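(* Let $d>2$ be an integer and let $\mathscr{T}_d$ be the $d$-regular tree. Fix $\beta>0$ with $\beta<\mathrm{artanh}(1/d^4)$. Then the Ising model on $\mathscr{T}_d$ at inverse temperature $\beta$ admits a unique realizing Gibbs measure $\mu$, and $\mu$ is $\psi$-mixing with exponential decay rate $$-\frac19\ln\tanh\beta-\frac49\ln d.$$
   Context: Let $S$ be the vertex set of $\mathscr{T}_d$, write $s\sim t$ for adjacent vertices, and let $d(\cdot,\cdot)$ be the path metric on $S$. Let $E=\{-1,1\}$, $\Omega=E^S$ with the product topology and Borel $\sigma$-algebra $\mathscr{F}$, with coordinate projections $\sigma_s$; for $\Lambda\subseteq S$, $\mathscr{F}_\Lambda$ is the $\sigma$-algebra generated by $\{\sigma_s:s\in\Lambda\}$, and $\sigma_\Lambda(\omega)=\omega_\Lambda$ is the restriction of $\omega$ to $\Lambda$. $\Lambda\sqsubseteq S$ means $\Lambda$ is a finite subset of $S$. For $w_\Lambda\in E^\Lambda$ and $\omega\in\Omega$, $w_\Lambda\omega_{\Lambda^c}$ is the configuration equal to $w_\Lambda$ on $\Lambda$ and to $\omega$ on $\Lambda^c$. The Ising model at inverse temperature $\beta>0$ is given by the potential $\Phi^\beta=(\Phi^\beta_\Delta)_{\Delta\sqsubseteq S}$ with $\Phi^\beta_\Delta(\omega)=-\beta\,\omega_s\omega_t$ if $\Delta=\{s,t\}$ with $s\sim t$, and $\Phi^\beta_\Delta\equiv0$ otherwise. For $\Lambda\sqsubseteq S$ put $H_\Lambda(\omega)=\sum_{\Delta\sqsubseteq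 S,\ \Delta\cap\Lambda\ne\emptyset}\Phi^\beta_\Delta(\omega)$ and $Z_\Lambda(\omega)=\sum_{w_\Lambda\in E^\Lambda}e^{-H_\Lambda(w_\Lambda\omega_{\Lambda^c})}$. A probability measure $\mu$ on $(\Omega,\mathscr{F})$ is a realizing Gibbs measure if for every $\Lambda\sqsubseteq S$ and $w_\Lambda\in E^\Lambda$, the conditional probability of $\{\sigma_\Lambda=w_\Lambda\}$ given $\mathscr{F}_{\Lambda^c}$ under $\mu$ equals $e^{-H_\Lambda(w_\Lambda\omega_{\Lambda^c})}/Z_\Lambda(\omega)$ for $\mu$-almost every $\omega$. For $U,V\subseteq S$ put $$\psi(U,V)=\sup\left\{\left|\frac{\mu(A\cap B)}{\mu(A)\mu(B)}-1\right|: A\in\mathscr{F}_U,\ B\in\mathscr{F}_V,\ \mu(A)\mu(B)>0\right\},$$ and for $\lambda>0$ put $\Sigma(\lambda,U,V)=\sum_{t\in U}\sum_{s\in V}e^{-\lambda d(t,s)}\in[0,\infty]$. The measure $\mu$ is $\psi$-mixing with exponential decay rate $\lambda$ if there is a constant $C\ge1$ such that $\psi(U,V)\le C\,\Sigma(\lambda,U,V)$ for all $U,V\subseteq S$ with $C\,\Sigma(\lambda,U,V)<1$. *)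

theory Defs
  imports "HOL-Probability.Probability"
begin

section \<open>Regular trees\<close>

text \<open>A graph is given by its vertex set \<open>S\<close> and its adjacency relation \<open>adj\<close>. A walk is
  the nonempty list of the vertices it visits.\<close>

definition walk :: "'v set \<Rightarrow> ('v \<Rightarrow> 'v \<Rightarrow> bool) \<Rightarrow> 'v list \<Rightarrow> bool" where
  "walk S adj xs \<longleftrightarrow> xs \<noteq> [] \<and> set xs \<subseteq> S \<and> successively adj xs"

definition simple_graph :: "'v set \<Rightarrow> ('v \<Rightarrow> 'v \<Rightarrow> bool) \<Rightarrow> bool" where
  "simple_graph S adj \<longleftrightarrow>
     (\<forall>s t. adj s t \<longrightarrow> s \<in> S \<and> t \<in> S \<and> s \<noteq> t \<and> adj t s)"

definition connected_graph :: "'v set \<Rightarrow> ('v \<Rightarrow> 'v \<Rightarrow> bool) \<Rightarrow> bool" where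
  "connected_graph S adj \<longleftrightarrow> S \<noteq> {} \<and>
     (\<forall>s\<in>S. \<forall>t\<in>S. \<exists>xs. walk S adj xs \<and> hd xs = s \<and> last xs = t)"

definition acyclic_graph :: "'v set \<Rightarrow> ('v \<Rightarrow> 'v \<Rightarrow> bool) \<Rightarrow> bool" where
  "acyclic_graph S adj \<longleftrightarrow>
     \<not> (\<exists>xs. walk S adj xs \<and> distinct xs \<and> length xs \<ge> 3 \<and> adj (last xs) (hd xs))"

definition regular_tree :: "nat \<Rightarrow> 'v set \<Rightarrow> ('v \<Rightarrow> 'v \<Rightarrow> bool) \<Rightarrow> bool" where
  "regular_tree d S adj \<longleftrightarrow>
     simple_graph S adj \<and> connected_graph S adj \<and> acyclic_graph S adj \<and>
     (\<forall>s\<in>S. finite {t\<in>S. adj s t} \<and> card {t\<in>S. adj s t} = d)"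

definition path_dist :: "'v set \<Rightarrow> ('v \<Rightarrow> 'v \<Rightarrow> bool) \<Rightarrow> 'v \<Rightarrow> 'v \<Rightarrow> nat" where
  "path_dist S adj s t =
     (LEAST n. \<exists>xs. walk S adj xs \<and> hd xs = s \<and> last xs = t \<and> length xs = Suc n)"

section \<open>Configurations\<close>

definition spins :: "real set" where
  "spins = {-1, 1}"

text \<open>\<open>configs \<Lambda>\<close> is $E^\Lambda$: functions on \<open>\<Lambda>\<close>, extended by \<open>undefined\<close> outside \<open>\<Lambda>\<close>.\<close>

definition configs :: "'v set \<Rightarrow> ('v \<Rightarrow> real) set" where
  "configs \<Lambda> = (\<Lambda> \<rightarrow>\<^sub>E spins)"

definition config_borel :: "'v set \<Rightarrow> ('v \<Rightarrow> real) measure" where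
  "config_borel S = sigma (configs S)
     {W. openin (product_topology (\<lambda>_. discrete_topology spins) S) W}"

definition coord_algebra :: "'v set \<Rightarrow> 'v set \<Rightarrow> ('v \<Rightarrow> real) measure" where
  "coord_algebra S \<Lambda> = sigma (configs S)
     {{\<omega> \<in> configs S. \<omega> s \<in> B} | s B. s \<in> \<Lambda> \<and> B \<subseteq> spins}"

section \<open>The Ising model\<close>

text \<open>For an edge \<open>\<Delta> = {s, t}\<close> the product below is \<open>\<omega> s * \<omega> t\<close>, as \<open>s \<noteq> t\<close>.\<close>

definition ising_potential ::
  "('v \<Rightarrow> 'v \<Rightarrow> bool) \<Rightarrow> real \<Rightarrow> 'v set \<Rightarrow> ('v \<Rightarrow> real) \<Rightarrow> real" where
  "ising_potential adj \<beta> \<Delta> \<omega> =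
     (if \<exists>s t. adj s t \<and> \<Delta> = {s, t} then - \<beta> * (\<Prod>s\<in>\<Delta>. \<omega> s) else 0)"

text \<open>On a locally finite graph only finitely many terms of this sum are nonzero.\<close>

definition hamiltonian ::
  "'v set \<Rightarrow> ('v \<Rightarrow> 'v \<Rightarrow> bool) \<Rightarrow> real \<Rightarrow> 'v set \<Rightarrow> ('v \<Rightarrow> real) \<Rightarrow> real" where
  "hamiltonian S adj \<beta> \<Lambda> \<omega> =
     (\<Sum>\<^sub>\<infinity>\<Delta>\<in>{\<Delta>. finite \<Delta> \<and> \<Delta> \<subseteq> S \<and> \<Delta> \<inter> \<Lambda> \<noteq> {}}. ising_potential adj \<beta> \<Delta> \<omega>)"

text \<open>\<open>merge \<Lambda> (S - \<Lambda>) (w, \<omega>)\<close> is $w_\Lambda\omega_{\Lambda^c}$.\<close>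

definition partition_fun ::
  "'v set \<Rightarrow> ('v \<Rightarrow> 'v \<Rightarrow> bool) \<Rightarrow> real \<Rightarrow> 'v set \<Rightarrow> ('v \<Rightarrow> real) \<Rightarrow> real" where
  "partition_fun S adj \<beta> \<Lambda> \<omega> =
     (\<Sum>w\<in>configs \<Lambda>. exp (- hamiltonian S adj \<beta> \<Lambda> (merge \<Lambda> (S - \<Lambda>) (w, \<omega>))))"

definition realizing_gibbs_measure ::
  "'v set \<Rightarrow> ('v \<Rightarrow> 'v \<Rightarrow> bool) \<Rightarrow> real \<Rightarrow> ('v \<Rightarrow> real) measure \<Rightarrow> bool" where
  "realizing_gibbs_measure S adj \<beta> \<mu> \<longleftrightarrow>
     prob_space \<mu> \<and> sets \<mu> = sets (config_borel S) \<and>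
     (\<forall>\<Lambda> w. finite \<Lambda> \<and> \<Lambda> \<subseteq> S \<and> w \<in> configs \<Lambda> \<longrightarrow>
        (AE \<omega> in \<mu>.
           real_cond_exp \<mu> (coord_algebra S (S - \<Lambda>))
             (indicator {\<omega> \<in> configs S. restrict \<omega> \<Lambda> = w}) \<omega>
           = exp (- hamiltonian S adj \<beta> \<Lambda> (merge \<Lambda> (S - \<Lambda>) (w, \<omega>)))
               / partition_fun S adj \<beta> \<Lambda> \<omega>))"

section \<open>Mixing\<close>

text \<open>The supremum is taken in \<open>[0, \<infinity>]\<close>; the set always contains \<open>0\<close>.\<close>

definition psi_coeff ::
  "'v set \<Rightarrow> ('v \<Rightarrow> real) measure \<Rightarrow> 'v set \<Rightarrow> 'v set \<Rightarrow> ennreal" where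
  "psi_coeff S \<mu> U V =
     Sup {ennreal \<bar>measure \<mu> (A \<inter> B) / (measure \<mu> A * measure \<mu> B) - 1\<bar> | A B.
            A \<in> sets (coord_algebra S U) \<and> B \<in> sets (coord_algebra S V) \<and>
            measure \<mu> A * measure \<mu> B > 0}"

definition exp_dist_sum ::
  "'v set \<Rightarrow> ('v \<Rightarrow> 'v \<Rightarrow> bool) \<Rightarrow> real \<Rightarrow> 'v set \<Rightarrow> 'v set \<Rightarrow> ennreal" where
  "exp_dist_sum S adj r U V =
     (\<Sum>\<^sub>\<infinity>t\<in>U. \<Sum>\<^sub>\<infinity>s\<in>V. ennreal (exp (- r * real (path_dist S adj t s))))"

definition psi_mixing_exp_rate ::
  "'v set \<Rightarrow> ('v \<Rightarrow> 'v \<Rightarrow> bool) \<Rightarrow> ('v \<Rightarrow> real) measure \<Rightarrow> real \<Rightarrow> bool" where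
  "psi_mixing_exp_rate S adj \<mu> r \<longleftrightarrow> r > 0 \<and>
     (\<exists>C::real. C \<ge> 1 \<and>
        (\<forall>U V. U \<subseteq> S \<and> V \<subseteq> S \<and> ennreal C * exp_dist_sum S adj r U V < 1 \<longrightarrow>
           psi_coeff S \<mu> U V \<le> ennreal C * exp_dist_sum S adj r U V))"

end

theory Submission
  imports Defs
begin

text \<open>Pinning the spin at \<open>s\<close> amounts to removing \<open>s\<close> and shifting the external fields at its
  neighbours. Shifting one field after another, one sees that the log-odds of the spin at \<open>x\<close> in a
  finite model with fields depend on the log-odds at the neighbours of \<open>x\<close>, in the model without \<open>x\<close>,
  through functions with Lipschitz constant \<open>tanh \<beta>\<close>. As \<open>d * tanh \<beta> < 1\<close>, the influence of
  \<open>s\<close> on \<open>x\<close> decays exponentially in their distance, uniformly in all fields, hence also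
  conditionally on the spins in any finite set. For finite \<open>U\<close> and \<open>V\<close>, the logarithm of
  \<open>\<mu>(u, v) / (\<mu>(u) \<mu>(v))\<close> telescopes into such conditional two-point terms, one for each pair
  in \<open>U \<times> V\<close>; this gives the mixing bound. The same contraction shows that cylinder probabilities
  in a large ball hardly depend on the boundary condition, whence uniqueness. Existence uses the
  tree: the Ising chain started at a root has the free Ising model as its marginal on every
  root_ball.\<close>

section \<open>Finite Ising models with external fields\<close>

text \<open>The coefficient psi compares ratios, and covariance bounds say nothing about ratios of
  rare events. All estimates are therefore relative errors, taken on the logarithmic scale. Such
  errors add up over atoms and survive approximation in measure, which carries the bound from
  cylinders to infinite \<open>U\<close> and \<open>V\<close>. The contraction is solved by guessing
  supersolutions (\<open>dominates\<close>): a function \<rho> that dominates the source term plus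
  tanh \<beta> times its own neighbour sum bounds the influence, so no sums over walks occur. A
  supersolution with decay q per step exists once 2 d tanh \<beta> \<le> q: half of it absorbs the
  source, half the neighbours. The rate r of the theorem satisfies exp(-r) = (d^4 tanh
  \<beta>)^(1/9). The base lies below 1, so this exceeds d^4 tanh \<beta>, which exceeds 2 d tanh
  \<beta> because d^3 \<ge> 27. For existence, the free models on nested balls of a tree are
  consistent, so a product space does the work of a weak limit.\<close>

lemma finite_configs: "finite \<Lambda> \<Longrightarrow> finite (configs \<Lambda>)"
  by (simp add: configs_def spins_def finite_PiE)

lemma bij_betw_configs_remove:
  assumes "x \<in> \<Lambda>" "x \<notin> X" "\<sigma> x \<in> spins"
  shows "bij_betw (\<lambda>u. u(x := \<sigma> x)) {u \<in> configs (\<Lambda> - {x}). \<forall>y\<in>X. u y = \<sigma> y}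
           {u \<in> configs \<Lambda>. \<forall>y\<in>insert x X. u y = \<sigma> y}"
\<comment> \<open>Members of \<open>configs (\<Lambda> - {x})\<close> are extensional, so deleting
  the spin at \<open>x\<close> means resetting it to \<open>undefined\<close>.\<close>
proof (rule bij_betw_byWitness[where f' = "\<lambda>u. u(x := undefined)"])
  show "\<forall>a\<in>{u \<in> configs (\<Lambda> - {x}). \<forall>y\<in>X. u y = \<sigma> y}. (a(x := \<sigma> x))(x := undefined) = a"
    by (auto simp: configs_def PiE_def extensional_def fun_eq_iff)
qed (use assms in \<open>auto simp: configs_def PiE_def extensional_def Pi_def\<close>)

locale ising_model =
  fixes adj :: "'v \<Rightarrow> 'v \<Rightarrow> bool" and \<beta> :: real
  assumes adj_sym: "adj s t \<Longrightarrow> adj t s"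
    and adj_irrefl: "\<not> adj s s"
    and beta_pos: "\<beta> > 0"
begin

text \<open>The double sum meets every edge once in each direction, hence the factor \<beta> /
  2.\<close>

definition wt :: "'v set \<Rightarrow> ('v \<Rightarrow> real) \<Rightarrow> ('v \<Rightarrow> real) \<Rightarrow> real" where
  "wt \<Lambda> h u =
     exp (\<beta> / 2 * (\<Sum>s\<in>\<Lambda>. \<Sum>t\<in>\<Lambda>. of_bool (adj s t) * u s * u t) + (\<Sum>s\<in>\<Lambda>. h s * u s))"

text \<open>An unnormalised cylinder probability. Without the normalisation, pinning a spin is an
  exact identity between models on different vertex sets.\<close>

definition cyl_sum :: "'v set \<Rightarrow> ('v \<Rightarrow> real) \<Rightarrow> 'v set \<Rightarrow> ('v \<Rightarrow> real) \<Rightarrow> real" where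
  "cyl_sum \<Lambda> h X \<sigma> = (\<Sum>u\<in>{u \<in> configs \<Lambda>. \<forall>x\<in>X. u x = \<sigma> x}. wt \<Lambda> h u)"

abbreviation part_sum :: "'v set \<Rightarrow> ('v \<Rightarrow> real) \<Rightarrow> real" where
  "part_sum \<Lambda> h \<equiv> cyl_sum \<Lambda> h {} (\<lambda>_. 1)"

definition log_odds :: "'v set \<Rightarrow> ('v \<Rightarrow> real) \<Rightarrow> 'v \<Rightarrow> real" where
  "log_odds \<Lambda> h x = ln (cyl_sum \<Lambda> h {x} (\<lambda>_. 1)) - ln (cyl_sum \<Lambda> h {x} (\<lambda>_. -1))"

lemma adj_commute: "adj s t \<longleftrightarrow> adj t s"
  using adj_sym by blast

lemma wt_pos: "wt \<Lambda> h u > 0"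
  by (simp add: wt_def)

lemma wt_cong:
  assumes "\<And>s. s \<in> \<Lambda> \<Longrightarrow> h s = h' s" "\<And>s. s \<in> \<Lambda> \<Longrightarrow> u s = u' s"
  shows "wt \<Lambda> h u = wt \<Lambda> h' u'"
  using assms by (simp add: wt_def)

lemma cyl_sum_cong:
  assumes "\<And>s. s \<in> \<Lambda> \<Longrightarrow> h s = h' s" "\<And>s. s \<in> X \<Longrightarrow> \<sigma> s = \<sigma>' s"
  shows "cyl_sum \<Lambda> h X \<sigma> = cyl_sum \<Lambda> h' X \<sigma>'"
  unfolding cyl_sum_def using assms by (intro sum.cong wt_cong) auto

lemma cyl_sum_pos:
  assumes "finite \<Lambda>" "X \<subseteq> \<Lambda>" "\<And>x. x \<in> X \<Longrightarrow> \<sigma> x \<in> spins"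
  shows "cyl_sum \<Lambda> h X \<sigma> > 0"
  unfolding cyl_sum_def
proof (rule sum_pos)
  show "finite {u \<in> configs \<Lambda>. \<forall>x\<in>X. u x = \<sigma> x}"
    using finite_configs[OF assms(1)] by simp
  have "(\<lambda>s. if s \<in> X then \<sigma> s else if s \<in> \<Lambda> then 1 else undefined)
          \<in> {u \<in> configs \<Lambda>. \<forall>x\<in>X. u x = \<sigma> x}"
    using assms(2,3) unfolding configs_def spins_def by fastforce
  then show "{u \<in> configs \<Lambda>. \<forall>x\<in>X. u x = \<sigma> x} \<noteq> {}" by blast
qed (rule wt_pos)

lemma part_sum_pos: "finite \<Lambda> \<Longrightarrow> part_sum \<Lambda> h > 0"
  by (rule cyl_sum_pos) auto

lemma cyl_sum_empty: "cyl_sum \<Lambda> h {} \<sigma> = part_sum \<Lambda> h"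
  by (rule cyl_sum_cong) auto

text \<open>An edge at \<open>x\<close> occurs twice in the double sum, which cancels the factor
  1/2. What remains is a field of size \<beta> times the spin at \<open>x\<close>, acting on the
  other endpoint.\<close>

lemma wt_remove:
  assumes "finite \<Lambda>" "x \<in> \<Lambda>"
  shows "wt \<Lambda> h u = exp (h x * u x) * wt (\<Lambda> - {x}) (\<lambda>s. h s + \<beta> * of_bool (adj x s) * u x) u"
proof -
  define \<Gamma> where "\<Gamma> = \<Lambda> - {x}"
  have \<Gamma>: "finite \<Gamma>" "x \<notin> \<Gamma>" "\<Lambda> = insert x \<Gamma>" using assms by (auto simp: \<Gamma>_def)
  have cross: "(\<Sum>s\<in>\<Gamma>. of_bool (adj s x) * u s * u x) = (\<Sum>t\<in>\<Gamma>. of_bool (adj x t) * u x * u t)"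
    by (intro sum.cong) (auto simp: adj_commute)
  have "(\<Sum>s\<in>\<Lambda>. \<Sum>t\<in>\<Lambda>. of_bool (adj s t) * u s * u t) =
      (\<Sum>s\<in>\<Gamma>. \<Sum>t\<in>\<Gamma>. of_bool (adj s t) * u s * u t) + 2 * (\<Sum>t\<in>\<Gamma>. of_bool (adj x t) * u x * u t)"
    using \<Gamma>(1,2) cross by (simp add: \<Gamma>(3) sum.distrib adj_irrefl)
  moreover have "(\<Sum>s\<in>\<Gamma>. (h s + \<beta> * of_bool (adj x s) * u x) * u s) =
      (\<Sum>s\<in>\<Gamma>. h s * u s) + \<beta> * (\<Sum>t\<in>\<Gamma>. of_bool (adj x t) * u x * u t)"
    by (simp add: distrib_right sum.distrib sum_distrib_left mult.assoc)
  moreover have "(\<Sum>s\<in>\<Lambda>. h s * u s) = h x * u x + (\<Sum>s\<in>\<Gamma>. h s * u s)"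
    using \<Gamma>(1,2) by (simp add: \<Gamma>(3))
  ultimately show ?thesis
    unfolding wt_def \<Gamma>_def[symmetric] exp_add[symmetric] by (simp add: distrib_left)
qed

lemma cyl_sum_remove:
  assumes "finite \<Lambda>" "x \<in> \<Lambda>" "x \<notin> X" "\<sigma> x \<in> spins"
  shows "cyl_sum \<Lambda> h (insert x X) \<sigma> =
    exp (h x * \<sigma> x) * cyl_sum (\<Lambda> - {x}) (\<lambda>s. h s + \<beta> * of_bool (adj x s) * \<sigma> x) X \<sigma>"
proof -
  have "cyl_sum \<Lambda> h (insert x X) \<sigma> =
      (\<Sum>u\<in>{u \<in> configs (\<Lambda> - {x}). \<forall>y\<in>X. u y = \<sigma> y}. wt \<Lambda> h (u(x := \<sigma> x)))"
    unfolding cyl_sum_def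
    by (rule sum.reindex_bij_betw[OF bij_betw_configs_remove, symmetric]) (use assms in auto)
  also have "\<dots> = (\<Sum>u\<in>{u \<in> configs (\<Lambda> - {x}). \<forall>y\<in>X. u y = \<sigma> y}.
      exp (h x * \<sigma> x) * wt (\<Lambda> - {x}) (\<lambda>s. h s + \<beta> * of_bool (adj x s) * \<sigma> x) u)"
  proof (rule sum.cong)
    fix u
    have "wt (\<Lambda> - {x}) (\<lambda>s. h s + \<beta> * of_bool (adj x s) * \<sigma> x) (u(x := \<sigma> x)) =
        wt (\<Lambda> - {x}) (\<lambda>s. h s + \<beta> * of_bool (adj x s) * \<sigma> x) u"
      by (rule wt_cong) auto
    then show "wt \<Lambda> h (u(x := \<sigma> x)) =
        exp (h x * \<sigma> x) * wt (\<Lambda> - {x}) (\<lambda>s. h s + \<beta> * of_bool (adj x s) * \<sigma> x) u"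
      using wt_remove[OF assms(1,2), of h "u(x := \<sigma> x)"] by simp
  qed simp
  finally show ?thesis by (simp add: cyl_sum_def sum_distrib_left)
qed

lemma cyl_sum_split:
  assumes "finite \<Lambda>" "x \<in> \<Lambda>" "x \<notin> X"
  shows "cyl_sum \<Lambda> h X \<sigma> =
    cyl_sum \<Lambda> h (insert x X) (\<sigma>(x := 1)) + cyl_sum \<Lambda> h (insert x X) (\<sigma>(x := -1))"
proof -
  have "{u \<in> configs \<Lambda>. \<forall>y\<in>X. u y = \<sigma> y} =
      {u \<in> configs \<Lambda>. \<forall>y\<in>insert x X. u y = (\<sigma>(x := 1)) y} \<union>
      {u \<in> configs \<Lambda>. \<forall>y\<in>insert x X. u y = (\<sigma>(x := -1)) y}"
    using assms(2,3) by (auto simp: configs_def spins_def PiE_def Pi_def)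
  then show ?thesis
    unfolding cyl_sum_def
    by (simp only:) (rule sum.union_disjoint, use finite_configs[OF assms(1)] in auto)
qed

lemma part_sum_split:
  assumes "finite \<Lambda>" "x \<in> \<Lambda>"
  shows "part_sum \<Lambda> h = cyl_sum \<Lambda> h {x} (\<lambda>_. 1) + cyl_sum \<Lambda> h {x} (\<lambda>_. -1)"
proof -
  have "cyl_sum \<Lambda> h {x} ((\<lambda>_. 1)(x := c)) = cyl_sum \<Lambda> h {x} (\<lambda>_. c)" for c
    by (rule cyl_sum_cong) auto
  then show ?thesis using cyl_sum_split[OF assms, of "{}" h "\<lambda>_. 1"] by simp
qed

lemma cyl_sum_single:
  assumes "finite \<Lambda>" "x \<in> \<Lambda>" "c \<in> spins"
  shows "cyl_sum \<Lambda> h {x} (\<lambda>_. c) =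
    exp (h x * c) * part_sum (\<Lambda> - {x}) (\<lambda>s. h s + \<beta> * of_bool (adj x s) * c)"
  using cyl_sum_remove[OF assms(1,2), of "{}" "\<lambda>_. c" h] assms(3)
  by (simp add: cyl_sum_empty[of _ _ "\<lambda>_. c"])

text \<open>The spin at \<open>x\<close> is felt by the rest only as a field +\<beta> or -\<beta> on
  its neighbours. The term \<open>2 * h x\<close> is the origin of the factor 2 in
  \<open>dominates\<close>.\<close>

lemma log_odds_eq:
  assumes "finite \<Lambda>" "x \<in> \<Lambda>"
  shows "log_odds \<Lambda> h x = 2 * h x +
    (ln (part_sum (\<Lambda> - {x}) (\<lambda>s. h s + \<beta> * of_bool (adj x s))) -
     ln (part_sum (\<Lambda> - {x}) (\<lambda>s. h s - \<beta> * of_bool (adj x s))))"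
  using part_sum_pos[of "\<Lambda> - {x}"] assms
  by (simp add: log_odds_def cyl_sum_single spins_def ln_mult less_imp_neq[symmetric])

text \<open>\<open>F\<close> is the cavity map of the Ising model, F(L) = 2 artanh (tanh \<beta>
  tanh (L/2)). Its slope is largest at L = 0, where it equals tanh \<beta>.\<close>

lemma ln_edge_lipschitz:
  fixes L L' :: real
  defines "F \<equiv> \<lambda>L. ln (exp (\<beta> + L) + exp (- \<beta>)) - ln (exp (L - \<beta>) + exp \<beta>)"
  shows "\<bar>F L - F L'\<bar> \<le> tanh \<beta> * \<bar>L - L'\<bar>"
proof -
  define F' where "F' = (\<lambda>L::real. exp (\<beta> + L) / (exp (\<beta> + L) + exp (- \<beta>)) -
                          exp (L - \<beta>) / (exp (L - \<beta>) + exp \<beta>))"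
  have deriv: "(F has_real_derivative F' L) (at L)" for L
    unfolding F_def F'_def
    by (auto intro!: derivative_eq_intros simp: add_pos_pos less_imp_neq[symmetric])
  have bound: "\<bar>F' L\<bar> \<le> tanh \<beta>" for L
  proof -
    define a y where "a = exp \<beta>" and "y = exp L"
    have a: "a > 1" and y: "y > 0" using beta_pos by (auto simp: a_def y_def)
    have p: "a * y + 1 / a > 0" "y / a + a > 0" using a y by (auto intro!: add_pos_pos)
    have "F' L = (a * y) / (a * y + 1 / a) - (y / a) / (y / a + a)"
      by (simp add: F'_def a_def y_def exp_add exp_diff exp_minus inverse_eq_divide mult.commute)
    also have "\<dots> = y * (a\<^sup>2 - 1 / a\<^sup>2) / ((a * y + 1 / a) * (y / a + a))"
      using p a by (simp add: divide_simps) (simp add: algebra_simps power2_eq_square power4_eq_xxxx)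
    finally have F': "F' L = y * (a\<^sup>2 - 1 / a\<^sup>2) / ((a * y + 1 / a) * (y / a + a))" .
    have num: "a\<^sup>2 - 1 / a\<^sup>2 = (a - 1 / a) * (a + 1 / a)"
      using a by (simp add: field_simps power2_eq_square)
    have "a - 1 / a > 0" using a by (simp add: field_simps) (metis less_1_mult)
    \<comment> \<open>The denominator exceeds its value at y = 1, scaled by y, by a perfect square;
      so the maximum of the slope is found without any further optimisation.\<close>
    have den: "(a * y + 1 / a) * (y / a + a) - y * (a + 1 / a)\<^sup>2 = (y - 1)\<^sup>2"
      using a by (simp add: field_simps power2_eq_square)
    have "F' L \<ge> 0"
      unfolding F' num using p y \<open>a - 1 / a > 0\<close> a by (intro divide_nonneg_pos mult_nonneg_nonneg) auto
    moreover have "F' L \<le> y * ((a - 1 / a) * (a + 1 / a)) / (y * (a + 1 / a)\<^sup>2)"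
      unfolding F' num
    proof (rule divide_left_mono)
      show "y * (a + 1 / a)\<^sup>2 \<le> (a * y + 1 / a) * (y / a + a)"
        using den zero_le_power2[of "y - 1"] by linarith
      show "0 \<le> y * ((a - 1 / a) * (a + 1 / a))"
        using y a \<open>a - 1 / a > 0\<close> by (intro mult_nonneg_nonneg) auto
      have "a + 1 / a > 0" using a by (intro add_pos_pos) auto
      then show "0 < (a * y + 1 / a) * (y / a + a) * (y * (a + 1 / a)\<^sup>2)"
        using p y by simp
    qed
    moreover have "y * ((a - 1 / a) * (a + 1 / a)) / (y * (a + 1 / a)\<^sup>2) = tanh \<beta>"
    proof -
      have "a + 1 / a > 0" using a by (intro add_pos_pos) auto
      then have "y * ((a - 1 / a) * (a + 1 / a)) / (y * (a + 1 / a)\<^sup>2) = (a - 1 / a) / (a + 1 / a)"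
        using y by (simp add: power2_eq_square)
      then show ?thesis
        by (simp add: tanh_altdef a_def exp_minus inverse_eq_divide)
    qed
    ultimately show ?thesis by simp
  qed
  have "norm (F L - F L') \<le> tanh \<beta> * norm (L - L')"
    by (rule field_differentiable_bound[of UNIV F F']) (use deriv bound in auto)
  then show ?thesis by simp
qed

text \<open>A field at the single site \<open>z\<close> only reweights the two classes of
  configurations with spin +1 or -1 at \<open>z\<close>. Their ratio is exp L, so the effect of the
  shift is a function of L alone.\<close>

lemma ln_part_sum_shift:
  fixes k :: "'v \<Rightarrow> real"
  assumes "finite \<Lambda>" "z \<in> \<Lambda>"
  defines "L \<equiv> log_odds \<Lambda> k z"
  shows "ln (part_sum \<Lambda> (\<lambda>s. k s + \<beta> * of_bool (s = z))) -
      ln (part_sum \<Lambda> (\<lambda>s. k s - \<beta> * of_bool (s = z))) =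
      ln (exp (\<beta> + L) + exp (- \<beta>)) - ln (exp (L - \<beta>) + exp \<beta>)"
proof -
  define P M where "P = cyl_sum \<Lambda> k {z} (\<lambda>_. 1)" and "M = cyl_sum \<Lambda> k {z} (\<lambda>_. -1)"
  have pos: "P > 0" "M > 0"
    unfolding P_def M_def using assms(1,2) by (auto intro!: cyl_sum_pos simp: spins_def)
  have P: "P = exp L * M"
    using pos by (simp add: L_def log_odds_def exp_diff flip: P_def M_def)
  have shift: "cyl_sum \<Lambda> (\<lambda>s. k s + c * of_bool (s = z)) {z} (\<lambda>_. a) =
      exp (c * a) * cyl_sum \<Lambda> k {z} (\<lambda>_. a)" if "a \<in> spins" for a c
  proof -
    have "part_sum (\<Lambda> - {z}) (\<lambda>s. k s + c * of_bool (s = z) + \<beta> * of_bool (adj z s) * a) =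
        part_sum (\<Lambda> - {z}) (\<lambda>s. k s + \<beta> * of_bool (adj z s) * a)"
      by (rule cyl_sum_cong) auto
    then show ?thesis
      using cyl_sum_single[OF assms(1,2) that, of k]
        cyl_sum_single[OF assms(1,2) that, of "\<lambda>s. k s + c * of_bool (s = z)"]
      by (simp add: distrib_right exp_add)
  qed
  have "part_sum \<Lambda> (\<lambda>s. k s + c * of_bool (s = z)) = exp c * P + exp (- c) * M" for c
    using shift[of 1 c] shift[of "-1" c] part_sum_split[OF assms(1,2)]
    by (simp add: spins_def P_def M_def)
  from this[of \<beta>] this[of "- \<beta>"]
  have "part_sum \<Lambda> (\<lambda>s. k s + \<beta> * of_bool (s = z)) = M * (exp (\<beta> + L) + exp (- \<beta>))"
    and "part_sum \<Lambda> (\<lambda>s. k s - \<beta> * of_bool (s = z)) = M * (exp (L - \<beta>) + exp \<beta>)"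
    by (simp_all add: P exp_add exp_diff exp_minus divide_inverse distrib_left mult_ac)
  moreover have "ln (M * c) = ln M + ln c" if "c > 0" for c
    using pos(2) that by (rule ln_mult_pos)
  ultimately show ?thesis
    by (simp add: add_pos_pos)
qed

end

text \<open>For a 2 x 2 table of weights this passes from the odds ratio to the ratio of a joint
  probability to the product of its marginals. The products a (a + b + c + d) and (a + b) (a + c)
  are a common part plus \<open>a * d\<close> and \<open>b * c\<close> respectively, and adding a
  common positive part only moves a ratio towards 1.\<close>

lemma ln_ratio_2x2_bound:
  fixes a b c d \<kappa> :: real
  assumes pos: "a > 0" "b > 0" "c > 0" "d > 0"
    and odds: "\<bar>(ln a - ln b) - (ln c - ln d)\<bar> \<le> \<kappa>"
  shows "\<bar>ln a + ln (a + b + c + d) - ln (a + b) - ln (a + c)\<bar> \<le> \<kappa>"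
proof -
  have \<kappa>: "exp \<kappa> \<ge> 1" using odds by simp
  define A where "A = a * a + a * b + a * c"
  have A: "A > 0" using pos by (simp add: A_def add_pos_pos)
  have mono: "ln (A + p) \<le> ln (A + q) + \<kappa>" if "ln p \<le> ln q + \<kappa>" "p > 0" "q > 0" for p q
  proof -
    have "p \<le> q * exp \<kappa>"
      using that by (metis exp_add exp_le_cancel_iff exp_ln)
    moreover have "A \<le> A * exp \<kappa>" using A \<kappa> by simp
    ultimately have "A + p \<le> (A + q) * exp \<kappa>" by (simp add: distrib_right)
    then have "ln (A + p) \<le> ln ((A + q) * exp \<kappa>)" using A that by simp
    then show ?thesis using A that by (simp add: ln_mult_pos)
  qed
  have "ln (a * d) \<le> ln (b * c) + \<kappa>" "ln (b * c) \<le> ln (a * d) + \<kappa>"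
    using odds pos by (simp_all add: ln_mult_pos)
  then have "\<bar>ln (A + a * d) - ln (A + b * c)\<bar> \<le> \<kappa>"
    using mono[of "a * d" "b * c"] mono[of "b * c" "a * d"] pos by (simp add: abs_le_iff)
  moreover have "A + a * d = a * (a + b + c + d)" "A + b * c = (a + b) * (a + c)"
    by (simp_all add: A_def algebra_simps)
  ultimately show ?thesis
    using pos by (simp add: ln_mult_pos add_pos_pos diff_diff_eq)
qed

text \<open>After cross-multiplication the comparison is between p m' and p' m, each with the common
  summand p p', which again only moves the ratio towards 1.\<close>

lemma ln_prob_le_odds:
  fixes p m p' m' \<kappa> :: real
  assumes pos: "p > 0" "m > 0" "p' > 0" "m' > 0"
    and odds: "\<bar>(ln p - ln m) - (ln p' - ln m')\<bar> \<le> \<kappa>"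
  shows "\<bar>(ln p - ln (p + m)) - (ln p' - ln (p' + m'))\<bar> \<le> \<kappa>"
proof -
  have \<kappa>: "exp \<kappa> \<ge> 1" using odds by simp
  have one_sided: "ln p - ln (p + m) \<le> ln p' - ln (p' + m') + \<kappa>"
    if "p > 0" "m > 0" "p' > 0" "m' > 0" "ln p - ln m \<le> ln p' - ln m' + \<kappa>" for p m p' m' :: real
  proof -
    have "ln (p * m') \<le> ln (p' * m * exp \<kappa>)"
      using that by (simp add: ln_mult_pos)
    then have "p * m' \<le> p' * m * exp \<kappa>" using that by simp
    moreover have "p * p' \<le> p' * p * exp \<kappa>" using that \<kappa> by simp
    ultimately have "p * (p' + m') \<le> p' * (p + m) * exp \<kappa>" by (simp add: algebra_simps)
    then have "ln (p * (p' + m')) \<le> ln (p' * (p + m) * exp \<kappa>)"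
      using that by (subst ln_le_cancel_iff) (auto intro!: mult_pos_pos add_pos_pos)
    then show ?thesis using that by (simp add: ln_mult_pos add_pos_pos)
  qed
  have "ln p - ln m \<le> ln p' - ln m' + \<kappa>" "ln p' - ln m' \<le> ln p - ln m + \<kappa>"
    using odds by linarith+
  then show ?thesis
    using one_sided[OF pos] one_sided[OF pos(3,4,1,2)] by (simp add: abs_le_iff)
qed

text \<open>The mixed second difference of \<open>f\<close> over \<open>U\<close> and
  \<open>V\<close> is the sum of elementary ones, obtained by inserting the points of
  \<open>U\<close> and \<open>V\<close> one at a time. \<open>W\<close> is the set of points already
  inserted, so the hypothesis has to allow every \<open>W\<close>.\<close>

lemma mixed_difference_bound:
  fixes f :: "'a set \<Rightarrow> real"
  assumes fin: "finite U" "finite V"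
    and pair: "\<And>W s t. W \<subseteq> U \<union> V \<Longrightarrow> s \<in> U - W \<Longrightarrow> t \<in> V - W \<Longrightarrow>
        \<bar>f (insert s (insert t W)) + f W - f (insert s W) - f (insert t W)\<bar> \<le> \<kappa> s t"
    and disj: "U \<inter> V = {}"
  shows "\<bar>f (U \<union> V) + f {} - f U - f V\<bar> \<le> (\<Sum>s\<in>U. \<Sum>t\<in>V. \<kappa> s t)"
proof -
  have row: "\<bar>f (insert s W \<union> V') + f W - f (insert s W) - f (W \<union> V')\<bar> \<le> (\<Sum>t\<in>V'. \<kappa> s t)"
    if "V' \<subseteq> V" "W \<subseteq> U" "s \<in> U - W" for W s V'
    using finite_subset[OF that(1) fin(2)] that(1)
  proof (induction V' rule: finite_induct)
    case (insert t V')
    then have "\<bar>f (insert s (insert t (W \<union> V'))) + f (W \<union> V') - f (insert s (W \<union> V')) -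
        f (insert t (W \<union> V'))\<bar> \<le> \<kappa> s t"
      using that disj by (intro pair) auto
    then show ?case
      using insert by (simp add: insert_commute)
  qed auto
  have "\<bar>f (U' \<union> V) + f {} - f U' - f V\<bar> \<le> (\<Sum>s\<in>U'. \<Sum>t\<in>V. \<kappa> s t)" if "U' \<subseteq> U" for U'
    using finite_subset[OF that fin(1)] that
  proof (induction U' rule: finite_induct)
    case (insert s U')
    then show ?case using row[of V U' s] by simp
  qed auto
  then show ?thesis by blast
qed

lemma abs_ln_le_imp:
  fixes r x :: real
  assumes "\<bar>ln r\<bar> \<le> x" "r > 0" "x \<le> 1"
  shows "\<bar>r - 1\<bar> \<le> 2 * x"
proof -
  have x: "0 \<le> x" using assms by linarith
  have "r \<le> exp x" using assms by (metis abs_le_D1 exp_le_cancel_iff exp_ln)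
  also have "exp x \<le> 1 + x + x\<^sup>2" using assms x by (intro exp_bound) auto
  also have "x\<^sup>2 \<le> x" using x assms(3) by (simp add: power2_eq_square mult_left_le)
  finally have "r \<le> 1 + 2 * x" by simp
  have "1 - x \<le> exp (- x)" using exp_ge_add_one_self[of "- x"] by simp
  also have "\<dots> \<le> r"
    using assms by (metis abs_le_D2 exp_le_cancel_iff exp_ln minus_le_iff)
  finally show ?thesis using \<open>r \<le> 1 + 2 * x\<close> x by linarith
qed

section \<open>Contraction of log-odds and its consequences for cylinders\<close>

context ising_model
begin

text \<open>The sites of \<open>N\<close> are switched from field +\<beta> to -\<beta> one after
  another. Each switch happens in a different intermediate field, which is why \<open>odds\<close>
  is assumed for all \<open>k\<close>.\<close>

lemma part_sum_shift_bound:
  assumes fin: "finite \<Lambda>" and N: "N \<subseteq> \<Lambda>"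
    and odds: "\<And>k z. z \<in> \<Lambda> \<Longrightarrow> \<bar>log_odds \<Lambda> (\<lambda>s. k s + \<delta> s) z - log_odds \<Lambda> k z\<bar> \<le> \<rho> z"
  defines "A \<equiv> \<lambda>k N. ln (part_sum \<Lambda> (\<lambda>s. k s + \<beta> * of_bool (s \<in> N))) -
                   ln (part_sum \<Lambda> (\<lambda>s. k s - \<beta> * of_bool (s \<in> N)))"
  shows "\<bar>A (\<lambda>s. k s + \<delta> s) N - A k N\<bar> \<le> tanh \<beta> * (\<Sum>z\<in>N. \<rho> z)"
  using finite_subset[OF N fin] N
proof (induction N arbitrary: k rule: finite_induct)
  case empty
  then show ?case by (simp add: A_def)
next
  case (insert z N)
  define S where "S = (\<lambda>k. ln (part_sum \<Lambda> (\<lambda>s. k s + \<beta> * of_bool (s = z))) -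
                          ln (part_sum \<Lambda> (\<lambda>s. k s - \<beta> * of_bool (s = z))))"
  \<comment> \<open>First \<open>z\<close> is switched while \<open>N\<close> still carries
    +\<beta>, then \<open>N\<close> is switched while \<open>z\<close> already carries
    -\<beta>.\<close>
  have split: "A k (insert z N) = S (\<lambda>s. k s + \<beta> * of_bool (s \<in> N)) +
      A (\<lambda>s. k s - \<beta> * of_bool (s = z)) N" for k
  proof -
    have "(of_bool (s \<in> insert z N) :: real) = of_bool (s \<in> N) + of_bool (s = z)" for s
      using insert.hyps by auto
    then show ?thesis by (simp add: A_def S_def algebra_simps)
  qed
  have "z \<in> \<Lambda>" using insert by simp
  have "\<bar>S (\<lambda>s. k s + \<beta> * of_bool (s \<in> N) + \<delta> s) - S (\<lambda>s. k s + \<beta> * of_bool (s \<in> N))\<bar>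
      \<le> tanh \<beta> * \<bar>log_odds \<Lambda> (\<lambda>s. k s + \<beta> * of_bool (s \<in> N) + \<delta> s) z -
          log_odds \<Lambda> (\<lambda>s. k s + \<beta> * of_bool (s \<in> N)) z\<bar>"
    unfolding S_def ln_part_sum_shift[OF fin \<open>z \<in> \<Lambda>\<close>] by (rule ln_edge_lipschitz)
  also have "\<dots> \<le> tanh \<beta> * \<rho> z"
    using odds[OF \<open>z \<in> \<Lambda>\<close>] beta_pos by (intro mult_left_mono) auto
  finally have 1: "\<bar>S (\<lambda>s. k s + \<delta> s + \<beta> * of_bool (s \<in> N)) - S (\<lambda>s. k s + \<beta> * of_bool (s \<in> N))\<bar>
      \<le> tanh \<beta> * \<rho> z" by (simp add: add_ac)
  have "\<bar>A (\<lambda>s. k s - \<beta> * of_bool (s = z) + \<delta> s) N - A (\<lambda>s. k s - \<beta> * of_bool (s = z)) N\<bar>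
      \<le> tanh \<beta> * (\<Sum>z\<in>N. \<rho> z)"
    using insert by auto
  then have 2: "\<bar>A (\<lambda>s. k s + \<delta> s - \<beta> * of_bool (s = z)) N - A (\<lambda>s. k s - \<beta> * of_bool (s = z)) N\<bar>
      \<le> tanh \<beta> * (\<Sum>z\<in>N. \<rho> z)" by (simp add: algebra_simps)
  show ?case
    using 1 2 insert.hyps unfolding split by (simp add: distrib_left)
qed

text \<open>\<rho> is a supersolution of the linearised recursion for log-odds with source
  \<open>2 * \<bar>\<delta> y\<bar>\<close>. Since \<rho> is nonnegative, this persists when
  vertices are deleted.\<close>

definition dominates :: "'v set \<Rightarrow> ('v \<Rightarrow> real) \<Rightarrow> ('v \<Rightarrow> real) \<Rightarrow> bool" where
  "dominates \<Lambda> \<rho> \<delta> \<longleftrightarrow>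
     (\<forall>y\<in>\<Lambda>. 0 \<le> \<rho> y \<and> 2 * \<bar>\<delta> y\<bar> + tanh \<beta> * (\<Sum>z\<in>{z \<in> \<Lambda>. adj y z}. \<rho> z) \<le> \<rho> y)"

lemma dominates_subset:
  assumes "dominates \<Lambda> \<rho> \<delta>" "\<Gamma> \<subseteq> \<Lambda>" "finite \<Lambda>"
  shows "dominates \<Gamma> \<rho> \<delta>"
  unfolding dominates_def
proof (intro ballI conjI)
  fix y assume "y \<in> \<Gamma>"
  have "(\<Sum>z\<in>{z \<in> \<Gamma>. adj y z}. \<rho> z) \<le> (\<Sum>z\<in>{z \<in> \<Lambda>. adj y z}. \<rho> z)"
    using assms by (intro sum_mono2) (auto simp: dominates_def)
  then have "tanh \<beta> * (\<Sum>z\<in>{z \<in> \<Gamma>. adj y z}. \<rho> z) \<le> tanh \<beta> * (\<Sum>z\<in>{z \<in> \<Lambda>. adj y z}. \<rho> z)"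
    using beta_pos by (intro mult_left_mono) auto
  then show "2 * \<bar>\<delta> y\<bar> + tanh \<beta> * (\<Sum>z\<in>{z \<in> \<Gamma>. adj y z}. \<rho> z) \<le> \<rho> y" "0 \<le> \<rho> y"
    using assms \<open>y \<in> \<Gamma>\<close> unfolding dominates_def by fastforce+
qed

text \<open>Deleting \<open>x\<close> expresses its log-odds by those of its neighbours in a smaller
  model, to which the induction on \<Lambda> applies. This is the self-avoiding-walk recursion; the
  supersolution property at \<open>x\<close> closes the step.\<close>

lemma log_odds_contraction:
  assumes "finite \<Lambda>" "dominates \<Lambda> \<rho> \<delta>" "x \<in> \<Lambda>"
  shows "\<bar>log_odds \<Lambda> (\<lambda>s. h s + \<delta> s) x - log_odds \<Lambda> h x\<bar> \<le> \<rho> x"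
  using assms
proof (induction \<Lambda> arbitrary: h x rule: finite_psubset_induct)
  case (psubset \<Lambda>)
  define \<Gamma> where "\<Gamma> = \<Lambda> - {x}"
  define N where "N = {z \<in> \<Gamma>. adj x z}"
  define A where "A = (\<lambda>k. ln (part_sum \<Gamma> (\<lambda>s. k s + \<beta> * of_bool (s \<in> N))) -
                   ln (part_sum \<Gamma> (\<lambda>s. k s - \<beta> * of_bool (s \<in> N))))"
  have "\<Gamma> \<subset> \<Lambda>" "finite \<Gamma>" "N \<subseteq> \<Gamma>" using psubset by (auto simp: \<Gamma>_def N_def)
  moreover have "dominates \<Gamma> \<rho> \<delta>"
    using dominates_subset psubset.prems psubset.hyps \<open>\<Gamma> \<subset> \<Lambda>\<close> by blast
  ultimately have A: "\<bar>A (\<lambda>s. h s + \<delta> s) - A h\<bar> \<le> tanh \<beta> * (\<Sum>z\<in>N. \<rho> z)"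
    unfolding A_def using psubset.IH by (intro part_sum_shift_bound)
  have odds: "log_odds \<Lambda> k x = 2 * k x + A k" for k
  proof -
    have "part_sum \<Gamma> (\<lambda>s. k s + \<beta> * of_bool (s \<in> N)) = part_sum \<Gamma> (\<lambda>s. k s + \<beta> * of_bool (adj x s))"
      "part_sum \<Gamma> (\<lambda>s. k s - \<beta> * of_bool (s \<in> N)) = part_sum \<Gamma> (\<lambda>s. k s - \<beta> * of_bool (adj x s))"
      by (auto intro!: cyl_sum_cong simp: N_def)
    then show ?thesis
      using log_odds_eq[OF psubset.hyps psubset.prems(2), of k] by (simp add: A_def flip: \<Gamma>_def)
  qed
  have "N = {z \<in> \<Lambda>. adj x z}" by (auto simp: N_def \<Gamma>_def adj_irrefl)
  then have "2 * \<bar>\<delta> x\<bar> + tanh \<beta> * (\<Sum>z\<in>N. \<rho> z) \<le> \<rho> x"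
    using psubset.prems by (auto simp: dominates_def)
  moreover have "\<bar>2 * (h x + \<delta> x) + a - (2 * h x + b)\<bar> \<le> 2 * \<bar>\<delta> x\<bar> + \<bar>a - b\<bar>" for a b
    using abs_triangle_ineq[of "2 * \<delta> x" "a - b"] by (simp add: algebra_simps)
  ultimately show ?case using A unfolding odds by (meson add_left_mono order_trans)
qed

lemma ln_cyl_sum_remove:
  assumes "finite \<Lambda>" "insert x X \<subseteq> \<Lambda>" "x \<notin> X" "\<And>y. y \<in> insert x X \<Longrightarrow> \<sigma> y \<in> spins"
  shows "ln (cyl_sum \<Lambda> h (insert x X) \<sigma>) = h x * \<sigma> x +
    ln (cyl_sum (\<Lambda> - {x}) (\<lambda>s. h s + \<beta> * of_bool (adj x s) * \<sigma> x) X \<sigma>)"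
proof -
  have "cyl_sum (\<Lambda> - {x}) (\<lambda>s. h s + \<beta> * of_bool (adj x s) * \<sigma> x) X \<sigma> > 0"
    using assms by (intro cyl_sum_pos) auto
  then show ?thesis
    using assms by (subst cyl_sum_remove) (auto simp: ln_mult_pos)
qed

text \<open>By the chain rule a cylinder probability is a product of conditional one-point
  probabilities. Each of these is a one-point probability in a model with pinned vertices removed,
  and contributes at most \<open>\<rho> x\<close>.\<close>

lemma cyl_prob_compare:
  assumes "finite \<Lambda>" "dominates \<Lambda> \<rho> \<delta>" "X \<subseteq> \<Lambda>" "\<And>x. x \<in> X \<Longrightarrow> \<sigma> x \<in> spins"
  defines "P \<equiv> \<lambda>\<Lambda> h X. ln (cyl_sum \<Lambda> h X \<sigma>) - ln (part_sum \<Lambda> h)"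
  shows "\<bar>P \<Lambda> (\<lambda>s. h s + \<delta> s) X - P \<Lambda> h X\<bar> \<le> (\<Sum>x\<in>X. \<rho> x)"
  using finite_subset[OF assms(3,1)] assms(1-4)
proof (induction X arbitrary: \<Lambda> h rule: finite_induct)
  case empty
  then show ?case by (simp add: P_def cyl_sum_empty[of _ _ \<sigma>])
next
  case (insert x X)
  define \<Gamma> where "\<Gamma> = \<Lambda> - {x}"
  define k where "k = (\<lambda>h s. h s + \<beta> * of_bool (adj x s) * \<sigma> x)"
  have x: "x \<in> \<Lambda>" "\<sigma> x \<in> spins" and \<Gamma>: "finite \<Gamma>" "X \<subseteq> \<Gamma>"
    using insert by (auto simp: \<Gamma>_def)
  have step: "P \<Lambda> h (insert x X) = P \<Gamma> (k h) X + P \<Lambda> h {x}" for h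
    using ln_cyl_sum_remove[of \<Lambda> x X \<sigma> h] ln_cyl_sum_remove[of \<Lambda> x "{}" \<sigma> h] insert.prems insert.hyps
    by (simp add: P_def \<Gamma>_def k_def cyl_sum_empty[of _ _ \<sigma>])
  \<comment> \<open>Pinning adds the same field to both models, so their difference is still
    \<delta> and the induction hypothesis applies.\<close>
  have shift: "k (\<lambda>s. h s + \<delta> s) = (\<lambda>s. k h s + \<delta> s)" by (auto simp: k_def)
  have 1: "\<bar>P \<Gamma> (\<lambda>s. k h s + \<delta> s) X - P \<Gamma> (k h) X\<bar> \<le> (\<Sum>x\<in>X. \<rho> x)"
    using insert \<Gamma> dominates_subset[of \<Lambda> \<rho> \<delta> \<Gamma>] by (intro insert.IH) (auto simp: \<Gamma>_def)
  have "\<bar>P \<Lambda> (\<lambda>s. h s + \<delta> s) {x} - P \<Lambda> h {x}\<bar> \<le> \<rho> x"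
  proof -
    define p m where "p = (\<lambda>h. cyl_sum \<Lambda> h {x} (\<lambda>_. \<sigma> x))"
      and "m = (\<lambda>h. cyl_sum \<Lambda> h {x} (\<lambda>_. - \<sigma> x))"
    have pos: "p h > 0" "m h > 0" for h
      unfolding p_def m_def using x insert.prems(1) by (auto intro!: cyl_sum_pos simp: spins_def)
    have "cyl_sum \<Lambda> h {x} \<sigma> = p h" for h
      unfolding p_def by (rule cyl_sum_cong) auto
    moreover have "part_sum \<Lambda> h = p h + m h" for h
      using x part_sum_split[OF insert.prems(1) x(1), of h] by (auto simp: p_def m_def spins_def)
    moreover have "\<bar>log_odds \<Lambda> h x - log_odds \<Lambda> h' x\<bar> =
        \<bar>(ln (p h) - ln (m h)) - (ln (p h') - ln (m h'))\<bar>" for h h'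
      using x(2) by (auto simp: log_odds_def p_def m_def spins_def)
    ultimately show ?thesis
      unfolding P_def
      using ln_prob_le_odds[OF pos pos] log_odds_contraction[OF insert.prems(1,2) x(1)] by simp
  qed
  then show ?case
    using 1 insert.hyps unfolding step shift by simp
qed

text \<open>Pinning \<open>W\<close> removes its vertices and adds a field, and a field factor
  common to all four terms drops out of the second difference. This leaves the case of empty
  \<open>W\<close>; \<kappa> must therefore bound the log-odds for all \<Gamma> and \<open>h\<close>
  at once.\<close>

lemma cyl_sum_pair:
  assumes "finite \<Lambda>" "W \<subseteq> \<Lambda>" "s \<in> \<Lambda> - W" "t \<in> \<Lambda> - W" "s \<noteq> t"
    and "\<And>x. x \<in> insert s (insert t W) \<Longrightarrow> \<sigma> x \<in> spins"
    and odds: "\<And>\<Gamma> h. \<Gamma> \<subseteq> \<Lambda> - {s} \<Longrightarrow> t \<in> \<Gamma> \<Longrightarrow>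
        \<bar>log_odds \<Gamma> (\<lambda>x. h x + \<beta> * of_bool (adj s x)) t -
         log_odds \<Gamma> (\<lambda>x. h x - \<beta> * of_bool (adj s x)) t\<bar> \<le> \<kappa>"
  defines "f \<equiv> \<lambda>\<Lambda> h X. ln (cyl_sum \<Lambda> h X \<sigma>)"
  shows "\<bar>f \<Lambda> h (insert s (insert t W)) + f \<Lambda> h W - f \<Lambda> h (insert s W) - f \<Lambda> h (insert t W)\<bar> \<le> \<kappa>"
  using finite_subset[OF assms(2,1)] assms(1-7)
proof (induction W arbitrary: \<Lambda> h rule: finite_induct)
  case empty
  \<comment> \<open>The four entries of the joint table of the spins at \<open>s\<close> and
    \<open>t\<close>; the terms of the second difference are an entry, its row and column sums, and
    the total.\<close>
  define m where "m = (\<lambda>a b. cyl_sum \<Lambda> h {s, t} (\<sigma>(s := a, t := b)))"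
  define a b where "a = \<sigma> s" and "b = \<sigma> t"
  have ab: "a \<in> spins" "b \<in> spins" using empty by (auto simp: a_def b_def)
  then have nab: "- a \<in> spins" "- b \<in> spins" by (auto simp: spins_def)
  have pos: "m a b > 0" if "a \<in> spins" "b \<in> spins" for a b
    unfolding m_def using empty that by (intro cyl_sum_pos) auto
  have split2: "g 1 + g (-1) = g c + g (- c)" if "c \<in> spins" for g :: "real \<Rightarrow> real" and c
    using that by (auto simp: spins_def)
  have fs: "cyl_sum \<Lambda> h {s} (\<sigma>(s := a)) = m a b + m a (- b)" for a
    using cyl_sum_split[OF empty.prems(1), of t "{s}" h "\<sigma>(s := a)"] empty.prems split2[OF ab(2)]
    by (simp add: m_def insert_commute)
  have ft: "cyl_sum \<Lambda> h {t} \<sigma> = m a b + m (- a) b"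
  proof -
    have "\<sigma>(s := c) = \<sigma>(s := c, t := b)" for c using empty.prems(5) by (auto simp: b_def)
    then show ?thesis
      using cyl_sum_split[OF empty.prems(1), of s "{t}" h \<sigma>] empty.prems
        split2[OF ab(1), of "\<lambda>c. cyl_sum \<Lambda> h {s, t} (\<sigma>(s := c))"]
      by (simp add: m_def)
  qed
  have fe: "cyl_sum \<Lambda> h {} \<sigma> = m a b + m a (- b) + m (- a) b + m (- a) (- b)"
    using cyl_sum_split[OF empty.prems(1), of s "{}" h \<sigma>] empty.prems
        split2[OF ab(1), of "\<lambda>c. cyl_sum \<Lambda> h {s} (\<sigma>(s := c))"] by (simp add: fs)
  have fst: "cyl_sum \<Lambda> h {s, t} \<sigma> = m a b"
    unfolding m_def by (rule cyl_sum_cong) (auto simp: a_def b_def)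
  have fs': "cyl_sum \<Lambda> h {s} \<sigma> = m a b + m a (- b)"
    using fs[of a] by (simp add: a_def)
  \<comment> \<open>Fixing the spin \<open>c\<close> at \<open>s\<close> yields the prefactor exp(h
    s c), which is the same for both values at \<open>t\<close> and cancels in the log-odds.\<close>
  have lo: "log_odds (\<Lambda> - {s}) (\<lambda>x. h x + \<beta> * of_bool (adj s x) * c) t =
      ln (m c 1) - ln (m c (- 1))" if "c \<in> spins" for c
  proof -
    have "ln (m c e) = h s * c +
        ln (cyl_sum (\<Lambda> - {s}) (\<lambda>x. h x + \<beta> * of_bool (adj s x) * c) {t} (\<lambda>_. e))"
      if e: "e \<in> spins" for e
    proof -
      have "cyl_sum (\<Lambda> - {s}) (\<lambda>x. h x + \<beta> * of_bool (adj s x) * c) {t} (\<sigma>(s := c, t := e)) =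
        cyl_sum (\<Lambda> - {s}) (\<lambda>x. h x + \<beta> * of_bool (adj s x) * c) {t} (\<lambda>_. e)"
        by (rule cyl_sum_cong) auto
      moreover have "(\<sigma>(s := c, t := e)) y \<in> spins" if "y \<in> {s, t}" for y
        using that \<open>c \<in> spins\<close> e by auto
      ultimately show ?thesis
        using ln_cyl_sum_remove[OF empty.prems(1), of s "{t}" "\<sigma>(s := c, t := e)" h]
          empty.prems(3-5) by (simp add: m_def)
    qed
    then show ?thesis by (simp add: log_odds_def spins_def)
  qed
  have "\<bar>(ln (m 1 1) - ln (m 1 (- 1))) - (ln (m (- 1) 1) - ln (m (- 1) (- 1)))\<bar> \<le> \<kappa>"
    using empty.prems(7)[of "\<Lambda> - {s}" h] lo[of 1] lo[of "-1"] empty.prems(4,5)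
    by (simp add: spins_def)
  then have "\<bar>(ln (m a b) - ln (m a (- b))) - (ln (m (- a) b) - ln (m (- a) (- b)))\<bar> \<le> \<kappa>"
    using ab by (auto simp: spins_def)
  then show ?case
    unfolding f_def fe ft fs' fst
    using pos ab nab by (intro ln_ratio_2x2_bound) auto
next
  case (insert x W)
  define \<Gamma> where "\<Gamma> = \<Lambda> - {x}"
  define k where "k = (\<lambda>s. h s + \<beta> * of_bool (adj x s) * \<sigma> x)"
  have "\<bar>f \<Gamma> k (insert s (insert t W)) + f \<Gamma> k W - f \<Gamma> k (insert s W) - f \<Gamma> k (insert t W)\<bar> \<le> \<kappa>"
    using insert.prems insert.hyps by (intro insert.IH) (auto simp: \<Gamma>_def)
  moreover have "f \<Lambda> h (insert x X) = h x * \<sigma> x + f \<Gamma> k X" if "X \<subseteq> insert s (insert t W)" for X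
  proof -
    have "x \<notin> X" using that insert.prems insert.hyps by auto
    then show ?thesis
      unfolding f_def \<Gamma>_def k_def using that insert.prems by (intro ln_cyl_sum_remove) auto
  qed
  ultimately show ?case
    by (simp add: insert_commute[of _ x] subset_insertI2 subset_insertI)
qed

text \<open>The quotient is the joint probability divided by the product of the marginals, with all
  normalisations collected in one \<open>part_sum\<close>.\<close>

lemma cyl_sum_mixing:
  assumes "finite \<Lambda>" "U \<subseteq> \<Lambda>" "V \<subseteq> \<Lambda>" "U \<inter> V = {}" "\<And>x. x \<in> U \<union> V \<Longrightarrow> \<sigma> x \<in> spins"
    and "\<And>\<Gamma> h s t. s \<in> U \<Longrightarrow> t \<in> V \<Longrightarrow> \<Gamma> \<subseteq> \<Lambda> - {s} \<Longrightarrow> t \<in> \<Gamma> \<Longrightarrow>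
        \<bar>log_odds \<Gamma> (\<lambda>x. h x + \<beta> * of_bool (adj s x)) t -
         log_odds \<Gamma> (\<lambda>x. h x - \<beta> * of_bool (adj s x)) t\<bar> \<le> \<kappa> s t"
    and "(\<Sum>s\<in>U. \<Sum>t\<in>V. \<kappa> s t) \<le> 1"
  shows "\<bar>cyl_sum \<Lambda> h (U \<union> V) \<sigma> * part_sum \<Lambda> h / (cyl_sum \<Lambda> h U \<sigma> * cyl_sum \<Lambda> h V \<sigma>) - 1\<bar>
    \<le> 2 * (\<Sum>s\<in>U. \<Sum>t\<in>V. \<kappa> s t)"
proof (rule abs_ln_le_imp)
  have pos: "cyl_sum \<Lambda> h X \<sigma> > 0" if "X \<subseteq> U \<union> V" for X
    using assms(1-5) that by (intro cyl_sum_pos) auto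
  have pos': "part_sum \<Lambda> h > 0" using assms(1) by (rule part_sum_pos)
  then show "cyl_sum \<Lambda> h (U \<union> V) \<sigma> * part_sum \<Lambda> h / (cyl_sum \<Lambda> h U \<sigma> * cyl_sum \<Lambda> h V \<sigma>) > 0"
    using pos by simp
  have "\<bar>ln (cyl_sum \<Lambda> h (U \<union> V) \<sigma>) + ln (cyl_sum \<Lambda> h {} \<sigma>) - ln (cyl_sum \<Lambda> h U \<sigma>) -
      ln (cyl_sum \<Lambda> h V \<sigma>)\<bar> \<le> (\<Sum>s\<in>U. \<Sum>t\<in>V. \<kappa> s t)"
  proof (rule mixed_difference_bound)
    fix W s t
    assume W: "W \<subseteq> U \<union> V" "s \<in> U - W" "t \<in> V - W"
    show "\<bar>ln (cyl_sum \<Lambda> h (insert s (insert t W)) \<sigma>) + ln (cyl_sum \<Lambda> h W \<sigma>) -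
        ln (cyl_sum \<Lambda> h (insert s W) \<sigma>) - ln (cyl_sum \<Lambda> h (insert t W) \<sigma>)\<bar> \<le> \<kappa> s t"
      by (rule cyl_sum_pair) (use W assms in auto)
  qed (use assms finite_subset in auto)
  then show "\<bar>ln (cyl_sum \<Lambda> h (U \<union> V) \<sigma> * part_sum \<Lambda> h / (cyl_sum \<Lambda> h U \<sigma> * cyl_sum \<Lambda> h V \<sigma>))\<bar>
      \<le> (\<Sum>s\<in>U. \<Sum>t\<in>V. \<kappa> s t)"
    using pos[of U] pos[of V] pos[of "U \<union> V"] pos'
    by (simp add: ln_mult_pos ln_divide_pos cyl_sum_empty[of _ _ \<sigma>])
qed (use assms in auto)

end

section \<open>Geometry of the regular tree\<close>

locale tree_ising =
  fixes d :: nat and S :: "'v set" and adj :: "'v \<Rightarrow> 'v \<Rightarrow> bool" and \<beta> :: real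
  assumes d_gt_2: "d > 2"
    and tree: "regular_tree d S adj"
    and beta_gt_0: "\<beta> > 0"
    and high_temp: "real d ^ 4 * tanh \<beta> < 1"
begin

sublocale ising_model adj \<beta>
  using tree beta_gt_0 by unfold_locales (auto simp: regular_tree_def simple_graph_def)

lemma adj_in_S: "adj s t \<Longrightarrow> s \<in> S" "adj s t \<Longrightarrow> t \<in> S"
  using tree by (auto simp: regular_tree_def simple_graph_def)

lemma
  assumes "s \<in> S"
  shows finite_nbrs: "finite {t. adj s t}" and card_nbrs: "card {t. adj s t} = d"
proof -
  have "{t. adj s t} = {t \<in> S. adj s t}" using adj_in_S by auto
  then show "finite {t. adj s t}" "card {t. adj s t} = d"
    using tree assms by (auto simp: regular_tree_def)
qed

abbreviation dst :: "'v \<Rightarrow> 'v \<Rightarrow> nat" where "dst \<equiv> path_dist S adj"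

lemma dst_le:
  assumes "walk S adj xs" "hd xs = s" "last xs = t" "length xs = Suc n"
  shows "dst s t \<le> n"
  unfolding path_dist_def using assms by (intro Least_le) auto

lemma dst_walk:
  assumes "s \<in> S" "t \<in> S"
  shows "\<exists>xs. walk S adj xs \<and> hd xs = s \<and> last xs = t \<and> length xs = Suc (dst s t)"
proof -
  obtain xs where "walk S adj xs" "hd xs = s" "last xs = t"
    using tree assms unfolding regular_tree_def connected_graph_def by blast
  moreover from this have "length xs = Suc (length xs - 1)"
    by (cases xs) (auto simp: walk_def)
  ultimately show ?thesis
    unfolding path_dist_def
    by (intro LeastI[of "\<lambda>n. \<exists>xs. walk S adj xs \<and> hd xs = s \<and> last xs = t \<and> length xs = Suc n"])
       blast
qed

lemma dst_self: "s \<in> S \<Longrightarrow> dst s s = 0"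
  using dst_le[of "[s]" s s 0] by (simp add: walk_def)

lemma dst_eq_0_imp_eq:
  assumes "s \<in> S" "t \<in> S" "dst s t = 0"
  shows "s = t"
  using dst_walk[OF assms(1,2)] assms(3) by (auto simp: length_Suc_conv)

lemma dst_step:
  assumes "s \<in> S" "adj z x"
  shows "dst s x \<le> Suc (dst s z)"
proof -
  obtain xs where xs: "walk S adj xs" "hd xs = s" "last xs = z" "length xs = Suc (dst s z)"
    using dst_walk[of s z] assms adj_in_S by auto
  show ?thesis
    by (rule dst_le[of "xs @ [x]"])
       (use xs assms adj_in_S in \<open>auto simp: walk_def successively_append_iff\<close>)
qed

lemma dst_pred:
  assumes "s \<in> S" "x \<in> S" "dst s x = Suc n"
  shows "\<exists>z. adj z x \<and> dst s z = n"
proof -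
  obtain xs where xs: "walk S adj xs" "hd xs = s" "last xs = x" "length xs = Suc (Suc n)"
    using dst_walk[OF assms(1,2)] assms(3) by auto
  define ys where "ys = butlast xs"
  have "xs \<noteq> []" using xs(4) by auto
  then have ys: "xs = ys @ [x]" "length ys = Suc n"
    using xs append_butlast_last_id[of xs] by (simp_all add: ys_def)
  then have "ys \<noteq> []" by auto
  have "adj (last ys) x" "walk S adj ys" "hd ys = s"
    using xs ys \<open>ys \<noteq> []\<close> by (auto simp: walk_def successively_append_iff)
  moreover from this have "dst s (last ys) \<le> n"
    using ys by (intro dst_le) auto
  moreover have "Suc n \<le> Suc (dst s (last ys))"
    using dst_step[OF assms(1), of "last ys" x] \<open>adj (last ys) x\<close> assms(3) by simp
  ultimately show ?thesis by (intro exI[of _ "last ys"]) auto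
qed

lemma finite_dst_ball:
  assumes "s \<in> S"
  shows "finite {x \<in> S. dst s x \<le> n}"
proof (induction n)
  case 0
  have "{x \<in> S. dst s x \<le> 0} \<subseteq> {s}" using dst_eq_0_imp_eq[OF assms] by auto
  then show ?case using finite_subset by blast
next
  case (Suc n)
  have "{x \<in> S. dst s x \<le> Suc n} \<subseteq>
      {x \<in> S. dst s x \<le> n} \<union> (\<Union>z\<in>{x \<in> S. dst s x \<le> n}. {x. adj z x})"
    using dst_pred[OF assms] adj_in_S by (fastforce simp: le_Suc_eq)
  then show ?case
    by (rule finite_subset) (use Suc finite_nbrs in auto)
qed

section \<open>Levels and parents with respect to a root\<close>

definition root :: 'v where "root = (SOME s. s \<in> S)"

definition lev :: "'v \<Rightarrow> nat" where "lev = dst root"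

definition root_ball :: "nat \<Rightarrow> 'v set" where "root_ball n = {x \<in> S. lev x \<le> n}"

text \<open>At \<open>root\<close> no vertex qualifies and the value is arbitrary, so statements
  about parents exclude the root.\<close>

definition par :: "'v \<Rightarrow> 'v" where "par s = (SOME z. adj z s \<and> Suc (lev z) = lev s)"

lemma root_in_S: "root \<in> S"
  using tree unfolding regular_tree_def connected_graph_def root_def by (metis ex_in_conv someI_ex)

lemma lev_root: "lev root = 0"
  by (simp add: lev_def dst_self root_in_S)

lemma lev_eq_0_iff: "s \<in> S \<Longrightarrow> lev s = 0 \<longleftrightarrow> s = root"
  using dst_eq_0_imp_eq[OF root_in_S, of s] lev_root by (auto simp: lev_def)

lemma lev_step: "adj s t \<Longrightarrow> lev t \<le> Suc (lev s)"
  unfolding lev_def using dst_step root_in_S by blast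

lemma finite_ball: "finite (root_ball n)"
  unfolding root_ball_def lev_def by (rule finite_dst_ball[OF root_in_S])

lemma ball_subset_S: "root_ball n \<subseteq> S"
  by (auto simp: root_ball_def)

lemma ball_mono: "m \<le> n \<Longrightarrow> root_ball m \<subseteq> root_ball n"
  by (auto simp: root_ball_def)

lemma countable_S: "countable S"
proof -
  have "S = (\<Union>n. root_ball n)" by (auto simp: root_ball_def)
  also have "countable \<dots>" by (intro countable_UN) (auto intro: countable_finite finite_ball)
  finally show ?thesis .
qed

lemma finite_subset_ball:
  assumes "finite X" "X \<subseteq> S"
  shows "\<exists>n0. \<forall>n\<ge>n0. X \<subseteq> root_ball n"
proof -
  have "lev x \<le> Max (lev ` X)" if "x \<in> X" for x using that assms by simp
  then show ?thesis
    using assms(2) by (intro exI[of _ "Max (lev ` X)"]) (force simp: root_ball_def)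
qed

lemma par_props:
  assumes "s \<in> S" "s \<noteq> root"
  shows "adj (par s) s" "Suc (lev (par s)) = lev s"
proof -
  obtain n where "dst root s = Suc n"
    using lev_eq_0_iff[OF assms(1)] assms(2) by (cases "dst root s") (auto simp: lev_def)
  then have "\<exists>z. adj z s \<and> Suc (lev z) = lev s"
    using dst_pred[OF root_in_S assms(1)] by (auto simp: lev_def)
  then have "adj (par s) s \<and> Suc (lev (par s)) = lev s"
    unfolding par_def by (rule someI_ex)
  then show "adj (par s) s" "Suc (lev (par s)) = lev s" by auto
qed

text \<open>Descending from \<open>s\<close> and \<open>t\<close> to their closest common ancestor gives a path inside the
  lower levels; an edge between \<open>s\<close> and \<open>t\<close>, or a common upper neighbour, would close a cycle.\<close>

lemma level_path:
  assumes "s \<in> S" "t \<in> S" "s \<noteq> t" "lev s = n" "lev t = n"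
  shows "\<exists>w. walk S adj w \<and> distinct w \<and> hd w = s \<and> last w = t \<and> length w \<ge> 3 \<and>
           (\<forall>x\<in>set w. lev x \<le> n)"
  using assms
proof (induction n arbitrary: s t)
  case 0
  then show ?case using lev_eq_0_iff by metis
next
  case (Suc n)
  define p q where "p = par s" and "q = par t"
  have "s \<noteq> root" "t \<noteq> root" using Suc.prems lev_root by auto
  then have p: "adj p s" "lev p = n" "p \<in> S" and q: "adj q t" "lev q = n" "q \<in> S"
    using par_props[of s] par_props[of t] Suc.prems adj_in_S unfolding p_def q_def by auto
  have *: "\<exists>w. walk S adj w \<and> distinct w \<and> hd w = p \<and> last w = q \<and> length w \<ge> 1 \<and>
      (\<forall>x\<in>set w. lev x \<le> n)"
  proof (cases "p = q")
    case True
    then show ?thesis using p by (intro exI[of _ "[p]"]) (auto simp: walk_def)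
  next
    case False
    then obtain w where "walk S adj w \<and> distinct w \<and> hd w = p \<and> last w = q \<and> length w \<ge> 3 \<and>
        (\<forall>x\<in>set w. lev x \<le> n)"
      using Suc.IH[of p q] p q by blast
    then show ?thesis by (intro exI[of _ w]) auto
  qed
  then obtain w where w: "walk S adj w" "distinct w" "hd w = p" "last w = q" "length w \<ge> 1"
    "\<forall>x\<in>set w. lev x \<le> n"
    by blast
  have "s \<notin> set w" "t \<notin> set w" using w(6) Suc.prems by auto
  moreover have "w \<noteq> []" using w by auto
  ultimately show ?case
    using w p q Suc.prems adj_sym
    by (intro exI[of _ "s # w @ [t]"])
       (auto simp: walk_def successively_Cons successively_append_iff hd_append)
qed

lemma acyclic: "walk S adj xs \<Longrightarrow> distinct xs \<Longrightarrow> length xs \<ge> 3 \<Longrightarrow> \<not> adj (last xs) (hd xs)"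
  using tree unfolding regular_tree_def acyclic_graph_def by blast

lemma adj_lev_neq:
  assumes "adj s t"
  shows "lev s \<noteq> lev t"
proof
  assume "lev s = lev t"
  moreover have "s \<in> S" "t \<in> S" "s \<noteq> t" using assms adj_in_S adj_irrefl by auto
  ultimately obtain w where "walk S adj w" "distinct w" "hd w = s" "last w = t" "length w \<ge> 3"
    using level_path by blast
  then show False using acyclic[of w] adj_sym[OF assms] by auto
qed

lemma par_unique:
  assumes "adj p s" "Suc (lev p) = lev s"
  shows "p = par s"
proof (rule ccontr)
  assume "p \<noteq> par s"
  have s: "s \<in> S" "s \<noteq> root" using assms adj_in_S lev_root by auto
  note par = par_props[OF s]
  obtain w where w: "walk S adj w" "distinct w" "hd w = p" "last w = par s" "length w \<ge> 3"
      "\<forall>x\<in>set w. lev x \<le> lev p"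
    using level_path[OF adj_in_S(1)[OF assms(1)] adj_in_S(1)[OF par(1)] \<open>p \<noteq> par s\<close> refl]
      par(2) assms(2) by auto
  have "s \<notin> set w" using w(6) assms(2) by auto
  moreover have "w \<noteq> []" using w by auto
  ultimately have "walk S adj (s # w)" "distinct (s # w)" "length (s # w) \<ge> 3"
    using w s adj_sym[OF assms(1)] by (auto simp: walk_def successively_Cons)
  then show False using acyclic[of "s # w"] w par(1) \<open>w \<noteq> []\<close> by auto
qed

text \<open>Every edge joins a vertex to its parent, in exactly one direction. The form with
  indicators can be substituted under the double sum of \<open>wt\<close>.\<close>

lemma adj_iff_par:
  assumes "s \<in> S" "t \<in> S"
  shows "(of_bool (adj s t) :: real) =
    of_bool (t \<noteq> root \<and> s = par t) + of_bool (s \<noteq> root \<and> t = par s)"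
proof -
  have or: "adj s t \<Longrightarrow> (t \<noteq> root \<and> s = par t) \<or> (s \<noteq> root \<and> t = par s)"
  proof -
    assume a: "adj s t"
    then have "lev t = Suc (lev s) \<or> lev s = Suc (lev t)"
      using lev_step[OF a] lev_step[OF adj_sym[OF a]] adj_lev_neq[OF a] by linarith
    then show ?thesis using par_unique a adj_sym lev_root by (metis nat.distinct(1))
  qed
  have imp: "(t \<noteq> root \<and> s = par t) \<Longrightarrow> adj s t" "(s \<noteq> root \<and> t = par s) \<Longrightarrow> adj s t"
    using par_props assms adj_sym by auto
  have excl: "\<not> ((t \<noteq> root \<and> s = par t) \<and> (s \<noteq> root \<and> t = par s))"
    using par_props(2)[OF assms(1)] par_props(2)[OF assms(2)] by fastforce
  have *: "(of_bool A :: real) = of_bool P + of_bool Q"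
    if "A \<Longrightarrow> P \<or> Q" "P \<Longrightarrow> A" "Q \<Longrightarrow> A" "\<not> (P \<and> Q)" for A P Q
    using that by auto
  show ?thesis by (rule *) (fact or imp excl)+
qed

lemma par_in_ball: "s \<in> root_ball n \<Longrightarrow> s \<noteq> root \<Longrightarrow> par s \<in> root_ball n"
  using par_props[of s] adj_in_S by (fastforce simp: root_ball_def)

text \<open>This turns the energy of the free model on a ball into a sum of one term per non-root
  vertex, so that the increments of the chain become independent.\<close>

lemma ball_edge_sum:
  "(\<Sum>s\<in>root_ball n. \<Sum>t\<in>root_ball n. of_bool (adj s t) * u s * u t) =
     2 * (\<Sum>s\<in>root_ball n - {root}. u s * u (par s))" for u :: "'v \<Rightarrow> real"
proof -
  let ?P = "\<lambda>s t. (of_bool (s \<noteq> root \<and> t = par s) :: real) * u s * u t"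
  have "(\<Sum>s\<in>root_ball n. \<Sum>t\<in>root_ball n. of_bool (adj s t) * u s * u t) =
      (\<Sum>s\<in>root_ball n. \<Sum>t\<in>root_ball n. ?P t s + ?P s t)"
    using adj_iff_par ball_subset_S
    by (intro sum.cong refl) (simp add: subset_eq distrib_right mult_ac)
  also have "\<dots> = (\<Sum>s\<in>root_ball n. \<Sum>t\<in>root_ball n. ?P t s) + (\<Sum>s\<in>root_ball n. \<Sum>t\<in>root_ball n. ?P s t)"
    by (simp add: sum.distrib)
  also have "(\<Sum>s\<in>root_ball n. \<Sum>t\<in>root_ball n. ?P t s) = (\<Sum>s\<in>root_ball n. \<Sum>t\<in>root_ball n. ?P s t)"
    by (rule sum.swap)
  also have "(\<Sum>s\<in>root_ball n. \<Sum>t\<in>root_ball n. ?P s t) = (\<Sum>s\<in>root_ball n. if s \<noteq> root then u s * u (par s) else 0)"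
  proof (intro sum.cong refl)
    fix s assume s: "s \<in> root_ball n"
    show "(\<Sum>t\<in>root_ball n. ?P s t) = (if s \<noteq> root then u s * u (par s) else 0)"
    proof (cases "s = root")
      case False
      then have "(\<Sum>t\<in>root_ball n. ?P s t) = (\<Sum>t\<in>root_ball n. if t = par s then u s * u t else 0)"
        by (intro sum.cong) auto
      then show ?thesis using False par_in_ball[OF s] by (simp add: finite_ball)
    qed simp
  qed
  also have "\<dots> = (\<Sum>s\<in>root_ball n - {root}. u s * u (par s))"
    by (rule sum.mono_neutral_cong_right) (auto simp: finite_ball)
  finally show ?thesis by simp
qed

section \<open>Supersolutions on the tree\<close>

lemma tanh_nonneg: "tanh \<beta> \<ge> 0"
  using beta_gt_0 by simp

lemma d_tanh_le: "2 * real d * tanh \<beta> \<le> real d ^ 4 * tanh \<beta>" "4 * real d * tanh \<beta> \<le> 1"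
proof -
  have "(3::real) ^ 3 \<le> real d ^ 3" using d_gt_2 by (intro power_mono) auto
  then have "27 * real d \<le> real d ^ 3 * real d" by (intro mult_right_mono) auto
  then have *: "27 * real d \<le> real d ^ 4" by (simp add: power4_eq_xxxx power3_eq_cube)
  then show "2 * real d * tanh \<beta> \<le> real d ^ 4 * tanh \<beta>"
    using tanh_nonneg by (intro mult_right_mono) auto
  have "4 * real d * tanh \<beta> \<le> real d ^ 4 * tanh \<beta>"
    using * tanh_nonneg by (intro mult_right_mono) auto
  then show "4 * real d * tanh \<beta> \<le> 1" using high_temp by simp
qed

lemma tanh_nbr_sum_le:
  assumes "y \<in> S" "c \<ge> 0" "\<And>z. z \<in> \<Lambda> \<Longrightarrow> adj y z \<Longrightarrow> \<rho> z \<le> c"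
  shows "tanh \<beta> * (\<Sum>z\<in>{z \<in> \<Lambda>. adj y z}. \<rho> z) \<le> d * tanh \<beta> * c"
proof -
  have "card {z \<in> \<Lambda>. adj y z} \<le> d"
    using card_mono[OF finite_nbrs[OF assms(1)], of "{z \<in> \<Lambda>. adj y z}"] card_nbrs[OF assms(1)] by auto
  have "(\<Sum>z\<in>{z \<in> \<Lambda>. adj y z}. \<rho> z) \<le> real (card {z \<in> \<Lambda>. adj y z}) * c"
    using assms(3) by (intro sum_bounded_above) auto
  also have "\<dots> \<le> real d * c"
    using \<open>card _ \<le> d\<close> assms(2) by (intro mult_right_mono) auto
  finally have "tanh \<beta> * (\<Sum>z\<in>{z \<in> \<Lambda>. adj y z}. \<rho> z) \<le> tanh \<beta> * (real d * c)"
    using tanh_nonneg by (rule mult_left_mono)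
  then show ?thesis by (simp add: mult_ac)
qed

text \<open>The source is the difference between the fields created by spin +1 and spin -1 at
  \<open>s\<close>. Half of \<rho> absorbs it: at distance 1 this half is 4 \<beta>, which fixes the
  constant 8. The other half absorbs the at most \<open>d\<close> neighbours, whose values exceed
  that at \<open>y\<close> by at most the factor 1 / q.\<close>

lemma dominates_point:
  assumes "finite \<Lambda>" "\<Lambda> \<subseteq> S - {s}" "s \<in> S" "2 * real d * tanh \<beta> \<le> q" "0 < q" "q \<le> 1"
  shows "dominates \<Lambda> (\<lambda>x. 8 * \<beta> / q * q ^ dst s x) (\<lambda>x. 2 * \<beta> * of_bool (adj s x))"
  unfolding dominates_def
proof (intro ballI conjI)
  fix y assume y: "y \<in> \<Lambda>"
  define K where "K = 8 * \<beta> / q"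
  have K: "K \<ge> 0" "K * q = 8 * \<beta>" using assms beta_gt_0 by (auto simp: K_def)
  have "y \<in> S" "y \<noteq> s" using y assms by auto
  \<comment> \<open>As \<open>s\<close> itself is excluded from \<Lambda>, the distance is positive
    and a neighbour of \<open>y\<close> has distance at least \<open>n\<close>.\<close>
  then obtain n where n: "dst s y = Suc n"
    using dst_eq_0_imp_eq[OF assms(3)] by (cases "dst s y") auto
  have "tanh \<beta> * (\<Sum>z\<in>{z \<in> \<Lambda>. adj y z}. K * q ^ dst s z) \<le> d * tanh \<beta> * (K * q ^ n)"
  proof (rule tanh_nbr_sum_le[OF \<open>y \<in> S\<close>])
    fix z assume "adj y z"
    then have "n \<le> dst s z" using dst_step[OF assms(3) adj_sym] n by fastforce
    then show "K * q ^ dst s z \<le> K * q ^ n"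
      using assms K by (intro mult_left_mono power_decreasing) auto
  qed (use K assms in auto)
  also have "\<dots> \<le> q / 2 * (K * q ^ n)"
    using assms K by (intro mult_right_mono) auto
  also have "\<dots> = K * q ^ dst s y / 2" by (simp add: n)
  finally have 1: "tanh \<beta> * (\<Sum>z\<in>{z \<in> \<Lambda>. adj y z}. K * q ^ dst s z) \<le> K * q ^ dst s y / 2" .
  have 2: "2 * \<bar>2 * \<beta> * of_bool (adj s y)\<bar> \<le> K * q ^ dst s y / 2"
  proof (cases "adj s y")
    case True
    then have "dst s y \<le> 1" using dst_step[OF assms(3) True] dst_self[OF assms(3)] by simp
    then have "dst s y = 1" using n by simp
    then show ?thesis using True K beta_gt_0 by simp
  qed (use K assms in auto)
  show "2 * \<bar>2 * \<beta> * of_bool (adj s y)\<bar> + tanh \<beta> * (\<Sum>z\<in>{z \<in> \<Lambda>. adj y z}. 8 * \<beta> / q * q ^ dst s z)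
      \<le> 8 * \<beta> / q * q ^ dst s y"
    using 1 2 unfolding K_def by linarith
  show "0 \<le> 8 * \<beta> / q * q ^ dst s y" using beta_gt_0 assms by simp
qed

text \<open>A disturbance of the fields on the outermost sphere, damped by 1/2 per level towards the
  root. Half of \<rho> absorbs the source of size at most 2 d \<beta> at level \<open>n\<close>, and
  4 d tanh \<beta> \<le> 1 leaves the other half for the neighbours.\<close>

lemma dominates_boundary:
  assumes "\<And>x. x \<in> root_ball n \<Longrightarrow> \<bar>\<delta> x\<bar> \<le> real d * \<beta>" "\<And>x. x \<in> root_ball n \<Longrightarrow> lev x < n \<Longrightarrow> \<delta> x = 0"
  shows "dominates (root_ball n) (\<lambda>x. 4 * real d * \<beta> * (1 / 2) ^ (n - lev x)) \<delta>"
  unfolding dominates_def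
proof (intro ballI conjI)
  fix y assume y: "y \<in> root_ball n"
  define K where "K = 4 * real d * \<beta>"
  have K: "K \<ge> 0" using beta_gt_0 by (auto simp: K_def)
  have "y \<in> S" using y ball_subset_S by auto
  have "tanh \<beta> * (\<Sum>z\<in>{z \<in> root_ball n. adj y z}. K * (1 / 2) ^ (n - lev z)) \<le>
      d * tanh \<beta> * (2 * (K * (1 / 2) ^ (n - lev y)))"
  proof (rule tanh_nbr_sum_le[OF \<open>y \<in> S\<close>])
    fix z assume "adj y z"
    \<comment> \<open>The level rises by at most one along an edge, so \<rho> at most
      doubles.\<close>
    then have "n - lev y \<le> Suc (n - lev z)" using lev_step[of y z] by linarith
    then have "(1 / 2 :: real) ^ Suc (n - lev z) \<le> (1 / 2) ^ (n - lev y)"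
      by (intro power_decreasing) auto
    then have "K * (1 / 2) ^ (n - lev z) \<le> K * (2 * (1 / 2) ^ (n - lev y))"
      using K by (intro mult_left_mono) auto
    then show "K * (1 / 2) ^ (n - lev z) \<le> 2 * (K * (1 / 2) ^ (n - lev y))" by simp
  qed (use K in auto)
  also have "\<dots> = (4 * real d * tanh \<beta>) * (K * (1 / 2) ^ (n - lev y)) / 2" by simp
  also have "\<dots> \<le> 1 * (K * (1 / 2) ^ (n - lev y)) / 2"
    using d_tanh_le(2) K by (intro divide_right_mono mult_right_mono) auto
  finally have 1: "tanh \<beta> * (\<Sum>z\<in>{z \<in> root_ball n. adj y z}. K * (1 / 2) ^ (n - lev z)) \<le>
      K * (1 / 2) ^ (n - lev y) / 2" by simp
  have 2: "2 * \<bar>\<delta> y\<bar> \<le> K * (1 / 2) ^ (n - lev y) / 2"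
  proof (cases "lev y < n")
    case True
    then show ?thesis using assms(2)[OF y] K by simp
  next
    case False
    then show ?thesis using assms(1)[OF y] by (simp add: K_def mult.commute)
  qed
  show "2 * \<bar>\<delta> y\<bar> + tanh \<beta> * (\<Sum>z\<in>{z \<in> root_ball n. adj y z}. 4 * real d * \<beta> * (1 / 2) ^ (n - lev z))
      \<le> 4 * real d * \<beta> * (1 / 2) ^ (n - lev y)"
    using 1 2 unfolding K_def by linarith
  show "0 \<le> 4 * real d * \<beta> * (1 / 2) ^ (n - lev y)" using K by (simp add: K_def)
qed

lemma log_odds_point_bound:
  assumes "finite \<Gamma>" "\<Gamma> \<subseteq> S - {s}" "s \<in> S" "t \<in> \<Gamma>" "2 * real d * tanh \<beta> \<le> q" "0 < q" "q \<le> 1"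
  shows "\<bar>log_odds \<Gamma> (\<lambda>x. h x + \<beta> * of_bool (adj s x)) t -
      log_odds \<Gamma> (\<lambda>x. h x - \<beta> * of_bool (adj s x)) t\<bar> \<le> 8 * \<beta> / q * q ^ dst s t"
proof -
  have "(\<lambda>x. h x + \<beta> * of_bool (adj s x)) =
      (\<lambda>x. (h x - \<beta> * of_bool (adj s x)) + 2 * \<beta> * of_bool (adj s x))"
    by (simp add: fun_eq_iff)
  then show ?thesis
    using log_odds_contraction[OF assms(1) dominates_point[OF assms(1-3,5-7)] assms(4),
        of "\<lambda>x. h x - \<beta> * of_bool (adj s x)"] by simp
qed

end

section \<open>Cylinder sets\<close>

definition cyl :: "'v set \<Rightarrow> 'v set \<Rightarrow> ('v \<Rightarrow> real) \<Rightarrow> ('v \<Rightarrow> real) set" where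
  "cyl S X v = {\<omega> \<in> configs S. \<forall>x\<in>X. \<omega> x = v x}"

lemma space_coord_algebra [simp]: "space (coord_algebra S U) = configs S"
  unfolding coord_algebra_def by (rule space_measure_of) auto

lemma sets_coord_algebra:
  "sets (coord_algebra S U) =
     sigma_sets (configs S) {{\<omega> \<in> configs S. \<omega> s \<in> B} | s B. s \<in> U \<and> B \<subseteq> spins}"
  unfolding coord_algebra_def by (rule sets_measure_of) auto

lemma sets_coord_algebra_mono: "U \<subseteq> V \<Longrightarrow> sets (coord_algebra S U) \<subseteq> sets (coord_algebra S V)"
  unfolding sets_coord_algebra by (rule sigma_sets_mono') auto

lemma cyl_coord_algebra:
  assumes "finite X" "X \<subseteq> U" "U \<subseteq> S"
  shows "cyl S X v \<in> sets (coord_algebra S U)"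
  using assms(1,2)
proof (induction X rule: finite_induct)
  case empty
  then show ?case using sets.top[of "coord_algebra S U"] by (simp add: cyl_def)
next
  case (insert x X)
  have "x \<in> S" using insert assms(3) by auto
  then have "cyl S (insert x X) v = {\<omega> \<in> configs S. \<omega> x \<in> {v x} \<inter> spins} \<inter> cyl S X v"
    by (auto simp: cyl_def configs_def)
  moreover have "{\<omega> \<in> configs S. \<omega> x \<in> {v x} \<inter> spins} \<in> sets (coord_algebra S U)"
    unfolding sets_coord_algebra using insert by (intro sigma_sets.Basic) blast
  ultimately show ?case using insert by auto
qed

lemma coord_algebra_determined:
  assumes "A \<in> sets (coord_algebra S X)" "\<omega> \<in> configs S" "\<omega>' \<in> configs S" "\<And>x. x \<in> X \<Longrightarrow> \<omega> x = \<omega>' x"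
  shows "\<omega> \<in> A \<longleftrightarrow> \<omega>' \<in> A"
  using assms(1) unfolding sets_coord_algebra
proof (induction rule: sigma_sets.induct)
  case (Basic A)
  then show ?case using assms by auto
qed (use assms in auto)

lemma cyl_partition:
  assumes "X \<subseteq> Y" "Y \<subseteq> S"
  shows "cyl S X \<sigma> = (\<Union>u\<in>{u \<in> configs Y. \<forall>x\<in>X. u x = \<sigma> x}. cyl S Y u)"
proof (intro equalityI subsetI)
  fix \<omega> assume "\<omega> \<in> cyl S X \<sigma>"
  then have "restrict \<omega> Y \<in> {u \<in> configs Y. \<forall>x\<in>X. u x = \<sigma> x}" "\<omega> \<in> cyl S Y (restrict \<omega> Y)"
    using assms by (auto simp: cyl_def configs_def PiE_def Pi_def)
  then show "\<omega> \<in> (\<Union>u\<in>{u \<in> configs Y. \<forall>x\<in>X. u x = \<sigma> x}. cyl S Y u)" by blast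
next
  fix \<omega> assume "\<omega> \<in> (\<Union>u\<in>{u \<in> configs Y. \<forall>x\<in>X. u x = \<sigma> x}. cyl S Y u)"
  then show "\<omega> \<in> cyl S X \<sigma>" using assms by (auto simp: cyl_def)
qed

lemma disjoint_family_on_cyl: "disjoint_family_on (cyl S Y) (configs Y)"
  unfolding disjoint_family_on_def configs_def
proof (intro ballI impI)
  fix u v assume uv: "u \<in> Y \<rightarrow>\<^sub>E spins" "v \<in> Y \<rightarrow>\<^sub>E spins" "u \<noteq> v"
  then obtain x where "x \<in> Y" "u x \<noteq> v x" by (metis PiE_ext)
  then show "cyl S Y u \<inter> cyl S Y v = {}" by (auto simp: cyl_def)
qed

lemma coord_algebra_finite_eq_cyls:
  assumes "A \<in> sets (coord_algebra S X)" "X \<subseteq> S"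
  shows "A = (\<Union>u\<in>{u \<in> configs X. cyl S X u \<subseteq> A}. cyl S X u)"
proof (intro equalityI subsetI)
  fix \<omega> assume "\<omega> \<in> A"
  then have \<omega>: "\<omega> \<in> configs S" using sets.sets_into_space[OF assms(1)] by auto
  have "cyl S X (restrict \<omega> X) \<subseteq> A"
    using coord_algebra_determined[OF assms(1) \<omega>] \<open>\<omega> \<in> A\<close> by (auto simp: cyl_def)
  moreover have "restrict \<omega> X \<in> configs X" "\<omega> \<in> cyl S X (restrict \<omega> X)"
    using \<omega> assms(2) by (auto simp: cyl_def configs_def PiE_def Pi_def)
  ultimately show "\<omega> \<in> (\<Union>u\<in>{u \<in> configs X. cyl S X u \<subseteq> A}. cyl S X u)" by blast
qed auto

text \<open>Basic open sets restrict finitely many coordinates and are unions of cylinders. Over a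
  countable \<open>S\<close> there are only countably many cylinders, so every open set is a
  countable union of them.\<close>

lemma sets_config_borel:
  assumes "countable S"
  shows "sets (config_borel S) = sets (coord_algebra S S)"
proof -
  let ?T = "product_topology (\<lambda>_. discrete_topology spins) S"
  let ?O = "{W. openin ?T W}"
  have O: "?O \<subseteq> Pow (configs S)"
    using openin_subset[of ?T] by (auto simp: configs_def)
  have "W \<in> sets (coord_algebra S S)" if W: "openin ?T W" for W
  proof -
    define C where "C = {cyl S F v | F v. F \<in> {F. finite F \<and> F \<subseteq> S} \<and> v \<in> configs F}"
    have "countable C"
    proof -
      have "C = (\<Union>F\<in>{F. finite F \<and> F \<subseteq> S}. cyl S F ` configs F)"
        by (auto simp: C_def)
      moreover have "countable (cyl S F ` configs F)" if "finite F" for F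
        using finite_configs[OF that] by (intro countable_finite) simp
      ultimately show ?thesis
        using assms by (auto intro!: countable_UN countable_Collect_finite_subset)
    qed
    have "W = \<Union>{c \<in> C. c \<subseteq> W}"
    proof (intro equalityI subsetI)
      fix \<omega> assume "\<omega> \<in> W"
      then obtain D where D: "finite {i \<in> S. D i \<noteq> spins}" "\<omega> \<in> Pi\<^sub>E S D" "Pi\<^sub>E S D \<subseteq> W"
        using W unfolding openin_product_topology_alt by fastforce
      define F where "F = {i \<in> S. D i \<noteq> spins}"
      have \<omega>: "\<omega> \<in> configs S" using O W \<open>\<omega> \<in> W\<close> by auto
      have "cyl S F (restrict \<omega> F) \<subseteq> Pi\<^sub>E S D"
      proof
        fix \<eta> assume "\<eta> \<in> cyl S F (restrict \<omega> F)"
        then have \<eta>: "\<eta> \<in> S \<rightarrow>\<^sub>E spins" "\<And>x. x \<in> F \<Longrightarrow> \<eta> x = \<omega> x"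
          by (auto simp: cyl_def configs_def)
        have "\<eta> x \<in> D x" if "x \<in> S" for x
          using D(2) \<eta> that by (cases "x \<in> F") (auto simp: F_def PiE_def Pi_def)
        then show "\<eta> \<in> Pi\<^sub>E S D" using \<eta>(1) by auto
      qed
      moreover have "restrict \<omega> F \<in> configs F"
        using \<omega> by (auto simp: configs_def F_def PiE_def Pi_def)
      moreover have "F \<in> {F. finite F \<and> F \<subseteq> S}" using D by (auto simp: F_def)
      ultimately have "cyl S F (restrict \<omega> F) \<in> {c \<in> C. c \<subseteq> W}"
        using D(3) unfolding C_def by blast
      moreover have "\<omega> \<in> cyl S F (restrict \<omega> F)" using \<omega> by (simp add: cyl_def)
      ultimately show "\<omega> \<in> \<Union>{c \<in> C. c \<subseteq> W}" by blast
    qed auto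
    moreover have "\<Union>{c \<in> C. c \<subseteq> W} \<in> sets (coord_algebra S S)"
    proof (rule sets.countable_Union)
      show "countable {c \<in> C. c \<subseteq> W}" using \<open>countable C\<close> by (rule countable_subset[rotated]) auto
    qed (auto simp: C_def intro!: cyl_coord_algebra)
    ultimately show ?thesis by simp
  qed
  then have "sigma_sets (configs S) ?O \<subseteq> sets (coord_algebra S S)"
    using sets.sigma_sets_subset[of ?O "coord_algebra S S"] by auto
  moreover have "sets (coord_algebra S S) \<subseteq> sigma_sets (configs S) ?O"
    unfolding sets_coord_algebra
  proof (rule sigma_sets_mono, safe)
    fix s B assume "s \<in> S" "B \<subseteq> spins"
    then have "openin ?T {\<omega> \<in> topspace ?T. \<omega> s \<in> B}"
      by (intro openin_continuous_map_preimage[OF continuous_map_product_projection]) auto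
    then show "{\<omega> \<in> configs S. \<omega> s \<in> B} \<in> sigma_sets (configs S) ?O"
      by (intro sigma_sets.Basic) (simp add: configs_def)
  qed
  ultimately show ?thesis
    using O by (simp add: config_borel_def)
qed

section \<open>Ball cylinders as generators, and boundary conditions as fields\<close>

context tree_ising
begin

text \<open>The threshold \<open>n0\<close> lets one keep only balls that contain a given finite set
  together with its neighbours. \<open>v\<close> may take values that are not spins, so the empty
  set can be written as a cylinder too.\<close>

definition ball_cyls :: "nat \<Rightarrow> 'v set \<Rightarrow> ('v \<Rightarrow> real) set set" where
  "ball_cyls n0 U = {cyl S (root_ball n \<inter> U) v | n v. n \<ge> n0}"

text \<open>Balls are nested, so the intersection of two cylinders is the one on the larger ball or
  empty.\<close>

lemma Int_stable_ball_cyls: "Int_stable (ball_cyls n0 U)"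
proof -
  have "cyl S (root_ball n \<inter> U) v \<inter> cyl S (root_ball m \<inter> U) w \<in> ball_cyls n0 U"
    if "n \<ge> n0" "n \<le> m" for n m v w
  proof (cases "\<forall>x\<in>root_ball n \<inter> U. v x = w x")
    case True
    then have "cyl S (root_ball n \<inter> U) v \<inter> cyl S (root_ball m \<inter> U) w = cyl S (root_ball m \<inter> U) w"
      using ball_mono[OF that(2)] by (auto simp: cyl_def)
    then show ?thesis using that unfolding ball_cyls_def by auto
  next
    case False
    then obtain x where x: "x \<in> root_ball n \<inter> U" "v x \<noteq> w x" by blast
    moreover have "x \<in> root_ball m \<inter> U" "x \<in> S" using x ball_mono[OF that(2)] ball_subset_S by auto
    ultimately have "cyl S (root_ball n \<inter> U) v \<inter> cyl S (root_ball m \<inter> U) w = {}"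
      "cyl S (root_ball m \<inter> U) (\<lambda>_. 0) = {}" \<comment> \<open>\<open>0\<close> is not a spin\<close>
      by (force simp: cyl_def configs_def spins_def)+
    then have "cyl S (root_ball n \<inter> U) v \<inter> cyl S (root_ball m \<inter> U) w = cyl S (root_ball m \<inter> U) (\<lambda>_. 0)"
      by simp
    moreover have "m \<ge> n0" using that by simp
    ultimately show ?thesis unfolding ball_cyls_def by blast
  qed
  then show ?thesis
    unfolding Int_stable_def ball_cyls_def[of n0]
    by clarsimp (metis (no_types, lifting) Int_commute nat_le_linear)
qed

text \<open>The threshold costs nothing: an event at one site is a finite union of cylinders on any
  ball containing the site.\<close>

lemma sets_coord_algebra_ball_cyls:
  assumes "U \<subseteq> S"
  shows "sets (coord_algebra S U) = sigma_sets (configs S) (ball_cyls n0 U)"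
proof
  have "ball_cyls n0 U \<subseteq> sets (coord_algebra S U)"
    using assms finite_ball unfolding ball_cyls_def by (auto intro!: cyl_coord_algebra)
  then show "sigma_sets (configs S) (ball_cyls n0 U) \<subseteq> sets (coord_algebra S U)"
    using sets.sigma_sets_subset[of "ball_cyls n0 U" "coord_algebra S U"] by simp
  have "{\<omega> \<in> configs S. \<omega> s \<in> B} \<in> sigma_sets (configs S) (ball_cyls n0 U)"
    if sB: "s \<in> U" "B \<subseteq> spins" for s B
  proof -
    obtain m where m: "\<forall>n\<ge>m. {s} \<subseteq> root_ball n"
      using finite_subset_ball[of "{s}"] sB(1) assms by blast
    define n where "n = max m n0"
    define X where "X = root_ball n \<inter> U"
    have s: "s \<in> X" and X: "finite X" "X \<subseteq> S" and n: "n \<ge> n0"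
      using m sB finite_ball assms by (auto simp: n_def X_def)
    have "{\<omega> \<in> configs S. \<omega> s \<in> B} = (\<Union>v\<in>{v \<in> configs X. v s \<in> B}. cyl S X v)"
    proof (intro equalityI subsetI)
      fix \<omega> assume "\<omega> \<in> {\<omega> \<in> configs S. \<omega> s \<in> B}"
      then have "restrict \<omega> X \<in> {v \<in> configs X. v s \<in> B}" "\<omega> \<in> cyl S X (restrict \<omega> X)"
        using s X by (auto simp: cyl_def configs_def PiE_def Pi_def)
      then show "\<omega> \<in> (\<Union>v\<in>{v \<in> configs X. v s \<in> B}. cyl S X v)" by blast
    qed (use s in \<open>auto simp: cyl_def\<close>)
    moreover have "countable {v \<in> configs X. v s \<in> B}"
      using finite_configs[OF X(1)] by (intro countable_finite) simp
    ultimately show ?thesis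
      using n by (auto simp: ball_cyls_def X_def intro!: sigma_sets_UNION)
  qed
  then show "sets (coord_algebra S U) \<subseteq> sigma_sets (configs S) (ball_cyls n0 U)"
    unfolding sets_coord_algebra by (intro sigma_sets_mono) blast
qed

lemma measure_cyl_sum:
  assumes "finite_measure \<mu>" "sets \<mu> = sets (coord_algebra S S)" "X \<subseteq> Y" "Y \<subseteq> S" "finite Y"
  shows "measure \<mu> (cyl S X \<sigma>) = (\<Sum>u\<in>{u \<in> configs Y. \<forall>x\<in>X. u x = \<sigma> x}. measure \<mu> (cyl S Y u))"
  unfolding cyl_partition[OF assms(3,4)]
proof (rule finite_measure.finite_measure_finite_Union[OF assms(1)])
  show "disjoint_family_on (cyl S Y) {u \<in> configs Y. \<forall>x\<in>X. u x = \<sigma> x}"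
    using disjoint_family_on_cyl[of S Y] by (auto simp: disjoint_family_on_def)
qed (use assms finite_configs[OF assms(5)] cyl_coord_algebra[of Y S S] in auto)

definition bfield :: "'v set \<Rightarrow> ('v \<Rightarrow> real) \<Rightarrow> 'v \<Rightarrow> real" where
  "bfield \<Lambda> \<omega> s = \<beta> * (\<Sum>t\<in>{t. adj s t \<and> t \<notin> \<Lambda>}. \<omega> t)"

text \<open>The Hamiltonian sums over unordered edges, \<open>wt\<close> over ordered pairs. Every
  edge meeting \<Lambda> is the image under \<open>e\<close> of exactly two pairs: both inside
  \<Lambda> (\<open>A1\<close>), or one leaving \<Lambda> (\<open>A2\<close>) and its reversal.
  Hence interior edges keep the factor 1/2 and boundary edges lose it, becoming the field
  \<open>bfield\<close>.\<close>

lemma hamiltonian_eq: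
  fixes \<omega> :: "'v \<Rightarrow> real"
  assumes "finite \<Lambda>" "\<Lambda> \<subseteq> S"
  shows "hamiltonian S adj \<beta> \<Lambda> \<omega> =
    - (\<beta> / 2 * (\<Sum>s\<in>\<Lambda>. \<Sum>t\<in>\<Lambda>. of_bool (adj s t) * \<omega> s * \<omega> t) + (\<Sum>s\<in>\<Lambda>. bfield \<Lambda> \<omega> s * \<omega> s))"
proof -
  define A1 where "A1 = (SIGMA s:\<Lambda>. {t \<in> \<Lambda>. adj s t})"
  define A2 where "A2 = (SIGMA s:\<Lambda>. {t. adj s t \<and> t \<notin> \<Lambda>})"
  define A where "A = A1 \<union> A2 \<union> prod.swap ` A2"
  define e where "e = (\<lambda>(s, t). {s, t} :: 'v set)"
  define g where "g = (\<lambda>(s, t). \<omega> s * \<omega> t)"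
  have nb: "finite {t. adj s t \<and> t \<notin> \<Lambda>}" if "s \<in> \<Lambda>" for s
    using finite_nbrs[of s] that assms(2) by auto
  have fin: "finite A1" "finite A2" "finite A"
    using assms(1) nb by (auto simp: A_def A1_def A2_def)
  have A_iff: "(s, t) \<in> A \<longleftrightarrow> adj s t \<and> (s \<in> \<Lambda> \<or> t \<in> \<Lambda>)" for s t
    using adj_sym by (auto simp: A_def A1_def A2_def image_iff)
  let ?D = "{\<Delta>. finite \<Delta> \<and> \<Delta> \<subseteq> S \<and> \<Delta> \<inter> \<Lambda> \<noteq> {}}"
  have "hamiltonian S adj \<beta> \<Lambda> \<omega> = (\<Sum>\<^sub>\<infinity>\<Delta>\<in>e ` A. ising_potential adj \<beta> \<Delta> \<omega>)"
    unfolding hamiltonian_def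
  proof (rule infsum_cong_neutral)
    fix \<Delta> assume "\<Delta> \<in> ?D - e ` A"
    then have "\<not> (\<exists>s t. adj s t \<and> \<Delta> = {s, t})" by (force simp: A_iff e_def image_iff)
    then show "ising_potential adj \<beta> \<Delta> \<omega> = 0"
      unfolding ising_potential_def by (rule if_not_P)
  next
    fix \<Delta> assume "\<Delta> \<in> e ` A - ?D"
    then have False by (auto simp: A_iff e_def dest: adj_in_S)
    then show "ising_potential adj \<beta> \<Delta> \<omega> = 0" ..
  qed simp
  also have "\<dots> = (\<Sum>\<Delta>\<in>e ` A. ising_potential adj \<beta> \<Delta> \<omega>)"
    using fin by simp
  also have "\<dots> = (\<Sum>\<Delta>\<in>e ` A. - \<beta> / 2 * sum g {p \<in> A. e p = \<Delta>})"
  proof (rule sum.cong[OF refl])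
    fix \<Delta> assume "\<Delta> \<in> e ` A"
    then obtain s t where st: "(s, t) \<in> A" "\<Delta> = {s, t}" by (auto simp: e_def)
    then have adj: "adj s t" "s \<noteq> t" using A_iff adj_irrefl by auto
    have "{p \<in> A. e p = \<Delta>} = {(s, t), (t, s)}"
      using st adj adj_sym by (auto simp: e_def A_iff doubleton_eq_iff)
    then have "sum g {p \<in> A. e p = \<Delta>} = 2 * (\<omega> s * \<omega> t)"
      using adj by (simp add: g_def)
    moreover have "ising_potential adj \<beta> \<Delta> \<omega> = - \<beta> * (\<omega> s * \<omega> t)"
      using adj st by (auto simp: ising_potential_def)
    ultimately show "ising_potential adj \<beta> \<Delta> \<omega> = - \<beta> / 2 * sum g {p \<in> A. e p = \<Delta>}" by simp
  qed
  also have "\<dots> = - \<beta> / 2 * sum g A"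
    using sum.image_gen[OF fin(3), of g e] by (simp add: sum_distrib_left)
  also have "sum g A = sum g A1 + sum g A2 + sum g (prod.swap ` A2)"
    unfolding A_def using fin by (subst sum.union_disjoint, simp, simp, force simp: A1_def A2_def)
      (subst sum.union_disjoint, auto simp: A1_def A2_def)
  also have "sum g (prod.swap ` A2) = sum g A2"
    by (subst sum.reindex) (auto simp: g_def mult.commute intro!: sum.cong)
  also have "sum g A1 = (\<Sum>s\<in>\<Lambda>. \<Sum>t\<in>{t \<in> \<Lambda>. adj s t}. \<omega> s * \<omega> t)"
    unfolding A1_def g_def using assms(1) by (subst sum.Sigma) auto
  also have "\<dots> = (\<Sum>s\<in>\<Lambda>. \<Sum>t\<in>\<Lambda>. of_bool (adj s t) * \<omega> s * \<omega> t)"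
    using assms(1) by (intro sum.cong refl sum.mono_neutral_cong_left) auto
  also have "sum g A2 = (\<Sum>s\<in>\<Lambda>. \<Sum>t\<in>{t. adj s t \<and> t \<notin> \<Lambda>}. \<omega> s * \<omega> t)"
    unfolding A2_def g_def using assms(1) nb by (subst sum.Sigma) auto
  finally have "hamiltonian S adj \<beta> \<Lambda> \<omega> = - \<beta> / 2 *
      ((\<Sum>s\<in>\<Lambda>. \<Sum>t\<in>\<Lambda>. of_bool (adj s t) * \<omega> s * \<omega> t) +
       2 * (\<Sum>s\<in>\<Lambda>. \<Sum>t\<in>{t. adj s t \<and> t \<notin> \<Lambda>}. \<omega> s * \<omega> t))"
    by simp
  moreover have "(\<Sum>s\<in>\<Lambda>. bfield \<Lambda> \<omega> s * \<omega> s) =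
      \<beta> * (\<Sum>s\<in>\<Lambda>. \<Sum>t\<in>{t. adj s t \<and> t \<notin> \<Lambda>}. \<omega> s * \<omega> t)"
    by (simp add: bfield_def sum_distrib_left mult_ac)
  ultimately show ?thesis by (simp add: distrib_left)
qed

lemma exp_hamiltonian_merge:
  assumes "finite \<Lambda>" "\<Lambda> \<subseteq> S"
  shows "exp (- hamiltonian S adj \<beta> \<Lambda> (merge \<Lambda> (S - \<Lambda>) (w, \<omega>))) = wt \<Lambda> (bfield \<Lambda> \<omega>) w"
proof -
  let ?m = "merge \<Lambda> (S - \<Lambda>) (w, \<omega>)"
  have "bfield \<Lambda> ?m s = bfield \<Lambda> \<omega> s" if "s \<in> \<Lambda>" for s
    unfolding bfield_def using adj_in_S by (auto simp: merge_def intro!: sum.cong)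
  then have "exp (- hamiltonian S adj \<beta> \<Lambda> ?m) = wt \<Lambda> (bfield \<Lambda> \<omega>) ?m"
    using assms by (simp add: hamiltonian_eq wt_def)
  also have "\<dots> = wt \<Lambda> (bfield \<Lambda> \<omega>) w"
    by (rule wt_cong) (auto simp: merge_def)
  finally show ?thesis .
qed

lemma partition_fun_eq:
  assumes "finite \<Lambda>" "\<Lambda> \<subseteq> S"
  shows "partition_fun S adj \<beta> \<Lambda> \<omega> = part_sum \<Lambda> (bfield \<Lambda> \<omega>)"
  using assms by (simp add: partition_fun_def exp_hamiltonian_merge cyl_sum_def)

text \<open>The spatial Markov property at the level of weights: as \<open>B\<close> contains all
  neighbours of \<Lambda>, the edges between \<Lambda> and \<open>B - \<Lambda>\<close> make up the
  whole boundary field.\<close>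

lemma wt_subset:
  assumes "finite B" "\<Lambda> \<subseteq> B" "\<And>s t. s \<in> \<Lambda> \<Longrightarrow> adj s t \<Longrightarrow> t \<in> B"
  shows "wt B (\<lambda>_. 0) u = wt \<Lambda> (bfield \<Lambda> u) u * wt (B - \<Lambda>) (\<lambda>_. 0) u"
proof -
  define \<Gamma> where "\<Gamma> = B - \<Lambda>"
  have B: "B = \<Lambda> \<union> \<Gamma>" "\<Lambda> \<inter> \<Gamma> = {}" and fin: "finite \<Lambda>" "finite \<Gamma>"
    using assms(1,2) finite_subset by (auto simp: \<Gamma>_def)
  let ?f = "\<lambda>s t. of_bool (adj s t) * u s * u t"
  have "(\<Sum>s\<in>\<Gamma>. \<Sum>t\<in>\<Lambda>. ?f s t) = (\<Sum>t\<in>\<Lambda>. \<Sum>s\<in>\<Gamma>. ?f s t)"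
    by (rule sum.swap)
  also have "\<dots> = (\<Sum>s\<in>\<Lambda>. \<Sum>t\<in>\<Gamma>. ?f s t)"
    by (intro sum.cong refl) (simp add: adj_commute mult_ac)
  finally have cross: "(\<Sum>s\<in>\<Gamma>. \<Sum>t\<in>\<Lambda>. ?f s t) = (\<Sum>s\<in>\<Lambda>. \<Sum>t\<in>\<Gamma>. ?f s t)" .
  have field: "bfield \<Lambda> u s * u s = \<beta> * (\<Sum>t\<in>\<Gamma>. ?f s t)" if "s \<in> \<Lambda>" for s
  proof -
    have "(\<Sum>t\<in>{t. adj s t \<and> t \<notin> \<Lambda>}. u t * u s) = (\<Sum>t\<in>\<Gamma>. ?f s t)"
      using assms(3) that fin by (intro sum.mono_neutral_cong_left) (auto simp: \<Gamma>_def)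
    then show ?thesis
      by (simp add: bfield_def sum_distrib_right mult.assoc)
  qed
  have "(\<Sum>s\<in>B. \<Sum>t\<in>B. ?f s t) = (\<Sum>s\<in>\<Lambda>. \<Sum>t\<in>\<Lambda>. ?f s t) + 2 * (\<Sum>s\<in>\<Lambda>. \<Sum>t\<in>\<Gamma>. ?f s t) +
      (\<Sum>s\<in>\<Gamma>. \<Sum>t\<in>\<Gamma>. ?f s t)"
    unfolding B(1) using fin B(2) cross
    by (simp add: sum.union_disjoint sum.distrib)
  moreover have "(\<Sum>s\<in>\<Lambda>. bfield \<Lambda> u s * u s) = \<beta> * (\<Sum>s\<in>\<Lambda>. \<Sum>t\<in>\<Gamma>. ?f s t)"
    by (simp only: field sum_distrib_left cong: sum.cong)
  ultimately show ?thesis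
    unfolding wt_def exp_add[symmetric] \<Gamma>_def[symmetric]
    by (simp add: distrib_left)
qed

section \<open>The tree-indexed Markov chain\<close>

text \<open>The increments \<open>\<eta> s = \<omega> s * \<omega> (par s)\<close> are independent with weights proportional to
  \<open>exp (\<beta> * a)\<close>, except that \<open>\<eta> root = \<omega> root\<close> is uniform; \<open>\<omega> s\<close> is the product of the
  increments along the path to the root.\<close>

definition incr_law :: "'v \<Rightarrow> real measure" where
  "incr_law s = point_measure spins
     (\<lambda>a. ennreal (if s = root then 1 / 2 else exp (\<beta> * a) / (exp \<beta> + exp (- \<beta>))))"

definition chain :: "('v \<Rightarrow> real) \<Rightarrow> 'v \<Rightarrow> real" where
  "chain \<eta> = (\<lambda>s\<in>S. \<Prod>k\<le>lev s. \<eta> ((par ^^ k) s))"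

definition chain_measure :: "('v \<Rightarrow> real) measure" where
  "chain_measure = distr (PiM S incr_law) (coord_algebra S S) chain"

lemma prob_space_incr_law: "prob_space (incr_law s)"
proof (rule prob_spaceI)
  have pos: "exp \<beta> + exp (- \<beta>) > 0" by (intro add_pos_pos) auto
  have "emeasure (incr_law s) (space (incr_law s)) =
      (\<Sum>a\<in>spins. ennreal (if s = root then 1 / 2 else exp (\<beta> * a) / (exp \<beta> + exp (- \<beta>))))"
    unfolding incr_law_def space_point_measure
    by (rule emeasure_point_measure_finite) (auto simp: spins_def)
  also have "\<dots> = ennreal (\<Sum>a\<in>spins. if s = root then 1 / 2 else exp (\<beta> * a) / (exp \<beta> + exp (- \<beta>)))"
    using pos by (intro sum_ennreal) (auto simp: less_imp_le)
  also have "(\<Sum>a\<in>spins. if s = root then 1 / 2 else exp (\<beta> * a) / (exp \<beta> + exp (- \<beta>))) = 1"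
    using pos by (simp add: spins_def flip: add_divide_distrib)
  finally show "emeasure (incr_law s) (space (incr_law s)) = 1" by simp
qed

lemma space_PiM_incr_law: "space (PiM S incr_law) = configs S"
  by (simp add: space_PiM incr_law_def space_point_measure configs_def)

lemma par_funpow: "s \<in> S \<Longrightarrow> k \<le> lev s \<Longrightarrow> (par ^^ k) s \<in> S \<and> lev ((par ^^ k) s) = lev s - k"
proof (induction k)
  case (Suc k)
  then have "(par ^^ k) s \<in> S" "lev ((par ^^ k) s) = lev s - k" "lev ((par ^^ k) s) \<noteq> 0" by auto
  moreover from this have "(par ^^ k) s \<noteq> root" using lev_root by auto
  ultimately show ?case using par_props[of "(par ^^ k) s"] adj_in_S by fastforce
qed simp

lemma chain_root: "chain \<eta> root = \<eta> root"
  by (simp add: chain_def root_in_S lev_root)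

lemma chain_step:
  assumes "s \<in> S" "s \<noteq> root"
  shows "chain \<eta> s = \<eta> s * chain \<eta> (par s)"
proof -
  note par = par_props[OF assms]
  have "chain \<eta> s = (\<Prod>k\<le>Suc (lev (par s)). \<eta> ((par ^^ k) s))"
    unfolding par(2) using assms(1) by (simp add: chain_def)
  also have "\<dots> = \<eta> ((par ^^ 0) s) * (\<Prod>k\<le>lev (par s). \<eta> ((par ^^ Suc k) s))"
    by (rule prod.atMost_Suc_shift)
  also have "(\<Prod>k\<le>lev (par s). \<eta> ((par ^^ Suc k) s)) = chain \<eta> (par s)"
    unfolding funpow_Suc_right using adj_in_S(1)[OF par(1)] by (simp add: chain_def)
  finally show ?thesis by simp
qed

lemma chain_in_configs:
  assumes "\<eta> \<in> configs S"
  shows "chain \<eta> \<in> configs S"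
proof -
  have "prod f I \<in> spins" if "\<And>i. i \<in> I \<Longrightarrow> f i \<in> spins" for f :: "nat \<Rightarrow> real" and I
    using that
  proof (induction I rule: infinite_finite_induct)
    case (insert i I)
    then have "f i \<in> spins" "prod f I \<in> spins" by auto
    then show ?case using insert.hyps by (auto simp: spins_def)
  qed (auto simp: spins_def)
  moreover have "\<eta> ((par ^^ k) s) \<in> spins" if "s \<in> S" "k \<le> lev s" for s k
    using assms par_funpow[OF that] by (auto simp: configs_def PiE_def Pi_def)
  ultimately have "(\<Prod>k\<le>lev s. \<eta> ((par ^^ k) s)) \<in> spins" if "s \<in> S" for s
    using that by (metis atMost_iff)
  then show ?thesis by (auto simp: chain_def configs_def)
qed

lemma measurable_chain: "chain \<in> PiM S incr_law \<rightarrow>\<^sub>M coord_algebra S S"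
  unfolding coord_algebra_def
proof (rule measurable_measure_of)
  show "chain \<in> space (PiM S incr_law) \<rightarrow> configs S"
    using chain_in_configs by (simp add: space_PiM_incr_law)
  fix W assume "W \<in> {{\<omega> \<in> configs S. \<omega> s \<in> B} | s B. s \<in> S \<and> B \<subseteq> spins}"
  then obtain s B where sB: "W = {\<omega> \<in> configs S. \<omega> s \<in> B}" "s \<in> S" "B \<subseteq> spins" by blast
  have coord: "(\<lambda>\<eta>. \<eta> x) \<in> borel_measurable (PiM S incr_law)" if "x \<in> S" for x
  proof -
    have "(\<lambda>a. a) \<in> borel_measurable (incr_law x)" by (simp add: incr_law_def)
    then show ?thesis
      using measurable_compose[OF measurable_component_singleton[OF that]] by blast
  qed
  have "(\<lambda>\<eta>. \<Prod>k\<le>lev s. \<eta> ((par ^^ k) s)) \<in> borel_measurable (PiM S incr_law)"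
    using par_funpow[OF sB(2)] by (intro borel_measurable_prod coord) auto
  moreover have "B \<in> sets borel"
    using sB(3) by (intro borel_closed finite_imp_closed) (auto simp: spins_def intro: finite_subset)
  ultimately have "(\<lambda>\<eta>. \<Prod>k\<le>lev s. \<eta> ((par ^^ k) s)) -` B \<inter> space (PiM S incr_law)
      \<in> sets (PiM S incr_law)" by (rule measurable_sets)
  moreover have "chain -` W \<inter> space (PiM S incr_law) =
      (\<lambda>\<eta>. \<Prod>k\<le>lev s. \<eta> ((par ^^ k) s)) -` B \<inter> space (PiM S incr_law)"
    using sB chain_in_configs by (auto simp: space_PiM_incr_law chain_def)
  ultimately show "chain -` W \<inter> space (PiM S incr_law) \<in> sets (PiM S incr_law)" by simp
qed auto

lemma sets_chain_measure [simp]: "sets chain_measure = sets (coord_algebra S S)"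
  by (simp add: chain_measure_def)

lemma prob_space_chain_measure: "prob_space chain_measure"
proof -
  interpret product_prob_space incr_law S
    by (intro product_prob_spaceI prob_space_incr_law)
  show ?thesis unfolding chain_measure_def by (rule prob_space_distr[OF measurable_chain])
qed

text \<open>Fixing the chain on a ball is the same as fixing the increments there. Their
  independence gives a product of factors exp(\<beta> u(x) u(par x)), which is the free weight; the
  prefactor does not depend on \<open>u\<close>.\<close>

lemma chain_measure_cyl_ball:
  assumes u: "\<And>x. x \<in> root_ball n \<Longrightarrow> u x \<in> spins"
  shows "measure chain_measure (cyl S (root_ball n) u) =
    1 / 2 / (exp \<beta> + exp (- \<beta>)) ^ card (root_ball n - {root}) * wt (root_ball n) (\<lambda>_. 0) u"
proof -
  interpret product_prob_space incr_law S
    by (intro product_prob_spaceI prob_space_incr_law)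
  \<comment> \<open>The increments that produce \<open>u\<close>, recovered from \<open>u\<close>
    because spins square to 1.\<close>
  define g where "g = (\<lambda>x. if x = root then u x else u x * u (par x))"
  define B where "B = root_ball n - {root}"
  have root_ball: "root_ball n = insert root B" "root \<notin> B" "finite B"
    using finite_ball root_in_S lev_root by (auto simp: B_def root_ball_def)
  have sq: "a * a = 1" if "a \<in> spins" for a :: real using that by (auto simp: spins_def)
  have g: "g x \<in> spins" if "x \<in> root_ball n" for x
    using u[OF that] u[OF par_in_ball[OF that]] by (auto simp: g_def spins_def)
  have "chain -` cyl S (root_ball n) u \<inter> space (PiM S incr_law) =
      {\<eta> \<in> space (PiM S incr_law). \<forall>x\<in>root_ball n. \<eta> x \<in> {g x}}"
  proof (intro equalityI subsetI)
    fix \<eta> assume "\<eta> \<in> chain -` cyl S (root_ball n) u \<inter> space (PiM S incr_law)"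
    then have \<eta>: "\<eta> \<in> configs S" and eq: "\<And>x. x \<in> root_ball n \<Longrightarrow> chain \<eta> x = u x"
      by (auto simp: space_PiM_incr_law cyl_def)
    have "\<eta> x = g x" if x: "x \<in> root_ball n" for x
    proof (cases "x = root")
      case True
      then show ?thesis using eq[OF x] chain_root by (simp add: g_def)
    next
      case False
      have "x \<in> S" using x ball_subset_S by auto
      then show ?thesis
        using eq[OF x] eq[OF par_in_ball[OF x False]] chain_step[of x \<eta>] False
          sq[OF u[OF par_in_ball[OF x False]]] by (simp add: g_def mult.assoc flip: eq[OF x])
    qed
    then show "\<eta> \<in> {\<eta> \<in> space (PiM S incr_law). \<forall>x\<in>root_ball n. \<eta> x \<in> {g x}}"
      using \<eta> by (simp add: space_PiM_incr_law)
  next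
    fix \<eta> assume "\<eta> \<in> {\<eta> \<in> space (PiM S incr_law). \<forall>x\<in>root_ball n. \<eta> x \<in> {g x}}"
    then have \<eta>: "\<eta> \<in> configs S" and eq: "\<And>x. x \<in> root_ball n \<Longrightarrow> \<eta> x = g x"
      by (auto simp: space_PiM_incr_law)
    have "chain \<eta> x = u x" if "x \<in> root_ball n" "lev x = m" for x m
      using that
    proof (induction m arbitrary: x)
      case 0
      then have "x = root" using lev_eq_0_iff ball_subset_S by blast
      then show ?case using chain_root eq[OF 0(1)] by (simp add: g_def)
    next
      case (Suc m)
      then have x: "x \<in> S" "x \<noteq> root" using ball_subset_S lev_root by auto
      then have "chain \<eta> (par x) = u (par x)"
        using Suc par_props(2)[OF x] par_in_ball by simp
      then show ?case
        using chain_step[OF x] eq[OF Suc.prems(1)] x sq[OF u[OF par_in_ball[OF Suc.prems(1) x(2)]]]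
        by (simp add: g_def mult.assoc)
    qed
    then show "\<eta> \<in> chain -` cyl S (root_ball n) u \<inter> space (PiM S incr_law)"
      using \<eta> chain_in_configs by (simp add: space_PiM_incr_law cyl_def)
  qed
  then have "emeasure chain_measure (cyl S (root_ball n) u) =
      emeasure (PiM S incr_law) {\<eta> \<in> space (PiM S incr_law). \<forall>x\<in>root_ball n. \<eta> x \<in> {g x}}"
    unfolding chain_measure_def using finite_ball ball_subset_S
    by (subst emeasure_distr[OF measurable_chain]) (simp_all add: cyl_coord_algebra)
  also have "\<dots> = (\<Prod>x\<in>root_ball n. emeasure (incr_law x) {g x})"
    using g finite_ball
    by (intro emeasure_PiM_Collect ball_subset_S) (auto simp: incr_law_def sets_point_measure)
  also have "\<dots> = (\<Prod>x\<in>root_ball n. ennreal (if x = root then 1 / 2 else exp (\<beta> * g x) / (exp \<beta> + exp (- \<beta>))))"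
  proof (rule prod.cong[OF refl])
    fix x assume "x \<in> root_ball n"
    then have "{g x} \<subseteq> spins" "finite spins" using g by (auto simp: spins_def)
    then show "emeasure (incr_law x) {g x} =
        ennreal (if x = root then 1 / 2 else exp (\<beta> * g x) / (exp \<beta> + exp (- \<beta>)))"
      unfolding incr_law_def by (subst emeasure_point_measure_finite) auto
  qed
  also have "\<dots> = ennreal (\<Prod>x\<in>root_ball n. if x = root then 1 / 2 else exp (\<beta> * g x) / (exp \<beta> + exp (- \<beta>)))"
    by (intro prod_ennreal) (auto simp: add_nonneg_nonneg)
  finally have "measure chain_measure (cyl S (root_ball n) u) =
      (\<Prod>x\<in>root_ball n. if x = root then 1 / 2 else exp (\<beta> * g x) / (exp \<beta> + exp (- \<beta>)))"
    by (simp add: measure_def prod_nonneg add_nonneg_nonneg)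
  also have "\<dots> = 1 / 2 * (\<Prod>x\<in>B. exp (\<beta> * (u x * u (par x))) / (exp \<beta> + exp (- \<beta>)))"
    using root_ball(2,3) unfolding root_ball(1) by (auto simp: g_def intro!: prod.cong)
  also have "(\<Prod>x\<in>B. exp (\<beta> * (u x * u (par x))) / (exp \<beta> + exp (- \<beta>))) =
      exp (\<beta> * (\<Sum>x\<in>B. u x * u (par x))) / (exp \<beta> + exp (- \<beta>)) ^ card B"
    using root_ball(3) by (simp add: prod_dividef exp_sum sum_distrib_left)
  also have "exp (\<beta> * (\<Sum>x\<in>B. u x * u (par x))) = wt (root_ball n) (\<lambda>_. 0) u"
    unfolding wt_def B_def by (simp add: ball_edge_sum)
  finally show ?thesis by (simp add: B_def)
qed

lemma chain_measure_cyl: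
  assumes "X \<subseteq> root_ball n"
  shows "measure chain_measure (cyl S X \<sigma>) =
    cyl_sum (root_ball n) (\<lambda>_. 0) X \<sigma> / part_sum (root_ball n) (\<lambda>_. 0)"
proof -
  interpret prob_space chain_measure by (rule prob_space_chain_measure)
  define c where "c = 1 / 2 / (exp \<beta> + exp (- \<beta>)) ^ card (root_ball n - {root})"
  have "measure chain_measure (cyl S X \<sigma>) = c * cyl_sum (root_ball n) (\<lambda>_. 0) X \<sigma>" if "X \<subseteq> root_ball n" for X \<sigma>
  proof -
    have "measure chain_measure (cyl S (root_ball n) u) = c * wt (root_ball n) (\<lambda>_. 0) u"
      if "u \<in> configs (root_ball n)" for u
      unfolding c_def by (rule chain_measure_cyl_ball) (use that in \<open>auto simp: configs_def\<close>)
    then show ?thesis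
      using measure_cyl_sum[OF finite_measure_axioms _ that ball_subset_S finite_ball]
      by (simp add: cyl_sum_def sum_distrib_left)
  qed
  from this[OF assms] this[of "{}" "\<lambda>_. 1"] show ?thesis
    using prob_space part_sum_pos[OF finite_ball, of n "\<lambda>_. 0"]
    by (simp add: cyl_def chain_measure_def field_simps)
qed

end

section \<open>The Gibbs property\<close>

lemma integrable_imp_set_integrable:
  fixes f :: "'a \<Rightarrow> real"
  shows "integrable M f \<Longrightarrow> A \<in> sets M \<Longrightarrow> set_integrable M A f"
  unfolding set_integrable_def by (rule integrable_mult_indicator)

text \<open>A Dynkin argument for integrable functions. The generator may lack the whole space, so
  equality of the total integrals is assumed separately; it is what handles complements.\<close>

lemma set_integral_eq_generator:
  fixes f g :: "'a \<Rightarrow> real"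
  assumes int: "integrable M f" "integrable M g"
    and G: "Int_stable G" "G \<subseteq> sets M"
    and basic: "\<And>A. A \<in> G \<Longrightarrow> (LINT x:A|M. f x) = (LINT x:A|M. g x)"
    and total: "(LINT x|M. f x) = (LINT x|M. g x)"
    and A: "A \<in> sigma_sets (space M) G"
  shows "(LINT x:A|M. f x) = (LINT x:A|M. g x)"
proof -
  have sub: "B \<in> sigma_sets (space M) G \<Longrightarrow> B \<in> sets M" for B
    using sets.sigma_sets_subset[OF G(2)] by blast
  have si: "B \<in> sets M \<Longrightarrow> set_integrable M B f" "B \<in> sets M \<Longrightarrow> set_integrable M B g" for B
    using int by (auto intro: integrable_imp_set_integrable)
  have "G \<subseteq> Pow (space M)" using G(2) sets.sets_into_space by blast
  from G(1) this A show ?thesis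
  proof (induction rule: sigma_sets_induct_disjoint)
    case (compl B)
    have B: "B \<in> sets M" "space M - B \<in> sets M" "B \<inter> (space M - B) = {}" "B \<union> (space M - B) = space M"
      using sub[OF compl(1)] sets.sets_into_space by auto
    have "(LINT x:space M|M. h x) = (LINT x:B|M. h x) + (LINT x:space M - B|M. h x)"
      if "\<And>B. B \<in> sets M \<Longrightarrow> set_integrable M B h" for h :: "'a \<Rightarrow> real"
      using set_integral_Un[OF B(3) that[OF B(1)] that[OF B(2)]] B(4) by simp
    from this[of f] this[of g] show ?case
      using si total compl(2) int by (simp add: set_integral_space)
  next
    case (union B)
    then have B: "B i \<in> sets M" for i using sub by blast
    have disj: "\<And>i j. i \<noteq> j \<Longrightarrow> B i \<inter> B j = {}"
      using union(1) by (auto simp: disjoint_family_on_def)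
    have "(\<Union>i. B i) \<in> sets M" using B by blast
    then have "(LINT x:(\<Union>i. B i)|M. h x) = (\<Sum>i. LINT x:B i|M. h x)" if "h = f \<or> h = g" for h
      using that si B disj by (intro lebesgue_integral_countable_add) auto
    then show ?case using union(3) by simp
  qed (use basic in \<open>auto simp: set_lebesgue_integral_def\<close>)
qed

lemma borel_measurable_coord:
  assumes "x \<in> U" "U \<subseteq> S"
  shows "(\<lambda>\<omega>. \<omega> x) \<in> borel_measurable (coord_algebra S U)"
proof (rule measurableI)
  fix B :: "real set"
  have "(\<lambda>\<omega>. \<omega> x) -` B \<inter> space (coord_algebra S U) = {\<omega> \<in> configs S. \<omega> x \<in> B \<inter> spins}"
    using assms by (auto simp: configs_def)
  also have "\<dots> \<in> sets (coord_algebra S U)"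
    unfolding sets_coord_algebra using assms by (intro sigma_sets.Basic) blast
  finally show "(\<lambda>\<omega>. \<omega> x) -` B \<inter> space (coord_algebra S U) \<in> sets (coord_algebra S U)" .
qed simp

section \<open>Finite-volume kernels and the Gibbs property of the chain\<close>

context tree_ising
begin

lemma nbr_closure_in_ball:
  assumes "finite \<Lambda>" "\<Lambda> \<subseteq> S"
  obtains n0 where "\<And>n. n \<ge> n0 \<Longrightarrow> \<Lambda> \<subseteq> root_ball n"
    "\<And>n s t. n \<ge> n0 \<Longrightarrow> s \<in> \<Lambda> \<Longrightarrow> adj s t \<Longrightarrow> t \<in> root_ball n"
proof -
  have "finite (\<Lambda> \<union> (\<Union>s\<in>\<Lambda>. {t. adj s t}))" "\<Lambda> \<union> (\<Union>s\<in>\<Lambda>. {t. adj s t}) \<subseteq> S"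
    using assms finite_nbrs adj_in_S by auto
  from finite_subset_ball[OF this] obtain n0
    where "\<forall>n\<ge>n0. \<Lambda> \<union> (\<Union>s\<in>\<Lambda>. {t. adj s t}) \<subseteq> root_ball n" by blast
  then show ?thesis by (intro that[of n0]) auto
qed

lemma bfield_cong: "(\<And>t. t \<notin> \<Lambda> \<Longrightarrow> adj s t \<Longrightarrow> \<omega> t = \<omega>' t) \<Longrightarrow> bfield \<Lambda> \<omega> s = bfield \<Lambda> \<omega>' s"
  unfolding bfield_def by (auto intro!: sum.cong)

text \<open>\<open>wt_subset\<close> summed over the spins inside \<Lambda>: the outer weight is a
  constant factor. This is the denominator in the conditional law on \<Lambda> given the spins in
  \<open>B - \<Lambda>\<close>.\<close>

lemma cyl_sum_outer:
  fixes v :: "'v \<Rightarrow> real"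
  assumes "finite B" "\<Lambda> \<subseteq> B" "\<And>s t. s \<in> \<Lambda> \<Longrightarrow> adj s t \<Longrightarrow> t \<in> B"
    and v: "\<And>x. x \<in> B - \<Lambda> \<Longrightarrow> v x \<in> spins"
  shows "cyl_sum B (\<lambda>_. 0) (B - \<Lambda>) v = part_sum \<Lambda> (bfield \<Lambda> v) * wt (B - \<Lambda>) (\<lambda>_. 0) v"
proof -
  let ?j = "\<lambda>w. merge \<Lambda> (B - \<Lambda>) (w, v)"
  have "bij_betw ?j (configs \<Lambda>) {u \<in> configs B. \<forall>x\<in>B - \<Lambda>. u x = v x}"
  proof (rule bij_betw_byWitness[where f' = "\<lambda>u. restrict u \<Lambda>"])
    show "\<forall>w\<in>configs \<Lambda>. restrict (?j w) \<Lambda> = w"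
      by (auto simp: configs_def merge_def fun_eq_iff PiE_def extensional_def)
    show "\<forall>u\<in>{u \<in> configs B. \<forall>x\<in>B - \<Lambda>. u x = v x}. ?j (restrict u \<Lambda>) = u"
      using assms(2) by (auto simp: configs_def merge_def fun_eq_iff PiE_def extensional_def)
    show "?j ` configs \<Lambda> \<subseteq> {u \<in> configs B. \<forall>x\<in>B - \<Lambda>. u x = v x}"
      using assms(2) v by (auto simp: configs_def merge_def PiE_def extensional_def Pi_def)
    show "(\<lambda>u. restrict u \<Lambda>) ` {u \<in> configs B. \<forall>x\<in>B - \<Lambda>. u x = v x} \<subseteq> configs \<Lambda>"
      using assms(2) by (auto simp: configs_def PiE_def Pi_def)
  qed
  then have "cyl_sum B (\<lambda>_. 0) (B - \<Lambda>) v = (\<Sum>w\<in>configs \<Lambda>. wt B (\<lambda>_. 0) (?j w))"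
    unfolding cyl_sum_def by (rule sum.reindex_bij_betw[symmetric])
  also have "\<dots> = (\<Sum>w\<in>configs \<Lambda>. wt \<Lambda> (bfield \<Lambda> v) w * wt (B - \<Lambda>) (\<lambda>_. 0) v)"
  proof (rule sum.cong[OF refl])
    fix w
    have "bfield \<Lambda> (?j w) s = bfield \<Lambda> v s" if "s \<in> \<Lambda>" for s
      using assms(3) that by (intro bfield_cong) (auto simp: merge_def)
    then have "wt \<Lambda> (bfield \<Lambda> (?j w)) (?j w) = wt \<Lambda> (bfield \<Lambda> v) w"
      by (intro wt_cong) (auto simp: merge_def)
    moreover have "wt (B - \<Lambda>) (\<lambda>_. 0) (?j w) = wt (B - \<Lambda>) (\<lambda>_. 0) v"
      by (intro wt_cong) (auto simp: merge_def)
    ultimately show "wt B (\<lambda>_. 0) (?j w) = wt \<Lambda> (bfield \<Lambda> v) w * wt (B - \<Lambda>) (\<lambda>_. 0) v"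
      using wt_subset[OF assms(1-3), where u = "?j w"] by simp
  qed
  finally show ?thesis by (simp add: cyl_sum_def sum_distrib_right)
qed

lemma cyl_sum_full:
  assumes "\<And>x. x \<in> B \<Longrightarrow> v x \<in> spins"
  shows "cyl_sum B h B v = wt B h v"
proof -
  have "{u \<in> configs B. \<forall>x\<in>B. u x = v x} = {restrict v B}"
    using assms by (auto simp: configs_def PiE_def extensional_def fun_eq_iff)
  then show ?thesis by (simp add: cyl_sum_def wt_def)
qed

definition spec :: "'v set \<Rightarrow> ('v \<Rightarrow> real) \<Rightarrow> ('v \<Rightarrow> real) \<Rightarrow> real" where
  "spec \<Lambda> w \<omega> = wt \<Lambda> (bfield \<Lambda> \<omega>) w / part_sum \<Lambda> (bfield \<Lambda> \<omega>)"

lemma spec_eq: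
  assumes "finite \<Lambda>" "\<Lambda> \<subseteq> S"
  shows "exp (- hamiltonian S adj \<beta> \<Lambda> (merge \<Lambda> (S - \<Lambda>) (w, \<omega>))) / partition_fun S adj \<beta> \<Lambda> \<omega>
    = spec \<Lambda> w \<omega>"
  using assms by (simp add: spec_def exp_hamiltonian_merge partition_fun_eq)

lemma spec_nonneg: "finite \<Lambda> \<Longrightarrow> spec \<Lambda> w \<omega> \<ge> 0"
  using wt_pos part_sum_pos by (simp add: spec_def less_imp_le)

lemma spec_le_1:
  assumes "finite \<Lambda>" "w \<in> configs \<Lambda>"
  shows "spec \<Lambda> w \<omega> \<le> 1"
proof -
  have "wt \<Lambda> (bfield \<Lambda> \<omega>) w \<le> part_sum \<Lambda> (bfield \<Lambda> \<omega>)"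
    unfolding cyl_sum_def using assms finite_configs wt_pos
    by (intro member_le_sum) (auto intro: less_imp_le)
  then show ?thesis using part_sum_pos[OF assms(1)] by (simp add: spec_def)
qed

lemma borel_measurable_spec:
  assumes "\<Lambda> \<subseteq> S"
  shows "spec \<Lambda> w \<in> borel_measurable (coord_algebra S (S - \<Lambda>))"
proof -
  have "(\<lambda>\<omega>. bfield \<Lambda> \<omega> s) \<in> borel_measurable (coord_algebra S (S - \<Lambda>))" for s
    unfolding bfield_def
    by (intro borel_measurable_times borel_measurable_const borel_measurable_sum borel_measurable_coord)
       (auto dest: adj_in_S)
  then show ?thesis
    unfolding spec_def cyl_sum_def wt_def by measurable
qed

text \<open>The conditional probability formula on one atom of the outer spins. The ball contains
  all neighbours of \<Lambda>, so the kernel depends only on spins fixed by that atom.\<close>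

lemma chain_measure_spec_cyl:
  assumes \<Lambda>: "finite \<Lambda>" "\<Lambda> \<subseteq> root_ball n" "\<And>s t. s \<in> \<Lambda> \<Longrightarrow> adj s t \<Longrightarrow> t \<in> root_ball n"
    and w: "w \<in> configs \<Lambda>" and v: "v \<in> configs S"
  shows "measure chain_measure (cyl S (root_ball n - \<Lambda>) v \<inter> cyl S \<Lambda> w) =
    spec \<Lambda> w v * measure chain_measure (cyl S (root_ball n - \<Lambda>) v)"
proof -
  define B where "B = root_ball n"
  define u where "u = merge \<Lambda> (B - \<Lambda>) (w, v)"
  have B: "finite B" "B \<subseteq> S" using finite_ball ball_subset_S by (auto simp: B_def)
  have spins: "u x \<in> spins" if "x \<in> B" for x
    using that w v B by (auto simp: u_def merge_def configs_def)
  have "cyl S (B - \<Lambda>) v \<inter> cyl S \<Lambda> w = cyl S B u"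
    using \<Lambda>(2) by (auto simp: cyl_def u_def merge_def B_def)
  then have "measure chain_measure (cyl S (B - \<Lambda>) v \<inter> cyl S \<Lambda> w) = wt B (\<lambda>_. 0) u / part_sum B (\<lambda>_. 0)"
    using chain_measure_cyl[of B n u] cyl_sum_full[OF spins] by (simp add: B_def)
  also have "wt B (\<lambda>_. 0) u = wt \<Lambda> (bfield \<Lambda> v) w * wt (B - \<Lambda>) (\<lambda>_. 0) v"
  proof -
    have "bfield \<Lambda> u s = bfield \<Lambda> v s" if "s \<in> \<Lambda>" for s
      using \<Lambda>(3) that by (intro bfield_cong) (auto simp: u_def merge_def B_def)
    then have "wt \<Lambda> (bfield \<Lambda> u) u = wt \<Lambda> (bfield \<Lambda> v) w"
      by (intro wt_cong) (auto simp: u_def merge_def)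
    moreover have "wt (B - \<Lambda>) (\<lambda>_. 0) u = wt (B - \<Lambda>) (\<lambda>_. 0) v"
      by (intro wt_cong) (auto simp: u_def merge_def)
    ultimately show ?thesis using wt_subset[OF B(1), of \<Lambda> u] \<Lambda> by (simp add: B_def)
  qed
  also have "\<dots> = spec \<Lambda> w v * cyl_sum B (\<lambda>_. 0) (B - \<Lambda>) v"
  proof -
    have "cyl_sum B (\<lambda>_. 0) (B - \<Lambda>) v = part_sum \<Lambda> (bfield \<Lambda> v) * wt (B - \<Lambda>) (\<lambda>_. 0) v"
      using \<Lambda> v B by (intro cyl_sum_outer) (auto simp: B_def configs_def)
    then show ?thesis using part_sum_pos[OF \<Lambda>(1), of "bfield \<Lambda> v"] by (simp add: spec_def)
  qed
  finally show ?thesis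
    using chain_measure_cyl[of "B - \<Lambda>" n v] by (simp add: B_def)
qed

lemma chain_measure_gibbs: "realizing_gibbs_measure S adj \<beta> chain_measure"
  unfolding realizing_gibbs_measure_def
proof (intro conjI allI impI)
  show "prob_space chain_measure" by (rule prob_space_chain_measure)
  show "sets chain_measure = sets (config_borel S)"
    using sets_config_borel[OF countable_S] by simp
next
  fix \<Lambda> w assume asm: "finite \<Lambda> \<and> \<Lambda> \<subseteq> S \<and> w \<in> configs \<Lambda>"
  then have \<Lambda>: "finite \<Lambda>" "\<Lambda> \<subseteq> S" and w: "w \<in> configs \<Lambda>" by auto
  define F where "F = coord_algebra S (S - \<Lambda>)"
  define C where "C = cyl S \<Lambda> w"
  interpret prob_space chain_measure by (rule prob_space_chain_measure)
  have space: "space chain_measure = configs S"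
    using sets_eq_imp_space_eq[OF sets_chain_measure] by simp
  have sub: "sets F \<subseteq> sets chain_measure"
    unfolding F_def using sets_coord_algebra_mono[of "S - \<Lambda>" S S] by auto
  interpret finite_measure_subalgebra chain_measure F
    by unfold_locales (use sub space in \<open>auto simp: subalgebra_def F_def\<close>)
  have C: "C \<in> sets chain_measure" "{\<omega> \<in> configs S. restrict \<omega> \<Lambda> = w} = C"
    using \<Lambda> w cyl_coord_algebra[of \<Lambda> S S w]
    by (auto simp: C_def cyl_def configs_def PiE_def extensional_def fun_eq_iff)
  have gF: "spec \<Lambda> w \<in> borel_measurable F" unfolding F_def by (rule borel_measurable_spec[OF \<Lambda>(2)])
  then have "spec \<Lambda> w \<in> borel_measurable chain_measure"
    by (rule measurable_from_subalg[OF subalg])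
  then have int: "integrable chain_measure (spec \<Lambda> w)"
    using spec_nonneg[OF \<Lambda>(1)] spec_le_1[OF \<Lambda>(1) w]
    by (intro integrable_const_bound[where B = 1]) auto
  have intf: "integrable chain_measure (indicat_real C)"
    using C(1) by (simp add: emeasure_eq_measure)
  obtain n0 where n0: "\<And>n. n \<ge> n0 \<Longrightarrow> \<Lambda> \<subseteq> root_ball n"
    "\<And>n s t. n \<ge> n0 \<Longrightarrow> s \<in> \<Lambda> \<Longrightarrow> adj s t \<Longrightarrow> t \<in> root_ball n"
    using nbr_closure_in_ball[OF \<Lambda>] by blast
  \<comment> \<open>The defining integral identity of the conditional expectation is needed only on
    cylinders over balls beyond \<open>n0\<close>.\<close>
  have basic: "(LINT \<omega>:A|chain_measure. indicat_real C \<omega>) = (LINT \<omega>:A|chain_measure. spec \<Lambda> w \<omega>)"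
    and basic_sets: "A \<in> sets chain_measure"
    if "A \<in> ball_cyls n0 (S - \<Lambda>)" for A
  proof -
    obtain n v where n: "n \<ge> n0" "A = cyl S (root_ball n \<inter> (S - \<Lambda>)) v"
      using \<open>A \<in> ball_cyls n0 (S - \<Lambda>)\<close> by (auto simp: ball_cyls_def)
    have "root_ball n \<inter> (S - \<Lambda>) = root_ball n - \<Lambda>" using ball_subset_S by auto
    then have A: "A = cyl S (root_ball n - \<Lambda>) v" using n by simp
    show sets: "A \<in> sets chain_measure"
      unfolding A using finite_ball ball_subset_S[of n] by (auto intro!: cyl_coord_algebra)
    show "(LINT \<omega>:A|chain_measure. indicat_real C \<omega>) = (LINT \<omega>:A|chain_measure. spec \<Lambda> w \<omega>)"
    proof (cases "A = {}")
      case False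
      then obtain v' where v': "v' \<in> A" by blast
      then have A': "A = cyl S (root_ball n - \<Lambda>) v'" "v' \<in> configs S"
        unfolding A by (auto simp: cyl_def)
      \<comment> \<open>All neighbours of \<Lambda> outside \<Lambda> belong to the coordinates
        fixed by \<open>A\<close>, so the boundary field is constant on \<open>A\<close>.\<close>
      have const: "spec \<Lambda> w \<omega> = spec \<Lambda> w v'" if "\<omega> \<in> A" for \<omega>
      proof -
        have "bfield \<Lambda> \<omega> s = bfield \<Lambda> v' s" if "s \<in> \<Lambda>" for s
          using \<open>\<omega> \<in> A\<close> n0(2)[OF n(1) that] unfolding A'(1)
          by (intro bfield_cong) (auto simp: cyl_def)
        then show ?thesis
          unfolding spec_def using wt_cong[of \<Lambda> "bfield \<Lambda> \<omega>" "bfield \<Lambda> v'" w w]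
            cyl_sum_cong[of \<Lambda> "bfield \<Lambda> \<omega>" "bfield \<Lambda> v'" "{}"] by simp
      qed
      have "(LINT \<omega>:A|chain_measure. spec \<Lambda> w \<omega>) = (LINT \<omega>:A|chain_measure. spec \<Lambda> w v')"
        using const sets by (intro set_lebesgue_integral_cong) auto
      also have "\<dots> = measure chain_measure A * spec \<Lambda> w v'"
        using sets by (simp add: set_integral_const emeasure_eq_measure)
      also have "\<dots> = measure chain_measure (A \<inter> C)"
        unfolding A'(1) C_def
        using chain_measure_spec_cyl[OF \<Lambda>(1) n0(1)[OF n(1)] n0(2)[OF n(1)] w A'(2)] by simp
      also have "\<dots> = (LINT \<omega>:A|chain_measure. indicat_real C \<omega>)"
        using sets C(1) by (simp add: set_lebesgue_integral_def flip: indicator_inter_arith)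
      finally show ?thesis by simp
    qed (simp add: set_lebesgue_integral_def)
  qed
  let ?X = "root_ball n0 \<inter> (S - \<Lambda>)"
  have X: "finite ?X" "?X \<subseteq> S" using finite_ball by auto
  \<comment> \<open>The configuration space is a finite disjoint union of generators at radius
    \<open>n0\<close>, so the total integrals inherit the identity from
    \<open>basic\<close>.\<close>
  have total: "(LINT \<omega>|chain_measure. indicat_real C \<omega>) = (LINT \<omega>|chain_measure. spec \<Lambda> w \<omega>)"
  proof -
    have part: "configs S = (\<Union>v\<in>configs ?X. cyl S ?X v)"
      using cyl_partition[of "{}" ?X S] X by (simp add: cyl_def)
    have bc: "cyl S ?X v \<in> ball_cyls n0 (S - \<Lambda>)" for v by (auto simp: ball_cyls_def)
    have "(LINT \<omega>|chain_measure. h \<omega>) = (\<Sum>v\<in>configs ?X. LINT \<omega>:cyl S ?X v|chain_measure. h \<omega>)"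
      if "integrable chain_measure h" for h :: "_ \<Rightarrow> real"
    proof -
      have "(LINT \<omega>|chain_measure. h \<omega>) = (LINT \<omega>:(\<Union>v\<in>configs ?X. cyl S ?X v)|chain_measure. h \<omega>)"
        unfolding part[symmetric] using set_integral_space[OF that] by (simp add: space)
      also have "\<dots> = (\<Sum>v\<in>configs ?X. LINT \<omega>:cyl S ?X v|chain_measure. h \<omega>)"
        using that basic_sets[OF bc] disjoint_family_on_cyl finite_configs[OF X(1)]
        by (intro set_integral_finite_Union) (auto intro: integrable_imp_set_integrable)
      finally show ?thesis .
    qed
    from this[OF intf] this[OF int] show ?thesis
      unfolding basic[OF bc] by (rule trans[OF _ sym])
  qed
  have "AE \<omega> in chain_measure. real_cond_exp chain_measure F (indicator C) \<omega> = spec \<Lambda> w \<omega>"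
  proof (rule real_cond_exp_charact)
    fix A assume "A \<in> sets F"
    then have "A \<in> sigma_sets (space chain_measure) (ball_cyls n0 (S - \<Lambda>))"
      unfolding F_def space using sets_coord_algebra_ball_cyls[of "S - \<Lambda>" n0] by simp
    then show "(LINT \<omega>:A|chain_measure. indicator C \<omega>) = (LINT \<omega>:A|chain_measure. spec \<Lambda> w \<omega>)"
      using set_integral_eq_generator[OF intf int Int_stable_ball_cyls _ basic total] basic_sets by auto
  qed (use intf int gF in auto)
  then show "AE \<omega> in chain_measure. real_cond_exp chain_measure (coord_algebra S (S - \<Lambda>))
         (indicator {\<omega> \<in> configs S. restrict \<omega> \<Lambda> = w}) \<omega> =
        exp (- hamiltonian S adj \<beta> \<Lambda> (merge \<Lambda> (S - \<Lambda>) (w, \<omega>))) / partition_fun S adj \<beta> \<Lambda> \<omega>"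
    using C(2) by (simp add: F_def spec_eq[OF \<Lambda>])
qed

end

section \<open>Uniqueness\<close>

context tree_ising
begin

lemma abs_bfield_le:
  assumes "\<omega> \<in> configs S" "s \<in> S"
  shows "\<bar>bfield \<Lambda> \<omega> s\<bar> \<le> real d * \<beta>"
proof -
  let ?N = "{t. adj s t \<and> t \<notin> \<Lambda>}"
  have "\<bar>\<omega> t\<bar> = 1" if "t \<in> ?N" for t
    using that assms(1) adj_in_S(2)[of s t] by (auto simp: configs_def spins_def PiE_def Pi_def)
  then have "\<bar>\<Sum>t\<in>?N. \<omega> t\<bar> \<le> real (card ?N)"
    using sum_abs[of \<omega> ?N] by simp
  also have "\<dots> \<le> real d"
    using card_mono[OF finite_nbrs[OF assms(2)], of ?N] card_nbrs[OF assms(2)] by auto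
  finally show ?thesis
    using beta_gt_0 by (simp add: bfield_def abs_mult mult.commute)
qed

text \<open>A Gibbs measure averages the finite-volume probabilities over boundary conditions. Each
  of them lies within a factor exp \<epsilon> of the probability with zero field, which is that of
  the chain; the bound is uniform and passes to the average.\<close>

lemma gibbs_cyl_bounds:
  assumes gibbs: "realizing_gibbs_measure S adj \<beta> \<nu>" and X: "X \<subseteq> root_ball n"
    and \<sigma>: "\<And>x. x \<in> X \<Longrightarrow> \<sigma> x \<in> spins"
  defines "\<epsilon> \<equiv> \<Sum>x\<in>X. 4 * real d * \<beta> * (1 / 2) ^ (n - lev x)"
  defines "p \<equiv> measure chain_measure (cyl S X \<sigma>)"
  shows "exp (- \<epsilon>) * p \<le> measure \<nu> (cyl S X \<sigma>)" "measure \<nu> (cyl S X \<sigma>) \<le> exp \<epsilon> * p"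
proof -
  interpret prob_space \<nu> using gibbs by (simp add: realizing_gibbs_measure_def)
  have sets: "sets \<nu> = sets (coord_algebra S S)"
    using gibbs sets_config_borel[OF countable_S] by (simp add: realizing_gibbs_measure_def)
  then have space: "space \<nu> = configs S"
    using sets_eq_imp_space_eq[OF sets] by simp
  define F where "F = coord_algebra S (S - root_ball n)"
  have "sets F \<subseteq> sets \<nu>"
    unfolding F_def sets using sets_coord_algebra_mono[of "S - root_ball n" S S] by auto
  then interpret finite_measure_subalgebra \<nu> F
    by unfold_locales (use space in \<open>auto simp: subalgebra_def F_def\<close>)
  note root_ball = finite_ball[of n] ball_subset_S[of n]
  have spec: "integrable \<nu> (spec (root_ball n) w)"
    "measure \<nu> (cyl S (root_ball n) w) = (\<integral>\<omega>. spec (root_ball n) w \<omega> \<partial>\<nu>)" if w: "w \<in> configs (root_ball n)" for w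
  proof -
    have C: "cyl S (root_ball n) w \<in> sets \<nu>"
      "{\<omega> \<in> configs S. restrict \<omega> (root_ball n) = w} = cyl S (root_ball n) w"
      using root_ball w cyl_coord_algebra[of "root_ball n" S S w]
      by (auto simp: sets cyl_def configs_def PiE_def extensional_def fun_eq_iff)
    have "spec (root_ball n) w \<in> borel_measurable F"
      unfolding F_def by (rule borel_measurable_spec[OF root_ball(2)])
    then have meas: "spec (root_ball n) w \<in> borel_measurable \<nu>"
      by (rule measurable_from_subalg[OF subalg])
    then show "integrable \<nu> (spec (root_ball n) w)"
      using spec_nonneg[OF root_ball(1)] spec_le_1[OF root_ball(1) w]
      by (intro integrable_const_bound[where B = 1]) auto
    have int: "integrable \<nu> (indicat_real (cyl S (root_ball n) w))"
      using C(1) by (simp add: emeasure_eq_measure)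
    have "AE \<omega> in \<nu>. real_cond_exp \<nu> F (indicator (cyl S (root_ball n) w)) \<omega> = spec (root_ball n) w \<omega>"
      using gibbs root_ball w unfolding realizing_gibbs_measure_def F_def C(2)[symmetric]
      by (simp add: spec_eq)
    then have "(\<integral>\<omega>. real_cond_exp \<nu> F (indicator (cyl S (root_ball n) w)) \<omega> \<partial>\<nu>) =
        (\<integral>\<omega>. spec (root_ball n) w \<omega> \<partial>\<nu>)"
      using meas by (intro integral_cong_AE) auto
    then show "measure \<nu> (cyl S (root_ball n) w) = (\<integral>\<omega>. spec (root_ball n) w \<omega> \<partial>\<nu>)"
      using real_cond_exp_int(2)[OF int] C(1) sets.sets_into_space[OF C(1)] by (simp add: Int_absorb2)
  qed
  let ?I = "{u \<in> configs (root_ball n). \<forall>x\<in>X. u x = \<sigma> x}"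
  define g where "g = (\<lambda>\<omega>. \<Sum>w\<in>?I. spec (root_ball n) w \<omega>)"
  have int: "integrable \<nu> g" unfolding g_def using spec(1) by (intro Bochner_Integration.integrable_sum) auto
  have "measure \<nu> (cyl S X \<sigma>) = (\<Sum>w\<in>?I. \<integral>\<omega>. spec (root_ball n) w \<omega> \<partial>\<nu>)"
    using measure_cyl_sum[OF finite_measure_axioms sets X root_ball(2,1)] spec(2) by simp
  also have "\<dots> = (\<integral>\<omega>. g \<omega> \<partial>\<nu>)"
    unfolding g_def using spec(1) by (intro Bochner_Integration.integral_sum[symmetric]) auto
  finally have eq: "measure \<nu> (cyl S X \<sigma>) = (\<integral>\<omega>. g \<omega> \<partial>\<nu>)" .
  have p: "p = cyl_sum (root_ball n) (\<lambda>_. 0) X \<sigma> / part_sum (root_ball n) (\<lambda>_. 0)"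
    unfolding p_def by (rule chain_measure_cyl[OF X])
  have pos: "cyl_sum (root_ball n) h X \<sigma> > 0" "part_sum (root_ball n) h > 0" for h
    using root_ball X \<sigma> by (auto intro!: cyl_sum_pos)
  have "exp (- \<epsilon>) * p \<le> g \<omega> \<and> g \<omega> \<le> exp \<epsilon> * p" if \<omega>: "\<omega> \<in> configs S" for \<omega>
  proof -
    define \<delta> where "\<delta> = bfield (root_ball n) \<omega>"
    have g: "g \<omega> = cyl_sum (root_ball n) \<delta> X \<sigma> / part_sum (root_ball n) \<delta>"
      by (simp add: g_def spec_def cyl_sum_def sum_divide_distrib \<delta>_def)
    \<comment> \<open>Below level \<open>n\<close> all neighbours lie in the ball, so the boundary
      field lives on the outermost sphere only.\<close>
    have "\<delta> x = 0" if "x \<in> root_ball n" "lev x < n" for x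
    proof -
      have no_nbr: "{t. adj x t \<and> t \<notin> root_ball n} = {}"
        using that lev_step[of x] adj_in_S(2)[of x] by (fastforce simp: root_ball_def)
      show ?thesis unfolding \<delta>_def bfield_def no_nbr by simp
    qed
    moreover have "\<bar>\<delta> x\<bar> \<le> real d * \<beta>" if "x \<in> root_ball n" for x
      unfolding \<delta>_def using abs_bfield_le[OF \<omega>] root_ball(2) that by blast
    ultimately have "dominates (root_ball n) (\<lambda>x. 4 * real d * \<beta> * (1 / 2) ^ (n - lev x)) \<delta>"
      by (intro dominates_boundary)
    from cyl_prob_compare[OF root_ball(1) this X \<sigma>, where h = "\<lambda>_. 0"]
    have "\<bar>ln (g \<omega>) - ln p\<bar> \<le> \<epsilon>"
      using pos by (simp add: g p \<epsilon>_def ln_divide_pos)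
    moreover have "g \<omega> > 0" "p > 0" using pos by (simp_all add: g p)
    ultimately have "ln (exp (- \<epsilon>) * p) \<le> ln (g \<omega>)" "ln (g \<omega>) \<le> ln (exp \<epsilon> * p)"
      by (simp_all add: ln_mult_pos abs_le_iff)
    then show ?thesis
      using \<open>g \<omega> > 0\<close> \<open>p > 0\<close> by simp
  qed
  then show "exp (- \<epsilon>) * p \<le> measure \<nu> (cyl S X \<sigma>)" "measure \<nu> (cyl S X \<sigma>) \<le> exp \<epsilon> * p"
    unfolding eq using int
    by (auto intro!: integral_ge_const integral_le_const AE_I2 simp: space)
qed

lemma gibbs_cyl_eq:
  assumes gibbs: "realizing_gibbs_measure S adj \<beta> \<nu>" and X: "X \<subseteq> root_ball m"
    and \<sigma>: "\<And>x. x \<in> X \<Longrightarrow> \<sigma> x \<in> spins"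
  shows "measure \<nu> (cyl S X \<sigma>) = measure chain_measure (cyl S X \<sigma>)"
proof -
  define \<epsilon> where "\<epsilon> = (\<lambda>n. \<Sum>x\<in>X. 4 * real d * \<beta> * (1 / 2) ^ (n - lev x))"
  define p where "p = measure chain_measure (cyl S X \<sigma>)"
  \<comment> \<open>Natural-number subtraction truncates, which affects only \<open>n < k\<close>;
    the shift by \<open>k\<close> removes it.\<close>
  have "(\<lambda>n. (1 / 2 :: real) ^ (n - k)) \<longlonglongrightarrow> 0" for k
    by (rule LIMSEQ_offset[of _ k]) (simp add: LIMSEQ_realpow_zero)
  then have "\<epsilon> \<longlonglongrightarrow> (\<Sum>x\<in>X. 4 * real d * \<beta> * 0)"
    unfolding \<epsilon>_def by (intro tendsto_sum tendsto_mult tendsto_const)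
  then have \<epsilon>: "\<epsilon> \<longlonglongrightarrow> 0" by simp
  have lower: "(\<lambda>n. exp (- \<epsilon> n) * p) \<longlonglongrightarrow> exp (- 0) * p"
    by (intro tendsto_intros \<epsilon>)
  have upper: "(\<lambda>n. exp (\<epsilon> n) * p) \<longlonglongrightarrow> exp 0 * p"
    by (intro tendsto_intros \<epsilon>)
  have bounds: "exp (- \<epsilon> n) * p \<le> measure \<nu> (cyl S X \<sigma>) \<and> measure \<nu> (cyl S X \<sigma>) \<le> exp (\<epsilon> n) * p"
    if "n \<ge> m" for n
    using gibbs_cyl_bounds[OF gibbs _ \<sigma>, where n = n] X ball_mono[OF that] by (auto simp: \<epsilon>_def p_def)
  have "exp (- 0) * p \<le> measure \<nu> (cyl S X \<sigma>)"
    by (rule LIMSEQ_le_const2[OF lower]) (use bounds in blast)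
  moreover have "measure \<nu> (cyl S X \<sigma>) \<le> exp 0 * p"
    by (rule LIMSEQ_le_const[OF upper]) (use bounds in blast)
  ultimately show ?thesis by (simp add: p_def)
qed

lemma gibbs_unique:
  assumes gibbs: "realizing_gibbs_measure S adj \<beta> \<nu>"
  shows "\<nu> = chain_measure"
proof -
  interpret N: prob_space \<nu> using gibbs by (simp add: realizing_gibbs_measure_def)
  interpret C: prob_space chain_measure by (rule prob_space_chain_measure)
  have sets: "sets \<nu> = sets (coord_algebra S S)"
    using gibbs sets_config_borel[OF countable_S] by (simp add: realizing_gibbs_measure_def)
  show ?thesis
  proof (rule measure_eqI_generator_eq_countable)
    show "Int_stable (ball_cyls 0 S)" by (rule Int_stable_ball_cyls)
    show "ball_cyls 0 S \<subseteq> Pow (configs S)" by (auto simp: ball_cyls_def cyl_def)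
    show "sets \<nu> = sigma_sets (configs S) (ball_cyls 0 S)"
      "sets chain_measure = sigma_sets (configs S) (ball_cyls 0 S)"
      using sets sets_coord_algebra_ball_cyls[of S 0] by simp_all
    show "emeasure \<nu> A = emeasure chain_measure A" if A: "A \<in> ball_cyls 0 S" for A
    proof -
      obtain n v where n: "A = cyl S (root_ball n) v"
        using A ball_subset_S by (auto simp: ball_cyls_def Int_absorb2)
      show ?thesis
      proof (cases "\<forall>x\<in>root_ball n. v x \<in> spins")
        case True
        then show ?thesis
          using gibbs_cyl_eq[OF gibbs, of "root_ball n" n v] n
          by (simp add: N.emeasure_eq_measure C.emeasure_eq_measure)
      next
        case False
        then obtain x where x: "x \<in> root_ball n" "v x \<notin> spins" by blast
        then have "\<omega> x \<in> spins" if "\<omega> \<in> configs S" for \<omega>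
          using that ball_subset_S by (auto simp: configs_def)
        with x have "A = {}" unfolding n cyl_def by force
        then show ?thesis by simp
      qed
    qed
    have "root_ball 0 \<inter> S \<subseteq> S" "finite (root_ball 0 \<inter> S)" using finite_ball by auto
    then show "countable (cyl S (root_ball 0 \<inter> S) ` configs (root_ball 0 \<inter> S))"
      using finite_configs by (blast intro: countable_finite)
    show "\<Union> (cyl S (root_ball 0 \<inter> S) ` configs (root_ball 0 \<inter> S)) = configs S"
      using cyl_partition[of "{}" "root_ball 0 \<inter> S" S] by (simp add: cyl_def)
    show "cyl S (root_ball 0 \<inter> S) ` configs (root_ball 0 \<inter> S) \<subseteq> ball_cyls 0 S"
      by (auto simp: ball_cyls_def)
  qed simp
qed

end

section \<open>Mixing\<close>

text \<open>The sets that can be approximated contain the algebra and are closed under complements.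
  A countable union is first cut off at finitely many sets by continuity from below.\<close>

lemma (in finite_measure) approx_by_algebra:
  assumes alg: "algebra (space M) G" and G: "G \<subseteq> sets M"
    and A: "A \<in> sigma_sets (space M) G" and e: "e > 0"
  shows "\<exists>B\<in>G. measure M ((A - B) \<union> (B - A)) < e"
  using A e
proof (induction arbitrary: e rule: sigma_sets.induct)
  case (Basic A)
  then show ?case by (intro bexI[of _ A]) auto
next
  case Empty
  then show ?case using alg by (intro bexI[of _ "{}"]) (auto simp: algebra_iff_Un)
next
  case (Compl A)
  then obtain B where B: "B \<in> G" "measure M ((A - B) \<union> (B - A)) < e" by blast
  have "A \<subseteq> space M" "B \<subseteq> space M"
    using sigma_sets_into_sp[OF _ Compl(1)] B(1) G sets.sets_into_space by blast+
  then have "(space M - A - (space M - B)) \<union> (space M - B - (space M - A)) = (A - B) \<union> (B - A)"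
    by auto
  then show ?case
    using B alg by (intro bexI[of _ "space M - B"]) (auto simp: algebra_iff_Un)
next
  case (Union A)
  have A: "A i \<in> sets M" for i using sets.sigma_sets_subset[OF G] Union(1) by blast
  let ?U = "\<lambda>n. \<Union>i<n. A i"
  have "(\<lambda>n. measure M (?U n)) \<longlonglongrightarrow> measure M (\<Union>n. ?U n)"
    using A by (intro finite_Lim_measure_incseq) (auto simp: incseq_def intro: less_le_trans)
  moreover have "(\<Union>n. ?U n) = (\<Union>i. A i)" by auto
  ultimately have "\<forall>\<^sub>F n in sequentially. measure M (\<Union>i. A i) - e / 2 < measure M (?U n)"
    using Union.prems by (intro order_tendstoD(1)) auto
  then obtain N where N: "measure M (\<Union>i. A i) - e / 2 < measure M (?U N)"
    by (auto simp: eventually_sequentially)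
  \<comment> \<open>Half of \<open>e\<close> pays for the tail of the union and the rest for
    \<open>N\<close> approximations; the \<open>+ 1\<close> keeps the quotient defined when
    \<open>N\<close> is 0 and the inequality strict.\<close>
  define e' where "e' = e / (2 * (real N + 1))"
  have e': "e' > 0" "real N * e' < e / 2"
    using Union.prems by (auto simp: e'_def field_simps)
  have "\<forall>i. \<exists>B\<in>G. measure M ((A i - B) \<union> (B - A i)) < e'"
    using Union.IH e'(1) by blast
  then obtain B where B: "\<And>i. B i \<in> G" "\<And>i. measure M ((A i - B i) \<union> (B i - A i)) < e'"
    by metis
  let ?D = "\<lambda>i. (A i - B i) \<union> (B i - A i)"
  have sets: "B i \<in> sets M" for i using B(1) G by auto
  have union: "(\<Union>i<n. B i) \<in> G" for n
  proof (induction n)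
    case 0
    then show ?case using alg by (auto simp: algebra_iff_Un)
  next
    case (Suc n)
    then show ?case using alg B(1)[of n] by (auto simp: algebra_iff_Un lessThan_Suc)
  qed
  have "measure M (((\<Union>i. A i) - (\<Union>i<N. B i)) \<union> ((\<Union>i<N. B i) - (\<Union>i. A i))) \<le>
      measure M (((\<Union>i. A i) - ?U N) \<union> (\<Union>i<N. ?D i))"
    using A sets by (intro finite_measure_mono) auto
  also have "\<dots> \<le> measure M ((\<Union>i. A i) - ?U N) + measure M (\<Union>i<N. ?D i)"
    using A sets by (intro measure_Un_le) auto
  also have "measure M ((\<Union>i. A i) - ?U N) = measure M (\<Union>i. A i) - measure M (?U N)"
    using A by (intro finite_measure_Diff) auto
  also have "measure M (\<Union>i<N. ?D i) \<le> (\<Sum>i<N. measure M (?D i))"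
    using A sets by (intro finite_measure_subadditive_finite) auto
  also have "\<dots> \<le> real N * e'"
    using B(2) sum_bounded_above[of "{..<N}" "\<lambda>i. measure M (?D i)" e'] by (simp add: less_imp_le)
  finally have "measure M (((\<Union>i. A i) - (\<Union>i<N. B i)) \<union> ((\<Union>i<N. B i) - (\<Union>i. A i))) < e"
    using N e'(2) by linarith
  then show ?case using union by blast
qed

lemma (in finite_measure) abs_measure_diff_le_symdiff:
  assumes "A \<in> sets M" "B \<in> sets M"
  shows "\<bar>measure M A - measure M B\<bar> \<le> measure M ((A - B) \<union> (B - A))"
proof -
  have "measure M A \<le> measure M (B \<union> ((A - B) \<union> (B - A)))"
    "measure M B \<le> measure M (A \<union> ((A - B) \<union> (B - A)))"
    using assms by (auto intro!: finite_measure_mono)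
  moreover have "measure M (B \<union> ((A - B) \<union> (B - A))) \<le> measure M B + measure M ((A - B) \<union> (B - A))"
    "measure M (A \<union> ((A - B) \<union> (B - A))) \<le> measure M A + measure M ((A - B) \<union> (B - A))"
    using assms by (auto intro!: measure_Un_le)
  ultimately show ?thesis by linarith
qed

text \<open>In multiplied-out form both sides are continuous in \<open>A\<close> and
  \<open>B\<close> with respect to the measure of the symmetric difference, null sets included, so
  the bound passes to limits.\<close>

lemma (in prob_space) dependence_bound_extend:
  assumes alg: "algebra (space M) G" "algebra (space M) H" and GH: "G \<subseteq> sets M" "H \<subseteq> sets M"
    and bound: "\<And>A B. A \<in> G \<Longrightarrow> B \<in> H \<Longrightarrow> \<bar>prob (A \<inter> B) - prob A * prob B\<bar> \<le> c * (prob A * prob B)"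
    and c: "c \<ge> 0"
    and A: "A \<in> sigma_sets (space M) G" and B: "B \<in> sigma_sets (space M) H"
  shows "\<bar>prob (A \<inter> B) - prob A * prob B\<bar> \<le> c * (prob A * prob B)"
proof (rule field_le_epsilon)
  fix e :: real assume "e > 0"
  \<comment> \<open>Replacing \<open>A\<close> and \<open>B\<close> costs 2 e' in the intersection,
    2 e' in the product and 2 c e' on the right-hand side.\<close>
  define e' where "e' = e / (4 + 2 * c)"
  have e': "e' > 0" "(4 + 2 * c) * e' = e" using \<open>e > 0\<close> c by (auto simp: e'_def)
  have AB: "A \<in> sets M" "B \<in> sets M" using sets.sigma_sets_subset GH A B by blast+
  obtain A' where A': "A' \<in> G" "prob ((A - A') \<union> (A' - A)) < e'"
    using approx_by_algebra[OF alg(1) GH(1) A e'(1)] by blast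
  obtain B' where B': "B' \<in> H" "prob ((B - B') \<union> (B' - B)) < e'"
    using approx_by_algebra[OF alg(2) GH(2) B e'(1)] by blast
  have s: "A' \<in> sets M" "B' \<in> sets M" using A' B' GH by auto
  have a: "\<bar>prob A - prob A'\<bar> \<le> e'" and b: "\<bar>prob B - prob B'\<bar> \<le> e'"
    using abs_measure_diff_le_symdiff[OF AB(1) s(1)] abs_measure_diff_le_symdiff[OF AB(2) s(2)] A' B'
    by linarith+
  have "\<bar>prob (A \<inter> B) - prob (A' \<inter> B')\<bar> \<le>
      prob ((A \<inter> B - A' \<inter> B') \<union> (A' \<inter> B' - A \<inter> B))"
    using AB s by (intro abs_measure_diff_le_symdiff) auto
  also have "\<dots> \<le> prob (((A - A') \<union> (A' - A)) \<union> ((B - B') \<union> (B' - B)))"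
    using AB s by (intro finite_measure_mono) auto
  also have "\<dots> \<le> prob ((A - A') \<union> (A' - A)) + prob ((B - B') \<union> (B' - B))"
    using AB s by (intro measure_Un_le) auto
  also have "\<dots> \<le> 2 * e'" using A' B' by simp
  finally have i: "\<bar>prob (A \<inter> B) - prob (A' \<inter> B')\<bar> \<le> 2 * e'" .
  have p: "\<bar>prob A * prob B - prob A' * prob B'\<bar> \<le> 2 * e'"
  proof -
    have "prob A * prob B - prob A' * prob B' = (prob A - prob A') * prob B + prob A' * (prob B - prob B')"
      by (simp add: algebra_simps)
    also have "\<bar>\<dots>\<bar> \<le> \<bar>prob A - prob A'\<bar> * prob B + prob A' * \<bar>prob B - prob B'\<bar>"
      by (rule order_trans[OF abs_triangle_ineq]) (simp add: abs_mult)
    also have "\<dots> \<le> e' * 1 + 1 * e'"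
      using a b e'(1) by (intro add_mono mult_mono) auto
    finally show ?thesis by simp
  qed
  have "\<bar>prob (A' \<inter> B') - prob A' * prob B'\<bar> \<le> c * (prob A' * prob B')"
    by (rule bound[OF A'(1) B'(1)])
  also have "\<dots> \<le> c * (prob A * prob B + 2 * e')"
    using p c by (intro mult_left_mono) auto
  finally have "\<bar>prob (A \<inter> B) - prob A * prob B\<bar> \<le> c * (prob A * prob B) + (4 + 2 * c) * e'"
    using i p by (simp add: algebra_simps abs_le_iff)
  then show "\<bar>prob (A \<inter> B) - prob A * prob B\<bar> \<le> c * (prob A * prob B) + e"
    using e'(2) by simp
qed

section \<open>From cylinders to psi-mixing of the chain measure\<close>

context tree_ising
begin

text \<open>The union is increasing in \<open>n\<close>, hence an algebra, though it need not be
  closed under countable unions.\<close>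

definition local_sets :: "'v set \<Rightarrow> ('v \<Rightarrow> real) set set" where
  "local_sets U = (\<Union>n. sets (coord_algebra S (root_ball n \<inter> U)))"

lemma local_sets_mono_ex:
  assumes "A \<in> local_sets U" "B \<in> local_sets V"
  shows "\<exists>n. A \<in> sets (coord_algebra S (root_ball n \<inter> U)) \<and> B \<in> sets (coord_algebra S (root_ball n \<inter> V))"
proof -
  obtain m n where "A \<in> sets (coord_algebra S (root_ball m \<inter> U))" "B \<in> sets (coord_algebra S (root_ball n \<inter> V))"
    using assms by (auto simp: local_sets_def)
  then show ?thesis
    using sets_coord_algebra_mono[of "root_ball m \<inter> U" "root_ball (max m n) \<inter> U" S]
      sets_coord_algebra_mono[of "root_ball n \<inter> V" "root_ball (max m n) \<inter> V" S]
      ball_mono[of m "max m n"] ball_mono[of n "max m n"]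
    by (intro exI[of _ "max m n"]) auto
qed

lemma algebra_local_sets: "algebra (configs S) (local_sets U)"
  unfolding algebra_iff_Un
proof (intro conjI ballI)
  show "local_sets U \<subseteq> Pow (configs S)"
    using sets.sets_into_space by (fastforce simp: local_sets_def)
  show "{} \<in> local_sets U" by (auto simp: local_sets_def)
next
  fix A assume "A \<in> local_sets U"
  then obtain n where "A \<in> sets (coord_algebra S (root_ball n \<inter> U))" by (auto simp: local_sets_def)
  from sets.compl_sets[OF this] have "configs S - A \<in> sets (coord_algebra S (root_ball n \<inter> U))"
    by simp
  then show "configs S - A \<in> local_sets U" by (auto simp: local_sets_def)
next
  fix A B assume "A \<in> local_sets U" "B \<in> local_sets U"
  from local_sets_mono_ex[OF this] show "A \<union> B \<in> local_sets U"
    by (auto simp: local_sets_def)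
qed

lemma sets_coord_algebra_subset_local_sets:
  assumes "U \<subseteq> S"
  shows "sets (coord_algebra S U) \<subseteq> sigma_sets (configs S) (local_sets U)"
proof -
  have "ball_cyls 0 U \<subseteq> local_sets U"
    unfolding ball_cyls_def local_sets_def using finite_ball assms
    by (auto intro!: cyl_coord_algebra)
  then show ?thesis
    unfolding sets_coord_algebra_ball_cyls[OF assms, of 0] by (rule sigma_sets_mono')
qed

lemma cyl_dependence_bound:
  assumes XY: "X \<subseteq> root_ball n" "Y \<subseteq> root_ball n" "X \<inter> Y = {}"
    and q: "2 * real d * tanh \<beta> \<le> q" "0 < q" "q \<le> 1"
    and uv: "u \<in> configs X" "v \<in> configs Y"
  defines "\<kappa> \<equiv> \<Sum>s\<in>X. \<Sum>t\<in>Y. 8 * \<beta> / q * q ^ dst s t"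
  assumes \<kappa>: "\<kappa> \<le> 1"
  defines "P \<equiv> measure chain_measure"
  shows "\<bar>P (cyl S X u \<inter> cyl S Y v) - P (cyl S X u) * P (cyl S Y v)\<bar> \<le>
    2 * \<kappa> * (P (cyl S X u) * P (cyl S Y v))"
proof -
  define \<sigma> where "\<sigma> = merge X Y (u, v)"
  let ?Z = "part_sum (root_ball n) (\<lambda>_. 0)" and ?c = "\<lambda>X. cyl_sum (root_ball n) (\<lambda>_. 0) X \<sigma>"
  note root_ball = finite_ball[of n] ball_subset_S[of n]
  have \<sigma>: "\<sigma> x \<in> spins" if "x \<in> X \<union> Y" for x
    using that uv by (auto simp: \<sigma>_def merge_def configs_def)
  have pos: "?c X > 0" "?c Y > 0" "?Z > 0"
    using root_ball XY \<sigma> by (auto intro!: cyl_sum_pos)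
  have PX: "P (cyl S X u) = ?c X / ?Z"
  proof -
    have "cyl S X u = cyl S X \<sigma>" by (auto simp: cyl_def \<sigma>_def merge_def)
    then show ?thesis unfolding P_def using chain_measure_cyl[OF XY(1)] by simp
  qed
  have PY: "P (cyl S Y v) = ?c Y / ?Z"
  proof -
    have "cyl S Y v = cyl S Y \<sigma>" using XY(3) by (auto simp: cyl_def \<sigma>_def merge_def)
    then show ?thesis unfolding P_def using chain_measure_cyl[OF XY(2)] by simp
  qed
  have PXY: "P (cyl S X u \<inter> cyl S Y v) = ?c (X \<union> Y) / ?Z"
  proof -
    have "cyl S X u \<inter> cyl S Y v = cyl S (X \<union> Y) \<sigma>"
      using XY(3) by (auto simp: cyl_def \<sigma>_def merge_def)
    then show ?thesis unfolding P_def using chain_measure_cyl[of "X \<union> Y" n] XY by simp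
  qed
  have "\<bar>?c (X \<union> Y) * ?Z / (?c X * ?c Y) - 1\<bar> \<le> 2 * \<kappa>"
    unfolding \<kappa>_def
  proof (rule cyl_sum_mixing[OF root_ball(1) XY \<sigma>])
    fix \<Gamma> h s t assume st: "s \<in> X" "t \<in> Y" "\<Gamma> \<subseteq> root_ball n - {s}" "t \<in> \<Gamma>"
    then have "finite \<Gamma>" "\<Gamma> \<subseteq> S - {s}" "s \<in> S"
      using root_ball XY finite_subset[of \<Gamma> "root_ball n"] by auto
    then show "\<bar>log_odds \<Gamma> (\<lambda>x. h x + \<beta> * of_bool (adj s x)) t -
        log_odds \<Gamma> (\<lambda>x. h x - \<beta> * of_bool (adj s x)) t\<bar> \<le> 8 * \<beta> / q * q ^ dst s t"
      using st q by (intro log_odds_point_bound)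
  qed (use \<kappa> \<kappa>_def in auto)
  \<comment> \<open>Multiplying by the product of the two marginals turns the ratio bound into a
    bound that can be summed over cylinders.\<close>
  then have "(?c X * ?c Y / (?Z * ?Z)) * \<bar>?c (X \<union> Y) * ?Z / (?c X * ?c Y) - 1\<bar> \<le>
      (?c X * ?c Y / (?Z * ?Z)) * (2 * \<kappa>)"
    using pos by (intro mult_left_mono) auto
  moreover have "(?c X * ?c Y / (?Z * ?Z)) * \<bar>?c (X \<union> Y) * ?Z / (?c X * ?c Y) - 1\<bar> =
      \<bar>?c (X \<union> Y) / ?Z - ?c X / ?Z * (?c Y / ?Z)\<bar>"
  proof -
    have "(?c X * ?c Y / (?Z * ?Z)) * \<bar>r\<bar> = \<bar>(?c X * ?c Y / (?Z * ?Z)) * r\<bar>" for r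
      using pos by (simp add: abs_mult)
    moreover have "(?c X * ?c Y / (?Z * ?Z)) * (?c (X \<union> Y) * ?Z / (?c X * ?c Y) - 1) =
        ?c (X \<union> Y) / ?Z - ?c X / ?Z * (?c Y / ?Z)"
      using pos by (simp add: field_simps)
    ultimately show ?thesis by metis
  qed
  ultimately show ?thesis by (simp add: PX PY PXY mult_ac)
qed

text \<open>\<open>A\<close> and \<open>B\<close> are finite disjoint unions of cylinders, and a
  relative error common to all pairs of cylinders is a relative error of the sum. Hence \<kappa>
  does not grow with the number of atoms.\<close>

lemma finite_dependence_bound:
  assumes XY: "X \<subseteq> root_ball n" "Y \<subseteq> root_ball n" "X \<inter> Y = {}"
    and q: "2 * real d * tanh \<beta> \<le> q" "0 < q" "q \<le> 1"
    and A: "A \<in> sets (coord_algebra S X)" and B: "B \<in> sets (coord_algebra S Y)"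
  defines "\<kappa> \<equiv> \<Sum>s\<in>X. \<Sum>t\<in>Y. 8 * \<beta> / q * q ^ dst s t"
  assumes \<kappa>: "\<kappa> \<le> 1"
  defines "P \<equiv> measure chain_measure"
  shows "\<bar>P (A \<inter> B) - P A * P B\<bar> \<le> 2 * \<kappa> * (P A * P B)"
proof -
  interpret prob_space chain_measure by (rule prob_space_chain_measure)
  define I where "I = {u \<in> configs X. cyl S X u \<subseteq> A}"
  define J where "J = {v \<in> configs Y. cyl S Y v \<subseteq> B}"
  have fin: "finite X" "finite Y" and sub: "X \<subseteq> S" "Y \<subseteq> S"
    using XY finite_subset[OF _ finite_ball] ball_subset_S[of n] by auto
  then have IJ: "finite I" "finite J"
    using finite_configs[OF fin(1)] finite_configs[OF fin(2)] by (auto simp: I_def J_def)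
  have cyls: "cyl S X u \<in> events" "cyl S Y u \<in> events" for u
    using fin sub by (auto intro!: cyl_coord_algebra)
  have A_eq: "A = (\<Union>u\<in>I. cyl S X u)" and B_eq: "B = (\<Union>v\<in>J. cyl S Y v)"
    using coord_algebra_finite_eq_cyls[OF A sub(1)] coord_algebra_finite_eq_cyls[OF B sub(2)]
    by (auto simp: I_def J_def)
  have dX: "disjoint_family_on (cyl S X) I" and dY: "disjoint_family_on (cyl S Y) J"
    using disjoint_family_on_cyl[of S X] disjoint_family_on_cyl[of S Y]
    by (auto simp: I_def J_def disjoint_family_on_def)
  have PA: "P A = (\<Sum>u\<in>I. P (cyl S X u))"
    unfolding A_eq P_def using IJ cyls dX by (intro finite_measure_finite_Union) auto
  have PB: "P B = (\<Sum>v\<in>J. P (cyl S Y v))"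
    unfolding B_eq P_def using IJ cyls dY by (intro finite_measure_finite_Union) auto
  have "A \<inter> B = (\<Union>(u, v)\<in>I \<times> J. cyl S X u \<inter> cyl S Y v)"
    unfolding A_eq B_eq by auto
  moreover have "disjoint_family_on (\<lambda>(u, v). cyl S X u \<inter> cyl S Y v) (I \<times> J)"
    unfolding disjoint_family_on_def
  proof (intro ballI impI)
    fix a b assume ab: "a \<in> I \<times> J" "b \<in> I \<times> J" "a \<noteq> b"
    then have "fst a \<noteq> fst b \<or> snd a \<noteq> snd b" by (auto simp: prod_eq_iff)
    then show "(case a of (u, v) \<Rightarrow> cyl S X u \<inter> cyl S Y v) \<inter>
        (case b of (u, v) \<Rightarrow> cyl S X u \<inter> cyl S Y v) = {}"
      using ab disjoint_family_onD[OF dX, of "fst a" "fst b"]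
        disjoint_family_onD[OF dY, of "snd a" "snd b"] by (auto simp: split_def)
  qed
  ultimately have "P (A \<inter> B) = (\<Sum>p\<in>I \<times> J. P (case p of (u, v) \<Rightarrow> cyl S X u \<inter> cyl S Y v))"
    unfolding P_def
    by (simp only:, intro finite_measure_finite_Union) (use IJ cyls in auto)
  also have "\<dots> = (\<Sum>u\<in>I. \<Sum>v\<in>J. P (cyl S X u \<inter> cyl S Y v))"
    by (simp add: sum.cartesian_product split_def)
  finally have PAB: "P (A \<inter> B) = (\<Sum>u\<in>I. \<Sum>v\<in>J. P (cyl S X u \<inter> cyl S Y v))" .
  have "P (A \<inter> B) - P A * P B =
      (\<Sum>u\<in>I. \<Sum>v\<in>J. P (cyl S X u \<inter> cyl S Y v) - P (cyl S X u) * P (cyl S Y v))"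
    by (simp add: PAB PA PB sum_product sum_subtractf)
  also have "\<bar>\<dots>\<bar> \<le> (\<Sum>u\<in>I. \<Sum>v\<in>J. \<bar>P (cyl S X u \<inter> cyl S Y v) - P (cyl S X u) * P (cyl S Y v)\<bar>)"
    by (intro order_trans[OF sum_abs] sum_mono sum_abs)
  also have "\<dots> \<le> (\<Sum>u\<in>I. \<Sum>v\<in>J. 2 * \<kappa> * (P (cyl S X u) * P (cyl S Y v)))"
    unfolding P_def \<kappa>_def using XY q \<kappa>
    by (intro sum_mono cyl_dependence_bound) (auto simp: I_def J_def \<kappa>_def)
  also have "\<dots> = 2 * \<kappa> * (P A * P B)"
    unfolding PA PB sum_product by (simp add: sum_distrib_left)
  finally show ?thesis .
qed

lemma sum_le_exp_dist_sum:
  assumes "finite X" "finite Y" "X \<subseteq> U" "Y \<subseteq> V" and q: "q = exp (- r)"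
  shows "ennreal (\<Sum>s\<in>X. \<Sum>t\<in>Y. q ^ dst s t) \<le> exp_dist_sum S adj r U V"
proof -
  have fin_le: "sum f F \<le> infsum f A" if "finite F" "F \<subseteq> A" for f :: "'v \<Rightarrow> ennreal" and F A
  proof -
    have "infsum f F \<le> infsum f A" using that by (intro infsum_mono_neutral nonneg_summable_on_complete) auto
    then show ?thesis using that(1) by simp
  qed
  have pw: "q ^ n = exp (- r * real n)" for n
    unfolding q by (simp add: exp_of_nat_mult[symmetric] mult.commute)
  have "ennreal (\<Sum>s\<in>X. \<Sum>t\<in>Y. q ^ dst s t) = (\<Sum>s\<in>X. \<Sum>t\<in>Y. ennreal (exp (- r * real (dst s t))))"
    by (simp add: pw sum_nonneg flip: sum_ennreal)
  also have "\<dots> \<le> (\<Sum>s\<in>X. \<Sum>\<^sub>\<infinity>t\<in>V. ennreal (exp (- r * real (dst s t))))"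
    using assms by (intro sum_mono fin_le)
  also have "\<dots> \<le> exp_dist_sum S adj r U V"
    unfolding exp_dist_sum_def using assms by (intro fin_le)
  finally show ?thesis .
qed

lemma chain_measure_psi_mixing:
  assumes r: "r > 0" and q: "2 * real d * tanh \<beta> \<le> exp (- r)"
  shows "psi_mixing_exp_rate S adj chain_measure r"
proof -
  interpret prob_space chain_measure by (rule prob_space_chain_measure)
  define q where "q = exp (- r)"
  \<comment> \<open>The influence bound has prefactor 8 \<beta> / q, and passing from logarithms to
    ratios doubles it.\<close>
  define C where "C = max 1 (16 * \<beta> / q)"
  have q: "2 * real d * tanh \<beta> \<le> q" "0 < q" "q \<le> 1" using r q by (auto simp: q_def)
  have space: "space chain_measure = configs S"
    using sets_eq_imp_space_eq[OF sets_chain_measure] by simp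
  have C: "C \<ge> 1" "16 * \<beta> / q \<le> C" by (auto simp: C_def)
  have "psi_coeff S chain_measure U V \<le> ennreal C * exp_dist_sum S adj r U V"
    if UV: "U \<subseteq> S" "V \<subseteq> S" and small: "ennreal C * exp_dist_sum S adj r U V < 1" for U V
  proof -
    have "1 * exp_dist_sum S adj r U V \<le> ennreal C * exp_dist_sum S adj r U V"
      using C(1) by (intro mult_right_mono) (auto simp: ennreal_ge_1)
    then have lt1: "exp_dist_sum S adj r U V < 1" using small by simp
    then obtain e where e: "exp_dist_sum S adj r U V = ennreal e" "e \<ge> 0"
      by (cases "exp_dist_sum S adj r U V") auto
    have "ennreal (C * e) < ennreal 1" using small e C(1) by (simp add: ennreal_mult)
    then have Ce: "C * e < 1"
      using ennreal_less_iff[of "C * e" 1] e(2) C(1) by (simp del: ennreal_1)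
    \<comment> \<open>A common point would be at distance 0 from itself and contribute a summand 1,
      but the sum is below 1.\<close>
    have disj: "U \<inter> V = {}"
    proof (rule ccontr)
      assume "U \<inter> V \<noteq> {}"
      then obtain x where x: "x \<in> U" "x \<in> V" by blast
      then have "ennreal (q ^ dst x x) \<le> exp_dist_sum S adj r U V"
        using sum_le_exp_dist_sum[of "{x}" "{x}" U V q r] by (simp add: q_def)
      then show False using lt1 dst_self x UV by auto
    qed
    have fin: "\<bar>prob (A \<inter> B) - prob A * prob B\<bar> \<le> C * e * (prob A * prob B)"
      if AB: "A \<in> local_sets U" "B \<in> local_sets V" for A B
    proof -
      obtain n where n: "A \<in> sets (coord_algebra S (root_ball n \<inter> U))" "B \<in> sets (coord_algebra S (root_ball n \<inter> V))"
        using local_sets_mono_ex[OF AB] by blast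
      let ?X = "root_ball n \<inter> U" and ?Y = "root_ball n \<inter> V"
      define \<kappa> where "\<kappa> = (\<Sum>s\<in>?X. \<Sum>t\<in>?Y. 8 * \<beta> / q * q ^ dst s t)"
      have "ennreal (\<Sum>s\<in>?X. \<Sum>t\<in>?Y. q ^ dst s t) \<le> ennreal e"
        unfolding e(1)[symmetric] using finite_ball by (intro sum_le_exp_dist_sum) (auto simp: q_def)
      then have "(\<Sum>s\<in>?X. \<Sum>t\<in>?Y. q ^ dst s t) \<le> e" using e(2) by simp
      then have "16 * \<beta> / q * (\<Sum>s\<in>?X. \<Sum>t\<in>?Y. q ^ dst s t) \<le> C * e"
        using C q beta_gt_0 by (intro mult_mono sum_nonneg) auto
      moreover have "2 * \<kappa> = 16 * \<beta> / q * (\<Sum>s\<in>?X. \<Sum>t\<in>?Y. q ^ dst s t)"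
        by (simp add: \<kappa>_def sum_distrib_left mult.assoc)
      ultimately have \<kappa>: "2 * \<kappa> \<le> C * e" by simp
      \<comment> \<open>Smallness \<open>C * e < 1\<close> also yields \<kappa> \<le> 1, the range
        in which the logarithmic bound can be converted.\<close>
      then have "\<bar>prob (A \<inter> B) - prob A * prob B\<bar> \<le> 2 * \<kappa> * (prob A * prob B)"
        unfolding \<kappa>_def using disj q n Ce
        by (intro finite_dependence_bound[of _ n]) (auto simp: \<kappa>_def)
      also have "\<dots> \<le> C * e * (prob A * prob B)"
        using \<kappa> by (intro mult_right_mono) auto
      finally show ?thesis .
    qed
    have local_events: "local_sets W \<subseteq> events" if "W \<subseteq> S" for W
      using that sets_coord_algebra_mono[of "root_ball n \<inter> W" S S for n] by (auto simp: local_sets_def)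
    have "ennreal \<bar>prob (A \<inter> B) / (prob A * prob B) - 1\<bar> \<le> ennreal (C * e)"
      if A: "A \<in> sets (coord_algebra S U)" and B: "B \<in> sets (coord_algebra S V)"
        and pos: "prob A * prob B > 0" for A B
    proof -
      have "\<bar>prob (A \<inter> B) - prob A * prob B\<bar> \<le> C * e * (prob A * prob B)"
      proof (rule dependence_bound_extend[OF _ _ local_events[OF UV(1)] local_events[OF UV(2)] fin])
        show "A \<in> sigma_sets (space chain_measure) (local_sets U)"
          "B \<in> sigma_sets (space chain_measure) (local_sets V)"
          using A B sets_coord_algebra_subset_local_sets UV by (auto simp: space)
      qed (use algebra_local_sets C e in \<open>auto simp: space\<close>)
      moreover have "prob (A \<inter> B) / (prob A * prob B) - 1 =
          (prob (A \<inter> B) - prob A * prob B) / (prob A * prob B)"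
        using divide_self[of "prob A * prob B"] pos by (simp only: diff_divide_distrib)
      ultimately have "\<bar>prob (A \<inter> B) / (prob A * prob B) - 1\<bar> \<le> C * e"
        using pos by (simp add: abs_divide pos_divide_le_eq)
      then show ?thesis by (rule ennreal_leI)
    qed
    then have "psi_coeff S chain_measure U V \<le> ennreal (C * e)"
      unfolding psi_coeff_def by (intro Sup_least) auto
    then show ?thesis using e C(1) by (simp add: ennreal_mult)
  qed
  then show ?thesis
    unfolding psi_mixing_exp_rate_def using r C(1) by auto
qed

end

section \<open>The temperature condition and the rate\<close>

lemma less_artanh_imp_tanh_less:
  fixes x y :: real
  assumes "x < artanh y" "0 < y" "y < 1"
  shows "tanh x < y"
proof -
  have "exp (- 2 * artanh y) = (1 - y) / (1 + y)"
    using assms by (simp add: artanh_def exp_minus)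
  moreover have "(1 - (1 - y) / (1 + y)) / (1 + (1 - y) / (1 + y)) = y"
    using assms by (simp add: field_simps)
  ultimately have "tanh (artanh y) = y"
    by (simp only: tanh_real_altdef)
  then show ?thesis
    using assms(1) tanh_real_less_iff by metis
qed

theorem corollary4p3:
  fixes d :: nat and S :: "'v set" and adj :: "'v \<Rightarrow> 'v \<Rightarrow> bool" and \<beta> :: real
  assumes "d > 2"
    and "regular_tree d S adj"
    and "\<beta> > 0"
    and "\<beta> < artanh (1 / real d ^ 4)"
  shows "\<exists>\<mu>. realizing_gibbs_measure S adj \<beta> \<mu> \<and>
           (\<forall>\<nu>. realizing_gibbs_measure S adj \<beta> \<nu> \<longrightarrow> \<nu> = \<mu>) \<and>
           psi_mixing_exp_rate S adj \<mu> (- (1 / 9) * ln (tanh \<beta>) - (4 / 9) * ln (real d))"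
proof -
  have "1 < real d ^ 4" using assms(1) by (intro one_less_power) auto
  then have "tanh \<beta> < 1 / real d ^ 4"
    using assms(1,4) by (intro less_artanh_imp_tanh_less) auto
  then have hot: "real d ^ 4 * tanh \<beta> < 1"
    using assms(1) by (simp add: field_simps)
  interpret tree_ising d S adj \<beta>
    by unfold_locales (use assms hot in auto)
  \<comment> \<open>\<open>L\<close> gathers both logarithms of the rate: r = -L / 9, and the
    temperature condition says exactly that \<open>L\<close> is negative.\<close>
  define L where "L = ln (real d ^ 4 * tanh \<beta>)"
  define r where "r = - (1 / 9) * ln (tanh \<beta>) - (4 / 9) * ln (real d)"
  have pos: "real d ^ 4 * tanh \<beta> > 0" using assms by simp
  then have "L < 0" using hot by (simp add: L_def)
  have r: "r = - L / 9"
    using assms by (simp add: r_def L_def ln_mult_pos ln_realpow field_simps)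
  have "2 * real d * tanh \<beta> \<le> exp L"
    using d_tanh_le(1) pos by (simp add: L_def)
  \<comment> \<open>As \<open>L\<close> is negative, dividing it by 9 increases it.\<close>
  also have "exp L \<le> exp (- r)" using \<open>L < 0\<close> by (simp add: r)
  finally have "psi_mixing_exp_rate S adj chain_measure r"
    using \<open>L < 0\<close> by (intro chain_measure_psi_mixing) (simp_all add: r)
  then show ?thesis
    using chain_measure_gibbs gibbs_unique unfolding r_def by blast
qed

end
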